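(* Let the integers $M\ge 2$, $1\le K\le M$ be fixed and let the number of users $N\to\infty$ in the MIMO broadcast channel described in the context, with power $P=P(N)>0$ in the high SNR regime, i.e. $P\ln N\to\infty$. Let $\mathcal{R}_{\mathrm{RBF}}$ be the average sum-rate of the Random Beam-Forming scheme in which each receive antenna is treated as a separate user. Then $$\lim_{N\to\infty}\big(\mathcal{R}_{\mathrm{Opt}}-\mathcal{R}_{\mathrm{RBF}}\big)=0\quad\text{if and only if}\quad \ln P\neq\Omega(\ln N).$$
   Context: Convention: $f(N)=\Omega(g(N))$ means $\lim_{N\to\infty}f(N)/g(N)>0$ (possibly $+\infty$); $P(N)$ is assumed to be such that $\lim_{N\to\infty}\ln P/\ln N$ exists in $[0,\infty]$, so $\ln P\neq\Omega(\ln N)$ means that this limit is $0$. Model (MIMO broadcast channel). A base station (BS) with $M$ antennas transmits to $N$ users, each with $K\le M$ antennas. User $k$ receives $\mathbf{y}_k=\mathbf{H}_k\mathbf{x}+\mathbf{n}_k$, where $\mathbf{x}\in\mathbb{C}^{M}$ satisfies $\mathbb{E}\{\mathrm{Tr}(\mathbf{x}\mathbf{x}^H)\}\le P$, $\mathbf{n}_k\sim\mathcal{CN}(\mathbf{0},\mathbf{I}_K)$, and the matrices $\mathbf{H}_k\in\mathbb{C}^{K\times M}$ are independent with i.i.d. $\mathcal{CN}(0,1)$ entries. Rates are in nats. The maximum sum-rate (perfect channel knowledge at the BS) is $\mathcal{R}_{\mathrm{Opt}}=\mathbb{E}\big\{\max\ln|\mathbf{I}_M+\sum_{n=1}^N\mathbf{H}_n^H\mathbf{Q}_n\mathbf{H}_n|\big\}$,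 the maximum being over positive semidefinite $K\times K$ matrices $\mathbf{Q}_n$ with $\sum_n\mathrm{Tr}(\mathbf{Q}_n)= P$. Random Beam-Forming: the BS constructs $M$ random orthonormal beams $\boldsymbol{\phi}_1,\dots,\boldsymbol{\phi}_M\in\mathbb{C}^M$ (independent of the channels) and sends an independent data stream of power $P/M$ on each beam. With $\mathbf{h}_{k,i}$ the $i$th row of $\mathbf{H}_k$, the signal to interference plus noise ratio of beam $m$ at antenna $i$ of user $k$ is $$\mathrm{SINR}_{k,i}^{(m)}=\frac{\frac{P}{M}|\mathbf{h}_{k,i}\boldsymbol{\phi}_m|^2}{1+\frac{P}{M}\sum_{j\ne m}|\mathbf{h}_{k,i}\boldsymbol{\phi}_j|^2}.$$ Beam $m$ is assigned to the user antenna with the largest $\mathrm{SINR}^{(m)}_{k,i}$, and $\mathcal{R}_{\mathrm{RBF}}=\mathbb{E}\big\{\sum_{m=1}^M\ln\big(1+\max_{1\le k\le N,\,1\le i\le K}\mathrm{SINR}_{k,i}^{(m)}\big)\big\}$. *)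

theory Defs
  imports "HOL-Probability.Probability"
begin

text \<open>Density, with respect to \<open>lborel\<close>, of the circularly symmetric law \<open>\<C>\<N>(0,1)\<close>: independent real and imaginary
  parts, each of variance \<open>1/2\<close>.\<close>

definition cn_density :: "complex \<Rightarrow> real" where
  "cn_density z = exp (- (cmod z)\<^sup>2) / pi"

definition conj_transpose :: "complex^'n^'m \<Rightarrow> complex^'m^'n" where
  "conj_transpose A = (\<chi> i j. cnj (A $ j $ i))"

definition pos_semidef :: "complex^'n^'n \<Rightarrow> bool" where
  "pos_semidef A \<longleftrightarrow>
     conj_transpose A = A \<and> (\<forall>x. 0 \<le> Re (\<Sum>i\<in>UNIV. cnj (x $ i) * (A *v x) $ i))"

text \<open>The beams are the rows \<open>\<Phi> $ m\<close> of the array \<open>\<Phi>\<close>.\<close>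

definition orthonormal_beams :: "complex^'m^'m \<Rightarrow> bool" where
  "orthonormal_beams \<Phi> \<longleftrightarrow>
     (\<forall>m l. (\<Sum>j\<in>UNIV. cnj (\<Phi> $ m $ j) * \<Phi> $ l $ j) = (if m = l then 1 else 0))"

text \<open>\<open>M = CARD('m)\<close> transmit antennas (and beams), \<open>K = CARD('k)\<close> antennas per user. One infinite
  sequence of users carries the channels for all \<open>N\<close>; users \<open>0, \<dots>, N - 1\<close> are those present in
  the system with \<open>N\<close> users. Only orthonormality and independence of the channels are required
  of the beams, so they may have any law, such as the isotropic one.\<close>

locale mimo_broadcast_channel = prob_space \<Omega>
  for \<Omega> :: "'w measure" +
  fixes H :: "nat \<Rightarrow> 'w \<Rightarrow> complex^'m^'k"
    and \<Phi> :: "'w \<Rightarrow> complex^'m^'m"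
  assumes channel_entries_indep:
      "indep_vars (\<lambda>_. borel) (\<lambda>(n, i, j) \<omega>. H n \<omega> $ i $ j) UNIV"
    and channel_entries_distributed:
      "\<And>n i j. distributed \<Omega> lborel (\<lambda>\<omega>. H n \<omega> $ i $ j) (\<lambda>z. ennreal (cn_density z))"
    and beams_measurable: "random_variable borel \<Phi>"
    and beams_orthonormal: "AE \<omega> in \<Omega>. orthonormal_beams (\<Phi> \<omega>)"
    and beams_indep_channels:
      "indep_set {\<Phi> -` A \<inter> space \<Omega> | A. A \<in> sets borel}
         {(\<lambda>\<omega> n. H n \<omega>) -` B \<inter> space \<Omega> | B. B \<in> sets (Pi\<^sub>M UNIV (\<lambda>_. borel))}"

definition input_covariances :: "nat \<Rightarrow> real \<Rightarrow> (nat \<Rightarrow> complex^'k^'k) set" where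
  "input_covariances N p =
     {Q. (\<forall>n<N. pos_semidef (Q n)) \<and> (\<Sum>n<N. trace (Q n)) = complex_of_real p}"

text \<open>For feasible \<open>Q\<close> the determinant is real and at least \<open>1\<close>, so \<open>Re\<close> only changes its type.
  It depends continuously on the values \<open>Q n\<close>, \<open>n < N\<close>, which range over a compact set (nonempty
  if \<open>N > 0\<close> and \<open>p \<ge> 0\<close>), so the supremum is a maximum.\<close>

definition max_sum_rate :: "nat \<Rightarrow> real \<Rightarrow> (nat \<Rightarrow> complex^'m^'k) \<Rightarrow> real" where
  "max_sum_rate N p h =
     (SUP Q\<in>input_covariances N p.
        ln (Re (det (mat 1 + (\<Sum>n<N. conj_transpose (h n) ** Q n ** h n)))))"

definition R_Opt :: "'w measure \<Rightarrow> (nat \<Rightarrow> 'w \<Rightarrow> complex^'m^'k) \<Rightarrow> nat \<Rightarrow> real \<Rightarrow> real" where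
  "R_Opt \<Omega> H N p = (LINT \<omega>|\<Omega>. max_sum_rate N p (\<lambda>n. H n \<omega>))"

definition beam_gain :: "complex^'m \<Rightarrow> complex^'m \<Rightarrow> real" where
  "beam_gain h \<phi> = (cmod (\<Sum>j\<in>UNIV. h $ j * \<phi> $ j))\<^sup>2"

definition SINR :: "real \<Rightarrow> complex^'m^'m \<Rightarrow> complex^'m \<Rightarrow> 'm \<Rightarrow> real" where
  "SINR p \<Phi> h m =
     (p / real CARD('m) * beam_gain h (\<Phi> $ m)) /
     (1 + p / real CARD('m) * (\<Sum>j\<in>UNIV - {m}. beam_gain h (\<Phi> $ j)))"

definition R_RBF ::
  "'w measure \<Rightarrow> (nat \<Rightarrow> 'w \<Rightarrow> complex^'m^'k) \<Rightarrow> ('w \<Rightarrow> complex^'m^'m) \<Rightarrow> nat \<Rightarrow> real \<Rightarrow> real" where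
  "R_RBF \<Omega> H \<Phi> N p =
     (LINT \<omega>|\<Omega>. (\<Sum>m\<in>UNIV.
        ln (1 + Max ((\<lambda>(n, i). SINR p (\<Phi> \<omega>) (H n \<omega> $ i) m) ` ({..<N} \<times> UNIV)))))"

text \<open>Here \<open>f = \<Omega>(g)\<close> means \<open>lim f/g > 0\<close>, possibly \<open>\<infinity>\<close>, which differs from the Landau symbol
  \<open>bigomega\<close> of the library.\<close>

definition Omega_lim :: "(nat \<Rightarrow> real) \<Rightarrow> (nat \<Rightarrow> real) \<Rightarrow> bool" where
  "Omega_lim f g \<longleftrightarrow> (\<exists>L::ereal. L > 0 \<and> (\<lambda>N. ereal (f N / g N)) \<longlonglongrightarrow> L)"

end

theory Submission
  imports Defs "HOL-Real_Asymp.Real_Asymp"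
begin

text \<open>
  Write \<open>A\<^sub>N = (P / M) ln N\<close>; both rates are compared with \<open>M ln A\<^sub>N\<close>. The law of the channels is invariant
  under unitary maps, so the beams may be taken to be the coordinate axes, and all signal and
  interference powers become independent standard exponential variables.

  By Hadamard's inequality and the inequality of the means, the optimal rate for given channels is at
  most \<open>M ln (1 + (P / M) max\<^sub>n \<parallel>H\<^sub>n\<parallel>\<^sup>2)\<close>, and \<open>max\<^sub>n \<parallel>H\<^sub>n\<parallel>\<^sup>2\<close> is \<open>ln N (1 + o(1))\<close> in the mean. Conversely, with
  probability \<open>1 - exp (- c N\<^sup>\<epsilon>)\<close> there is for each beam a user with signal power at least \<open>(1 - \<epsilon>) ln N\<close> and
  small interference powers; giving equal power to these users attains \<open>M ln A\<^sub>N + o(1)\<close> unless \<open>P\<close> is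
  superpolynomial. If \<open>P = N\<^bsup>o(1)\<^esup>\<close>, the interference powers can be made \<open>o(1 / P)\<close>, so random
  beam-forming attains \<open>M ln A\<^sub>N + o(1)\<close> as well. If \<open>P \<ge> N\<^sup>l\<close> with \<open>l > 0\<close>, the factor \<open>(1 + x)\<^bsup>-(M-1)\<^esup>\<close> in
  \<open>Pr (SINR > x) = exp (- x M / P) / (1 + x)\<^bsup>M-1\<^esup>\<close> keeps the largest SINR below \<open>c A\<^sub>N\<close> for some \<open>c < 1\<close>,
  which costs at least \<open>- M ln c\<close> up to \<open>o(1)\<close>.
\<close>

subsection \<open>Determinant bounds for Hermitian matrices\<close>

text \<open>The hypothesis on \<open>P N * ln N\<close> says exactly that the comparison sequence
  diverges; \<open>P\<close> itself may tend to 0. Upper bounds on mean rates rest on concavity of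
  the logarithm: a rate at most \<open>ln (1 + g)\<close> has mean at most
  \<open>ln (1 + E g)\<close>, so only means of suitable majorants \<open>g\<close> are needed.
  Lower bounds restrict the mean to a good event. Its complement is extremely unlikely, but the rate
  given up there is of order \<open>ln P\<close>, and this product need not vanish when
  \<open>P\<close> is superpolynomial. That case is treated apart: one interferer bounds the SINR by
  a ratio of two independent exponential variables, free of \<open>P\<close>, whose square root has
  finite mean. Hence beam-forming stays below \<open>2 M ln N + O(1)\<close> for every power, while
  the optimum is at least \<open>3 M ln N - O(1)\<close>. For subpolynomial \<open>P\<close> the
  decisive count is this: about \<open>N\<^sup>\<epsilon>\<close> antennas have a strong signal on a
  given beam, and asking that all \<open>M - 1\<close> interference powers be of order
  \<open>1 / P\<close> keeps a fraction of order \<open>P\<close> to the power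
  \<open>-(M - 1)\<close>, which is only \<open>N\<close> to the power \<open>-o(1)\<close>; so
  suitable users remain.\<close>

definition hermitian_form :: "complex^'n^'n \<Rightarrow> complex^'n \<Rightarrow> real" where
  "hermitian_form A x = Re (\<Sum>i\<in>UNIV. cnj (x $ i) * (A *v x) $ i)"

lemma norm_vec_power2: "(norm (x :: complex^'n))\<^sup>2 = (\<Sum>i\<in>UNIV. (cmod (x $ i))\<^sup>2)"
  by (simp add: norm_vec_def L2_set_def sum_nonneg)

lemma norm_matrix_power2:
  "(norm (A :: complex^'n^'m))\<^sup>2 = (\<Sum>i\<in>UNIV. \<Sum>j\<in>UNIV. (cmod (A $ i $ j))\<^sup>2)"
  by (simp add: norm_vec_def L2_set_def sum_nonneg)

lemma cnj_mult_self: "cnj z * z = complex_of_real ((cmod z)\<^sup>2)"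
  using complex_norm_square[of z] by (simp add: mult.commute)

lemma hermitian_form_adjoint:
  "hermitian_form (conj_transpose B ** A ** B) x = hermitian_form A (B *v x)"
proof -
  have adj: "(\<Sum>i\<in>UNIV. cnj (x $ i) * (conj_transpose B *v y) $ i)
      = (\<Sum>i\<in>UNIV. cnj ((B *v x) $ i) * y $ i)" for y
  proof -
    have "(\<Sum>i\<in>UNIV. cnj (x $ i) * (conj_transpose B *v y) $ i)
        = (\<Sum>i\<in>UNIV. \<Sum>j\<in>UNIV. cnj (x $ i) * cnj (B $ j $ i) * y $ j)"
      by (simp add: conj_transpose_def matrix_vector_mult_def sum_distrib_left mult.assoc)
    also have "\<dots> = (\<Sum>j\<in>UNIV. \<Sum>i\<in>UNIV. cnj (x $ i) * cnj (B $ j $ i) * y $ j)"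
      by (rule sum.swap)
    also have "\<dots> = (\<Sum>i\<in>UNIV. cnj ((B *v x) $ i) * y $ i)"
      by (simp add: matrix_vector_mult_def sum_distrib_left sum_distrib_right mult_ac)
    finally show ?thesis .
  qed
  have "(conj_transpose B ** A ** B) *v x = conj_transpose B *v (A *v (B *v x))"
    by (simp add: matrix_vector_mul_assoc matrix_mul_assoc)
  then show ?thesis
    unfolding hermitian_form_def by (simp add: adj)
qed

lemma hermitian_form_mat_1: "hermitian_form (mat 1) x = (norm x)\<^sup>2"
  by (simp add: hermitian_form_def norm_vec_power2 cnj_mult_self del: of_real_power)

lemma hermitian_form_add: "hermitian_form (A + B) x = hermitian_form A x + hermitian_form B x"
  by (simp add: hermitian_form_def matrix_vector_mult_add_rdistrib algebra_simps sum.distrib)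

lemma hermitian_form_sum: "hermitian_form (\<Sum>n\<in>S. A n) x = (\<Sum>n\<in>S. hermitian_form (A n) x)"
  by (induction S rule: infinite_finite_induct)
    (auto simp: hermitian_form_add, auto simp: hermitian_form_def)

lemma conj_transpose_mult: "conj_transpose (A ** B) = conj_transpose B ** conj_transpose A"
  by (simp add: vec_eq_iff conj_transpose_def matrix_matrix_mult_def mult.commute)

lemma conj_transpose_conj_transpose [simp]: "conj_transpose (conj_transpose A) = A"
  by (simp add: vec_eq_iff conj_transpose_def)

lemma conj_transpose_add: "conj_transpose (A + B) = conj_transpose A + conj_transpose B"
  by (simp add: vec_eq_iff conj_transpose_def)

lemma conj_transpose_0: "conj_transpose 0 = 0"
  by (simp add: vec_eq_iff conj_transpose_def)

lemma conj_transpose_sum: "conj_transpose (\<Sum>n\<in>S. A n) = (\<Sum>n\<in>S. conj_transpose (A n))"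
  by (induction S rule: infinite_finite_induct) (simp_all add: conj_transpose_add conj_transpose_0)

lemma conj_transpose_mat_1: "conj_transpose (mat 1) = mat 1"
  by (auto simp: vec_eq_iff conj_transpose_def mat_def)

lemma hermitian_form_axis: "hermitian_form A (axis k 1) = Re (A $ k $ k)"
proof -
  have "(\<Sum>i\<in>UNIV. cnj (axis k 1 $ i) * (A *v axis k 1) $ i)
      = (\<Sum>i\<in>UNIV. if i = k then A $ k $ k else 0)"
    by (intro sum.cong)
      (auto simp: axis_def matrix_vector_mult_def if_distrib[where f = "\<lambda>x. _ * x"] cong: if_cong)
  then show ?thesis
    by (simp add: hermitian_form_def)
qed

lemma hermitian_diagonal_real:
  assumes "conj_transpose A = A"
  shows "A $ k $ k = complex_of_real (Re (A $ k $ k))"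
proof -
  have "cnj (A $ k $ k) = A $ k $ k"
    using arg_cong[OF assms, of "\<lambda>X. X $ k $ k"] by (simp add: conj_transpose_def)
  then show ?thesis
    by (simp add: complex_eq_iff)
qed

text \<open>Multiplication from the left adds multiples of row \<open>k\<close> to all other rows at
  once, and its conjugate transpose from the right does the same for columns. One pair therefore
  eliminates a whole row and column while keeping the matrix Hermitian.\<close>

definition column_transvection :: "'n \<Rightarrow> ('n \<Rightarrow> complex) \<Rightarrow> complex^'n^'n" where
  "column_transvection k c =
     (\<chi> i j. (if i = j then 1 else 0) + (if j = k \<and> i \<noteq> k then c i else 0))"

text \<open>After transposition only row \<open>k\<close> differs from the identity, by a
  combination of the other rows, which is the situation of \<open>det_row_span\<close>.\<close>

lemma det_column_transvection: "det (column_transvection k c :: complex^'n^'n) = 1"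
proof -
  let ?I = "mat 1 :: complex^'n^'n"
  let ?x = "\<chi> i. if i = k then 0 else c i"
  have "?x = (\<Sum>i\<in>UNIV - {k}. c i *s row i ?I)"
    by (auto simp: vec_eq_iff row_def mat_def if_distrib cong: if_cong)
  also have "\<dots> \<in> vec.span {row j ?I |j. j \<noteq> k}"
    by (intro vec.span_sum vec.span_scale vec.span_base) auto
  finally have "det (\<chi> i. if i = k then row k ?I + ?x else row i ?I) = det ?I"
    by (rule det_row_span)
  also have "(\<chi> i. if i = k then row k ?I + ?x else row i ?I)
      = transpose (column_transvection k c)"
    by (auto simp: vec_eq_iff row_def mat_def transpose_def column_transvection_def)
  finally show ?thesis
    by (simp add: det_transpose)
qed

lemma det_conj_transpose_column_transvection:
  "det (conj_transpose (column_transvection k c) :: complex^'n^'n) = 1"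
proof -
  have "conj_transpose (column_transvection k c) = transpose (column_transvection k (cnj \<circ> c))"
    by (auto simp: vec_eq_iff conj_transpose_def transpose_def column_transvection_def)
  then show ?thesis
    by (simp add: det_transpose det_column_transvection)
qed

lemma column_transvection_mult:
  "(column_transvection k c ** A) $ i $ j = A $ i $ j + (if i = k then 0 else c i * A $ k $ j)"
proof -
  have "(column_transvection k c ** A) $ i $ j =
      (\<Sum>l\<in>UNIV. (if i = l then A $ l $ j else 0) + (if l = k \<and> i \<noteq> k then c i * A $ l $ j else 0))"
    by (auto simp: column_transvection_def matrix_matrix_mult_def algebra_simps intro!: sum.cong)
  then show ?thesis
    by (simp add: sum.distrib)
qed

lemma mult_conj_transpose_column_transvection:
  "(A ** conj_transpose (column_transvection k c)) $ i $ j
     = A $ i $ j + (if j = k then 0 else cnj (c j) * A $ i $ k)"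
proof -
  have "(A ** conj_transpose (column_transvection k c)) $ i $ j =
      (\<Sum>l\<in>UNIV. (if l = j then A $ i $ l else 0) + (if l = k \<and> j \<noteq> k then cnj (c j) * A $ i $ l else 0))"
    by (auto simp: column_transvection_def conj_transpose_def matrix_matrix_mult_def algebra_simps
        intro!: sum.cong)
  then show ?thesis
    by (simp add: sum.distrib)
qed

text \<open>Coordinate \<open>k\<close> decouples from the rest. This is the shape of the matrix
  after row and column \<open>k\<close> have been eliminated.\<close>

lemma hermitian_form_isolated:
  fixes B :: "complex^'n^'n"
  assumes z: "\<And>i. i \<noteq> k \<Longrightarrow> B $ i $ k = 0" "\<And>i. i \<noteq> k \<Longrightarrow> B $ k $ i = 0"
  shows "hermitian_form B x = Re (B $ k $ k) * (cmod (x $ k))\<^sup>2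
           + hermitian_form B (\<chi> i. if i = k then 0 else x $ i)"
proof -
  let ?y = "\<chi> i. if i = k then 0 else x $ i"
  have Bx: "(B *v x) $ k = B $ k $ k * x $ k"
    unfolding matrix_vector_mult_def using z(2)
    by (simp, subst sum.remove[of _ k]) auto
  have By: "(B *v ?y) $ i = (B *v x) $ i" if "i \<noteq> k" for i
    unfolding matrix_vector_mult_def using z(1)[OF that] by (auto intro!: sum.cong)
  have "(\<Sum>i\<in>UNIV. cnj (x $ i) * (B *v x) $ i)
      = cnj (x $ k) * (B *v x) $ k + (\<Sum>i\<in>UNIV - {k}. cnj (x $ i) * (B *v x) $ i)"
    by (subst sum.remove[of _ k]) auto
  also have "(\<Sum>i\<in>UNIV - {k}. cnj (x $ i) * (B *v x) $ i) = (\<Sum>i\<in>UNIV - {k}. cnj (?y $ i) * (B *v ?y) $ i)"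
    by (intro sum.cong) (auto simp: By)
  also have "\<dots> = (\<Sum>i\<in>UNIV. cnj (?y $ i) * (B *v ?y) $ i)"
    by (subst (2) sum.remove[of _ k]) auto
  also have "cnj (x $ k) * (B *v x) $ k = B $ k $ k * complex_of_real ((cmod (x $ k))\<^sup>2)"
    unfolding Bx cnj_mult_self[symmetric] by simp
  finally show ?thesis
    by (simp add: hermitian_form_def del: of_real_power)
qed

text \<open>Symmetric Gaussian elimination without eigenvalues. \<open>T\<close> holds the indices
  that may still carry off-diagonal entries, and each induction step clears one of them. The step
  preserves the determinant and the lower bound \<open>c\<close> of the form and does not increase
  the diagonal, so both inequalities pass back from the diagonal case.\<close>

lemma det_hermitian_bounds_aux:
  fixes A :: "complex^'n^'n"
  assumes "finite T" "conj_transpose A = A" "\<And>x. c * (norm x)\<^sup>2 \<le> hermitian_form A x" "c > 0"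
    and "\<And>i j. i \<noteq> j \<Longrightarrow> i \<notin> T \<or> j \<notin> T \<Longrightarrow> A $ i $ j = 0"
  shows "\<exists>d. det A = complex_of_real d \<and> c ^ CARD('n) \<le> d \<and> d \<le> (\<Prod>i\<in>UNIV. Re (A $ i $ i))"
  using assms
proof (induction T arbitrary: A rule: finite_induct)
  case empty
  have "det A = (\<Prod>i\<in>UNIV. A $ i $ i)"
    by (rule det_diagonal) (use empty in auto)
  also have "\<dots> = complex_of_real (\<Prod>i\<in>UNIV. Re (A $ i $ i))"
    using hermitian_diagonal_real[OF empty(1)] by (simp add: of_real_prod)
  finally have d: "det A = complex_of_real (\<Prod>i\<in>UNIV. Re (A $ i $ i))" .
  have "c \<le> Re (A $ i $ i)" for i
    using empty(2)[of "axis i 1"] by (simp add: hermitian_form_axis norm_axis_1)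
  then have "(\<Prod>i\<in>(UNIV::'n set). c) \<le> (\<Prod>i\<in>UNIV. Re (A $ i $ i))"
    using \<open>c > 0\<close> by (intro prod_mono) auto
  with d show ?case
    by (intro exI[of _ "\<Prod>i\<in>UNIV. Re (A $ i $ i)"]) simp
next
  case (insert k T)
  define a where "a = Re (A $ k $ k)"
  have akk: "A $ k $ k = complex_of_real a"
    unfolding a_def by (rule hermitian_diagonal_real[OF insert.prems(1)])
  have diag: "c \<le> Re (A $ i $ i)" for i
    using insert.prems(2)[of "axis i 1"] by (simp add: hermitian_form_axis norm_axis_1)
  have a: "a > 0"
    using diag[of k] insert.prems(3) by (simp add: a_def)
  have herm: "cnj (A $ i $ j) = A $ j $ i" for i j
    using arg_cong[OF insert.prems(1), of "\<lambda>X. X $ j $ i"] by (simp add: conj_transpose_def)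
  \<comment> \<open>Chosen so that adding \<open>e i\<close> times the pivot row cancels the entry
    of row \<open>i\<close> in column \<open>k\<close>.\<close>
  define e where "e i = - A $ i $ k / complex_of_real a" for i
  define E where "E = column_transvection k e"
  define B where "B = E ** A ** conj_transpose E"
  have detB: "det B = det A"
    by (simp add: B_def E_def det_mul det_column_transvection
        det_conj_transpose_column_transvection)
  have hermB: "conj_transpose B = B"
    by (simp add: B_def conj_transpose_mult insert.prems(1) matrix_mul_assoc)
  \<comment> \<open>Away from row and column \<open>k\<close> this is the Schur complement of the
    pivot \<open>a\<close>.\<close>
  have B_entry: "B $ i $ j = (if i = k \<or> j = k then if i = j then complex_of_real a else 0
       else A $ i $ j - A $ i $ k * A $ k $ j / complex_of_real a)" for i j
    using a by (cases "i = k"; cases "j = k")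
      (simp_all add: B_def E_def mult_conj_transpose_column_transvection column_transvection_mult
        e_def akk herm)
  \<comment> \<open>The pivot is at least \<open>c\<close>. On the remaining coordinates the form of
    \<open>B\<close> is the form of \<open>A\<close> at \<open>?z\<close>, which agrees with
    \<open>x\<close> except in coordinate \<open>k\<close>, so its norm is no smaller than that of
    the remaining part of \<open>x\<close>.\<close>
  have formB: "c * (norm x)\<^sup>2 \<le> hermitian_form B x" for x
  proof -
    let ?y = "\<chi> i. if i = k then 0 else x $ i"
    let ?z = "conj_transpose E *v ?y"
    have "hermitian_form B x = a * (cmod (x $ k))\<^sup>2 + hermitian_form B ?y"
      by (subst hermitian_form_isolated[of k]) (auto simp: B_entry)
    moreover have "hermitian_form B ?y = hermitian_form A ?z"
      unfolding B_def using hermitian_form_adjoint[of "conj_transpose E" A ?y] by simp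
    moreover have "c * (norm ?z)\<^sup>2 \<le> hermitian_form A ?z"
      by (rule insert.prems(2))
    moreover have "c * (\<Sum>i\<in>UNIV - {k}. (cmod (x $ i))\<^sup>2) \<le> c * (norm ?z)\<^sup>2"
    proof (intro mult_left_mono)
      have "?z $ i = x $ i" if "i \<noteq> k" for i
      proof -
        have "?z $ i = (\<Sum>j\<in>UNIV. if j = i then x $ i else 0)"
          unfolding matrix_vector_mult_def conj_transpose_def E_def column_transvection_def
            vec_lambda_beta
          using that by (intro sum.cong) auto
        then show ?thesis
          by simp
      qed
      then have "(\<Sum>i\<in>UNIV - {k}. (cmod (x $ i))\<^sup>2) = (\<Sum>i\<in>UNIV - {k}. (cmod (?z $ i))\<^sup>2)"
        by (intro sum.cong) auto
      also have "\<dots> \<le> (norm ?z)\<^sup>2"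
        unfolding norm_vec_power2 by (intro sum_mono2) auto
      finally show "(\<Sum>i\<in>UNIV - {k}. (cmod (x $ i))\<^sup>2) \<le> (norm ?z)\<^sup>2" .
    qed (use insert.prems(3) in simp)
    moreover have "c * (cmod (x $ k))\<^sup>2 \<le> a * (cmod (x $ k))\<^sup>2"
      using diag[of k] by (intro mult_right_mono) (auto simp: a_def)
    moreover have "(norm x)\<^sup>2 = (cmod (x $ k))\<^sup>2 + (\<Sum>i\<in>UNIV - {k}. (cmod (x $ i))\<^sup>2)"
      unfolding norm_vec_power2 by (subst sum.remove[of _ k]) auto
    ultimately show ?thesis
      by (simp add: algebra_simps)
  qed
  \<comment> \<open>A fill-in term \<open>A $ i $ k * A $ k $ j\<close> needs both \<open>i\<close>
    and \<open>j\<close> linked to \<open>k\<close>, so elimination creates no entries outside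
    \<open>T\<close>.\<close>
  have zeroB: "B $ i $ j = 0" if "i \<noteq> j" "i \<notin> T \<or> j \<notin> T" for i j
    using insert.prems(4)[of i j] insert.prems(4)[of i k] insert.prems(4)[of k j] that
    by (auto simp: B_entry)
  obtain d where d: "det B = complex_of_real d" "c ^ CARD('n) \<le> d" "d \<le> (\<Prod>i\<in>UNIV. Re (B $ i $ i))"
    using insert.IH[OF hermB formB insert.prems(3) zeroB] by blast
  have "(\<Prod>i\<in>UNIV. Re (B $ i $ i)) \<le> (\<Prod>i\<in>UNIV. Re (A $ i $ i))"
  proof (intro prod_mono conjI)
    fix i
    have "c \<le> Re (B $ i $ i)"
      using formB[of "axis i 1"] by (simp add: hermitian_form_axis norm_axis_1)
    then show "0 \<le> Re (B $ i $ i)"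
      using insert.prems(3) by simp
    have "A $ i $ k * A $ k $ i = complex_of_real ((cmod (A $ k $ i))\<^sup>2)"
      using cnj_mult_self[of "A $ k $ i"] herm[of k i] by simp
    then have "Re (A $ i $ k * A $ k $ i / complex_of_real a) = (cmod (A $ k $ i))\<^sup>2 / a"
      by (metis Re_complex_of_real of_real_divide)
    then show "Re (B $ i $ i) \<le> Re (A $ i $ i)"
      using a by (cases "i = k") (simp_all add: B_entry a_def)
  qed
  with d detB show ?case
    by auto
qed

lemma det_hermitian_bounds:
  fixes A :: "complex^'n^'n"
  assumes "conj_transpose A = A" "\<And>x. c * (norm x)\<^sup>2 \<le> hermitian_form A x" "c > 0"
  shows "c ^ CARD('n) \<le> Re (det A)" "Re (det A) \<le> (\<Prod>i\<in>UNIV. Re (A $ i $ i))"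
  using det_hermitian_bounds_aux[of UNIV A c, OF _ assms] by auto

subsection \<open>The maximum sum rate of given channels\<close>

lemma pos_semidef_iff_hermitian_form:
  "pos_semidef A \<longleftrightarrow> conj_transpose A = A \<and> (\<forall>x. 0 \<le> hermitian_form A x)"
  by (simp add: pos_semidef_def hermitian_form_def)

text \<open>The difference of the two sides is half the sum, over all pairs \<open>i, j\<close>, of the values of
  the form at the vectors \<open>- cnj (v $ j) e\<^sub>i + cnj (v $ i) e\<^sub>j\<close>.\<close>

lemma hermitian_form_le_trace:
  fixes Q :: "complex^'n^'n"
  assumes "pos_semidef Q"
  shows "hermitian_form Q v \<le> Re (trace Q) * (norm v)\<^sup>2"
proof -
  define x :: "'n \<Rightarrow> 'n \<Rightarrow> complex^'n" where
    "x i j = (\<chi> l. (if l = i then - cnj (v $ j) else 0) + (if l = j then cnj (v $ i) else 0))" for i j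
  define T where "T i j = cnj (v $ j) * v $ j * Q $ i $ i + cnj (v $ i) * v $ i * Q $ j $ j
      - cnj (v $ i) * Q $ i $ j * v $ j - cnj (v $ j) * Q $ j $ i * v $ i" for i j
  have Qx: "(Q *v x i j) $ a = - Q $ a $ i * cnj (v $ j) + Q $ a $ j * cnj (v $ i)" for i j a
  proof -
    have "(Q *v x i j) $ a
        = (\<Sum>l\<in>UNIV. (if l = i then - Q $ a $ i * cnj (v $ j) else 0)
            + (if l = j then Q $ a $ j * cnj (v $ i) else 0))"
      unfolding matrix_vector_mult_def x_def vec_lambda_beta
      by (intro sum.cong) (auto simp: algebra_simps)
    then show ?thesis
      by (simp add: sum.distrib)
  qed
  have "(\<Sum>a\<in>UNIV. cnj (x i j $ a) * (Q *v x i j) $ a) = T i j" for i j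
  proof -
    have "(\<Sum>a\<in>UNIV. cnj (x i j $ a) * (Q *v x i j) $ a)
        = (\<Sum>a\<in>UNIV. (if a = i then - v $ j * (Q *v x i j) $ i else 0)
            + (if a = j then v $ i * (Q *v x i j) $ j else 0))"
      unfolding x_def vec_lambda_beta by (intro sum.cong) (auto simp: algebra_simps)
    then show ?thesis
      by (simp add: sum.distrib Qx T_def algebra_simps)
  qed
  then have "hermitian_form Q (x i j) = Re (T i j)" for i j
    by (simp add: hermitian_form_def)
  then have "0 \<le> Re (T i j)" for i j
    using assms unfolding pos_semidef_iff_hermitian_form by metis
  then have "0 \<le> Re (\<Sum>i\<in>UNIV. \<Sum>j\<in>UNIV. T i j)"
    by (simp add: sum_nonneg)
  also have "(\<Sum>i\<in>UNIV. \<Sum>j\<in>UNIV. T i j)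
      = 2 * (trace Q * (\<Sum>j\<in>UNIV. cnj (v $ j) * v $ j))
        - 2 * (\<Sum>i\<in>UNIV. cnj (v $ i) * (Q *v v) $ i)"
  proof -
    have 1: "(\<Sum>i\<in>UNIV. \<Sum>j\<in>UNIV. cnj (v $ j) * v $ j * Q $ i $ i)
        = trace Q * (\<Sum>j\<in>UNIV. cnj (v $ j) * v $ j)"
      by (simp add: trace_def sum_product mult.commute)
    have 2: "(\<Sum>i\<in>UNIV. \<Sum>j\<in>UNIV. cnj (v $ i) * v $ i * Q $ j $ j)
        = trace Q * (\<Sum>j\<in>UNIV. cnj (v $ j) * v $ j)"
      by (subst sum.swap) (rule 1)
    have 3: "(\<Sum>i\<in>UNIV. \<Sum>j\<in>UNIV. cnj (v $ i) * Q $ i $ j * v $ j)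
        = (\<Sum>i\<in>UNIV. cnj (v $ i) * (Q *v v) $ i)"
      by (simp add: matrix_vector_mult_def sum_distrib_left mult.assoc)
    have 4: "(\<Sum>i\<in>UNIV. \<Sum>j\<in>UNIV. cnj (v $ j) * Q $ j $ i * v $ i)
        = (\<Sum>i\<in>UNIV. cnj (v $ i) * (Q *v v) $ i)"
      by (subst sum.swap) (rule 3)
    show ?thesis
      unfolding T_def sum.distrib sum_subtractf 1 2 3 4 by simp
  qed
  also have "(\<Sum>j\<in>UNIV. cnj (v $ j) * v $ j) = complex_of_real ((norm v)\<^sup>2)"
    by (simp add: cnj_mult_self norm_vec_power2 del: of_real_power)
  finally show ?thesis
    unfolding hermitian_form_def by (simp del: of_real_power)
qed

lemma trace_pos_semidef_nonneg: "pos_semidef Q \<Longrightarrow> 0 \<le> Re (trace Q)"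
  unfolding pos_semidef_iff_hermitian_form trace_def
  by (auto simp: hermitian_form_axis[symmetric] intro!: sum_nonneg)

section \<open>Log-determinants of admissible input covariances\<close>

definition rate_matrix ::
  "nat \<Rightarrow> (nat \<Rightarrow> complex^'m^'k) \<Rightarrow> (nat \<Rightarrow> complex^'k^'k) \<Rightarrow> complex^'m^'m" where
  "rate_matrix N h Q = mat 1 + (\<Sum>n<N. conj_transpose (h n) ** Q n ** h n)"

lemma max_sum_rate_eq:
  "max_sum_rate N p h = (SUP Q\<in>input_covariances N p. ln (Re (det (rate_matrix N h Q))))"
  by (simp add: max_sum_rate_def rate_matrix_def)

lemma input_covariances_trace:
  assumes "Q \<in> input_covariances N p"
  shows "(\<Sum>n<N. Re (trace (Q n))) = p"
proof -
  have "Re (\<Sum>n<N. trace (Q n)) = p"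
    using assms by (simp add: input_covariances_def)
  then show ?thesis
    by simp
qed

lemma conj_transpose_rate_matrix:
  assumes "Q \<in> input_covariances N p"
  shows "conj_transpose (rate_matrix N h Q) = rate_matrix N h Q"
  using assms
  by (simp add: rate_matrix_def conj_transpose_add conj_transpose_sum conj_transpose_mult
      conj_transpose_mat_1 matrix_mul_assoc input_covariances_def pos_semidef_def)

lemma hermitian_form_rate_matrix:
  "hermitian_form (rate_matrix N h Q) x = (norm x)\<^sup>2 + (\<Sum>n<N. hermitian_form (Q n) (h n *v x))"
  by (simp add: rate_matrix_def hermitian_form_add hermitian_form_mat_1 hermitian_form_sum
      hermitian_form_adjoint)

lemma hermitian_form_rate_matrix_ge:
  assumes "Q \<in> input_covariances N p"
  shows "(norm x)\<^sup>2 \<le> hermitian_form (rate_matrix N h Q) x"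
  using assms
  by (auto simp: hermitian_form_rate_matrix input_covariances_def pos_semidef_iff_hermitian_form
      intro!: sum_nonneg)

lemma det_rate_matrix_ge_1:
  assumes "Q \<in> input_covariances N p"
  shows "1 \<le> Re (det (rate_matrix N h Q))"
  using det_hermitian_bounds(1)[OF conj_transpose_rate_matrix[OF assms, of h], of 1]
    hermitian_form_rate_matrix_ge[OF assms, of _ h]
  by simp

text \<open>The inequality of the means in logarithmic form, from the tangent of \<open>ln\<close>
  at \<open>w\<close>. An upper bound \<open>w\<close> of the mean serves as well as the mean
  itself.\<close>

lemma sum_ln_le:
  fixes b :: "'i \<Rightarrow> real"
  assumes "finite S" "\<And>i. i \<in> S \<Longrightarrow> 0 < b i" "w > 0" "(\<Sum>i\<in>S. b i) \<le> real (card S) * w"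
  shows "(\<Sum>i\<in>S. ln (b i)) \<le> real (card S) * ln w"
proof -
  have "ln (b i) \<le> b i / w - 1 + ln w" if "i \<in> S" for i
    using ln_le_minus_one[of "b i / w"] assms(2)[OF that] assms(3) by (simp add: ln_div)
  then have "(\<Sum>i\<in>S. ln (b i)) \<le> (\<Sum>i\<in>S. b i / w - 1 + ln w)"
    by (rule sum_mono)
  also have "\<dots> = (\<Sum>i\<in>S. b i) / w - real (card S) + real (card S) * ln w"
    by (simp add: sum.distrib sum_subtractf sum_divide_distrib)
  also have "(\<Sum>i\<in>S. b i) / w \<le> real (card S)"
    using assms(3,4) by (simp add: divide_le_eq)
  finally show ?thesis
    by simp
qed

text \<open>The trace is controlled by the power: summing \<open>hermitian_form_le_trace\<close>
  over the coordinate axes weights \<open>trace (Q n)\<close> with the squared Frobenius norm of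
  \<open>h n\<close>, so the trace is at most \<open>M + p * v\<close>. Hadamard's inequality and
  \<open>sum_ln_le\<close> turn this into the bound on the determinant.\<close>

lemma ln_det_rate_matrix_le:
  fixes h :: "nat \<Rightarrow> complex^'m^'k"
  assumes Q: "Q \<in> input_covariances N p" and v: "\<And>n. n < N \<Longrightarrow> (norm (h n))\<^sup>2 \<le> v"
    and "0 \<le> p" "0 \<le> v"
  shows "ln (Re (det (rate_matrix N h Q))) \<le> real CARD('m) * ln (1 + p / real CARD('m) * v)"
proof -
  let ?B = "rate_matrix N h Q"
  have psd: "pos_semidef (Q n)" if "n < N" for n
    using Q that by (simp add: input_covariances_def)
  have diag: "Re (?B $ i $ i) = hermitian_form ?B (axis i 1)" for i
    by (simp add: hermitian_form_axis)
  have pos: "1 \<le> Re (?B $ i $ i)" for i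
    using hermitian_form_rate_matrix_ge[OF Q, of "axis i 1" h] by (simp add: diag norm_axis_1)
  have nonzero: "Re (?B $ i $ i) \<noteq> 0" for i
    using pos[of i] by linarith
  have "(\<Sum>i\<in>UNIV. Re (?B $ i $ i))
      = real CARD('m) + (\<Sum>i\<in>UNIV. \<Sum>n<N. hermitian_form (Q n) (h n *v axis i 1))"
    by (simp add: diag hermitian_form_rate_matrix norm_axis_1 sum.distrib)
  also have "(\<Sum>i\<in>UNIV. \<Sum>n<N. hermitian_form (Q n) (h n *v axis i 1))
      \<le> (\<Sum>i\<in>(UNIV::'m set). \<Sum>n<N. Re (trace (Q n)) * (norm (h n *v axis i 1))\<^sup>2)"
    using psd by (intro sum_mono hermitian_form_le_trace) auto
  also have "\<dots> = (\<Sum>n<N. Re (trace (Q n)) * (\<Sum>i\<in>(UNIV::'m set). (norm (h n *v axis i 1))\<^sup>2))"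
    by (subst sum.swap) (simp add: sum_distrib_left)
  also have "\<dots> = (\<Sum>n<N. Re (trace (Q n)) * (norm (h n))\<^sup>2)"
  proof (intro sum.cong refl arg_cong2[where f = "(*)"])
    fix n
    have "(h n *v axis i 1) $ k = h n $ k $ i" for i k
      by (simp add: matrix_vector_mult_def axis_def if_distrib cong: if_cong)
    then have "(\<Sum>i\<in>(UNIV::'m set). (norm (h n *v axis i 1))\<^sup>2)
        = (\<Sum>i\<in>UNIV. \<Sum>k\<in>UNIV. (cmod (h n $ k $ i))\<^sup>2)"
      by (simp add: norm_vec_power2)
    also have "\<dots> = (norm (h n))\<^sup>2"
      unfolding norm_matrix_power2 by (rule sum.swap)
    finally show "(\<Sum>i\<in>(UNIV::'m set). (norm (h n *v axis i 1))\<^sup>2) = (norm (h n))\<^sup>2" .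
  qed
  also have "\<dots> \<le> (\<Sum>n<N. Re (trace (Q n)) * v)"
    using psd v by (intro sum_mono mult_left_mono trace_pos_semidef_nonneg) auto
  also have "\<dots> = p * v"
    using input_covariances_trace[OF Q] by (simp flip: sum_distrib_right)
  finally have tr: "(\<Sum>i\<in>UNIV. Re (?B $ i $ i)) \<le> real CARD('m) * (1 + p / real CARD('m) * v)"
    by (simp add: algebra_simps)
  have "ln (Re (det ?B)) \<le> ln (\<Prod>i\<in>UNIV. Re (?B $ i $ i))"
    using det_hermitian_bounds(2)[OF conj_transpose_rate_matrix[OF Q], of 1]
      hermitian_form_rate_matrix_ge[OF Q] det_rate_matrix_ge_1[OF Q, of h]
    by (subst ln_le_cancel_iff) (auto intro!: prod_pos less_le_trans[OF _ pos])
  also have "\<dots> = (\<Sum>i\<in>UNIV. ln (Re (?B $ i $ i)))"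
    by (intro ln_prod) (simp_all add: nonzero)
  also have "\<dots> \<le> real CARD('m) * ln (1 + p / real CARD('m) * v)"
    using tr assms(3,4)
    by (intro sum_ln_le) (auto intro: less_le_trans[OF zero_less_one pos] add_pos_nonneg)
  finally show ?thesis .
qed

text \<open>Needed to work with the supremum over the reals; for this the crude choice of
  \<open>v\<close> as the sum of all squared norms is enough.\<close>

lemma bdd_above_ln_det_rate_matrix:
  fixes h :: "nat \<Rightarrow> complex^'m^'k"
  assumes "0 \<le> p"
  shows "bdd_above ((\<lambda>Q. ln (Re (det (rate_matrix N h Q)))) ` input_covariances N p)"
proof (intro bdd_aboveI2)
  fix Q :: "nat \<Rightarrow> complex^'k^'k"
  assume Q: "Q \<in> input_covariances N p"
  show "ln (Re (det (rate_matrix N h Q)))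
      \<le> real CARD('m) * ln (1 + p / real CARD('m) * (\<Sum>n<N. (norm (h n))\<^sup>2))"
    by (intro ln_det_rate_matrix_le[OF Q] member_le_sum[of _ "{..<N}" "\<lambda>n. (norm (h n))\<^sup>2"] sum_nonneg)
      (use assms in auto)
qed

lemma max_sum_rate_ge:
  assumes "Q \<in> input_covariances N p" "0 \<le> p"
  shows "ln (Re (det (rate_matrix N h Q))) \<le> max_sum_rate N p h"
  unfolding max_sum_rate_eq using assms by (intro cSUP_upper bdd_above_ln_det_rate_matrix)

text \<open>Each index \<open>m\<close> gives the share \<open>p / M\<close> to antenna
  \<open>i0\<close> of user \<open>\<sigma> m\<close>. Shares of a user chosen repeatedly
  accumulate, so \<open>\<sigma>\<close> may be any map and distinctness of the selected users never
  has to be shown.\<close>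

lemma selected_antenna_in_input_covariances:
  fixes \<sigma> :: "'m::finite \<Rightarrow> nat" and i0 :: "'k::finite"
  assumes "\<And>m. \<sigma> m < N" "0 \<le> p"
  defines "Q \<equiv> \<lambda>n. \<chi> i j. if i = i0 \<and> j = i0
     then complex_of_real (\<Sum>m\<in>UNIV. if \<sigma> m = n then p / real CARD('m) else 0) else 0"
  shows "Q \<in> input_covariances N p"
    and "(\<Sum>n<N. hermitian_form (Q n) (y n)) = p / real CARD('m) * (\<Sum>m\<in>UNIV. (cmod (y (\<sigma> m) $ i0))\<^sup>2)"
proof -
  define w where "w n = (\<Sum>m\<in>UNIV. if \<sigma> m = n then p / real CARD('m) else 0)" for n
  have w: "0 \<le> w n" for n
    using assms(2) by (auto simp: w_def intro!: sum_nonneg)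
  have sum_w: "(\<Sum>n<N. w n * f n) = p / real CARD('m) * (\<Sum>m\<in>UNIV. f (\<sigma> m))" for f :: "nat \<Rightarrow> real"
  proof -
    have "(\<Sum>n<N. w n * f n) = (\<Sum>n<N. \<Sum>m\<in>UNIV. if \<sigma> m = n then p / real CARD('m) * f n else 0)"
      by (auto simp: w_def sum_distrib_right if_distrib[of "\<lambda>x. x * _"] intro!: sum.cong cong: if_cong)
    also have "\<dots> = (\<Sum>m\<in>UNIV. \<Sum>n<N. if \<sigma> m = n then p / real CARD('m) * f n else 0)"
      by (rule sum.swap)
    also have "\<dots> = (\<Sum>m\<in>UNIV. p / real CARD('m) * f (\<sigma> m))"
      using assms(1) by (intro sum.cong) auto
    finally show ?thesis
      by (simp add: sum_distrib_left)
  qed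
  have Q_eq: "Q n $ i $ j = (if i = i0 \<and> j = i0 then complex_of_real (w n) else 0)" for n i j
    by (simp add: Q_def w_def)
  have Qy: "(Q n *v x) $ i = (if i = i0 then complex_of_real (w n) * x $ i0 else 0)" for n x i
    unfolding matrix_vector_mult_def
    by (simp add: Q_eq if_distrib[of "\<lambda>x. x * _"] cong: if_cong)
  have form: "hermitian_form (Q n) x = w n * (cmod (x $ i0))\<^sup>2" for n x
  proof -
    have "(\<Sum>i\<in>UNIV. cnj (x $ i) * (Q n *v x) $ i)
        = (\<Sum>i\<in>UNIV. if i = i0 then complex_of_real (w n) * (cnj (x $ i0) * x $ i0) else 0)"
      by (intro sum.cong) (auto simp: Qy)
    then show ?thesis
      unfolding hermitian_form_def by (simp add: cnj_mult_self del: of_real_power)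
  qed
  show "(\<Sum>n<N. hermitian_form (Q n) (y n))
      = p / real CARD('m) * (\<Sum>m\<in>UNIV. (cmod (y (\<sigma> m) $ i0))\<^sup>2)"
    by (simp add: form sum_w)
  have "pos_semidef (Q n)" for n
    using w[of n] by (auto simp: pos_semidef_iff_hermitian_form form vec_eq_iff conj_transpose_def Q_eq)
  moreover have "trace (Q n) = complex_of_real (w n)" for n
    by (simp add: trace_def Q_eq cong: if_cong)
  moreover have "(\<Sum>n<N. w n) = p"
    using sum_w[of "\<lambda>_. 1"] by simp
  ultimately show "Q \<in> input_covariances N p"
    by (simp add: input_covariances_def flip: of_real_sum)
qed

lemma input_covariances_nonempty:
  assumes "0 < N" "0 \<le> p"
  shows "(input_covariances N p :: (nat \<Rightarrow> complex^'k^'k) set) \<noteq> {}"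
  \<comment> \<open>With the index type \<open>unit\<close> there is a single share, and user 0
    receives the whole power.\<close>
  using selected_antenna_in_input_covariances(1)[of "\<lambda>_::unit. 0" N p] assms by blast

lemma max_sum_rate_nonneg:
  fixes h :: "nat \<Rightarrow> complex^'m^'k"
  assumes "0 < N" "0 \<le> p"
  shows "0 \<le> max_sum_rate N p h"
proof -
  obtain Q :: "nat \<Rightarrow> complex^'k^'k" where Q: "Q \<in> input_covariances N p"
    using input_covariances_nonempty[OF assms] by blast
  show ?thesis
    using max_sum_rate_ge[OF Q assms(2), of h] det_rate_matrix_ge_1[OF Q, of h]
    by (meson ln_ge_zero order_trans)
qed

lemma max_sum_rate_le:
  fixes h :: "nat \<Rightarrow> complex^'m^'k"
  assumes "0 < N" "0 \<le> p" "0 \<le> v" "\<And>n. n < N \<Longrightarrow> (norm (h n))\<^sup>2 \<le> v"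
  shows "max_sum_rate N p h \<le> real CARD('m) * ln (1 + p / real CARD('m) * v)"
  unfolding max_sum_rate_eq
  by (intro cSUP_least input_covariances_nonempty ln_det_rate_matrix_le) (use assms in auto)

text \<open>One antenna each of \<open>M\<close> users, the channel of the \<open>m\<close>-th of them being nearly parallel to the
  \<open>m\<close>-th coordinate axis: the matrix of the selected channels is diagonally dominant.\<close>

lemma norm_diagonally_dominant_ge:
  fixes R :: "complex^'m^'m"
  assumes diag: "\<And>m. s \<le> cmod (R $ m $ m)" and off: "\<And>m j. j \<noteq> m \<Longrightarrow> cmod (R $ m $ j) \<le> 1"
    and "0 \<le> s"
  shows "(s - (real CARD('m))\<^sup>2) * norm x \<le> norm (R *v x)"
proof -
  define D where "D = (\<chi> m. R $ m $ m * x $ m)"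
  define E where "E = (\<chi> m. \<Sum>j\<in>UNIV - {m}. R $ m $ j * x $ j)"
  have "(R *v x) $ m = (D + E) $ m" for m
    unfolding matrix_vector_mult_def D_def E_def vector_add_component vec_lambda_beta
    by (rule sum.remove) auto
  then have "R *v x = D + E"
    by (simp add: vec_eq_iff)
  then have "norm D \<le> norm (R *v x) + norm E"
    using norm_triangle_ineq4[of "D + E" E] by simp
  moreover have "s * norm x \<le> norm D"
  proof (rule power2_le_imp_le)
    have "(s * norm x)\<^sup>2 = (\<Sum>m\<in>UNIV. (s * cmod (x $ m))\<^sup>2)"
      by (simp add: power_mult_distrib norm_vec_power2 sum_distrib_left)
    also have "\<dots> \<le> (norm D)\<^sup>2"
      unfolding norm_vec_power2 D_def using \<open>0 \<le> s\<close> diag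
      by (intro sum_mono power_mono) (auto simp: norm_mult intro!: mult_right_mono)
    finally show "(s * norm x)\<^sup>2 \<le> (norm D)\<^sup>2" .
  qed auto
  moreover have "norm E \<le> (real CARD('m))\<^sup>2 * norm x"
  proof -
    have "cmod (E $ m) \<le> real CARD('m) * norm x" for m
    proof -
      have "cmod (E $ m) \<le> (\<Sum>j\<in>UNIV - {m}. cmod (R $ m $ j * x $ j))"
        unfolding E_def vec_lambda_beta by (rule norm_sum)
      also have "\<dots> \<le> (\<Sum>j\<in>UNIV - {m}. norm x)"
        using mult_mono[OF off Finite_Cartesian_Product.norm_nth_le] by (intro sum_mono) (auto simp: norm_mult)
      also have "\<dots> \<le> real CARD('m) * norm x"
        by (simp add: mult_right_mono card_Diff_subset)
      finally show ?thesis .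
    qed
    then have "norm E \<le> (\<Sum>m\<in>(UNIV::'m set). real CARD('m) * norm x)"
      unfolding norm_vec_def[of E] by (intro order_trans[OF L2_set_le_sum] sum_mono) auto
    then show ?thesis
      by (simp add: power2_eq_square)
  qed
  ultimately show ?thesis
    by (simp add: algebra_simps)
qed

text \<open>Equal shares contribute \<open>p / M\<close> times the squared norm of
  \<open>R *v x\<close> to the form, and diagonal dominance bounds that norm below in every
  direction. The form is thus at least \<open>?c\<close> times the squared norm, and
  \<open>det_hermitian_bounds\<close> yields the \<open>M\<close>-th power of
  \<open>?c\<close>.\<close>

lemma max_sum_rate_ge_selection:
  fixes h :: "nat \<Rightarrow> complex^'m^'k" and i0 :: 'k
  assumes \<sigma>: "\<And>m. \<sigma> m < N" and diag: "\<And>m. s \<le> cmod (h (\<sigma> m) $ i0 $ m)"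
    and off: "\<And>m j. j \<noteq> m \<Longrightarrow> cmod (h (\<sigma> m) $ i0 $ j) \<le> 1"
    and s: "(real CARD('m))\<^sup>2 \<le> s" and p: "0 \<le> p"
  shows "real CARD('m) * ln (1 + p / real CARD('m) * (s - (real CARD('m))\<^sup>2)\<^sup>2) \<le> max_sum_rate N p h"
proof -
  let ?c = "1 + p / real CARD('m) * (s - (real CARD('m))\<^sup>2)\<^sup>2"
  define R where "R = (\<chi> m j. h (\<sigma> m) $ i0 $ j)"
  define Q :: "nat \<Rightarrow> complex^'k^'k" where "Q = (\<lambda>n. \<chi> i j. if i = i0 \<and> j = i0
     then complex_of_real (\<Sum>m\<in>UNIV. if \<sigma> m = n then p / real CARD('m) else 0) else 0)"
  have Q: "Q \<in> input_covariances N p"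
    unfolding Q_def by (rule selected_antenna_in_input_covariances(1)[OF \<sigma> p])
  have c: "?c > 0"
    using p by (simp add: add_pos_nonneg)
  have form: "?c * (norm x)\<^sup>2 \<le> hermitian_form (rate_matrix N h Q) x" for x
  proof -
    have "(\<Sum>m\<in>UNIV. (cmod ((h (\<sigma> m) *v x) $ i0))\<^sup>2) = (norm (R *v x))\<^sup>2"
      by (simp add: norm_vec_power2 R_def matrix_vector_mult_def)
    then have "hermitian_form (rate_matrix N h Q) x
        = (norm x)\<^sup>2 + p / real CARD('m) * (norm (R *v x))\<^sup>2"
      unfolding hermitian_form_rate_matrix Q_def
      by (simp add: selected_antenna_in_input_covariances(2)[OF \<sigma> p])
    moreover have "((s - (real CARD('m))\<^sup>2) * norm x)\<^sup>2 \<le> (norm (R *v x))\<^sup>2"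
      using diag off s
      by (intro power_mono norm_diagonally_dominant_ge) (auto simp: R_def intro: order_trans[OF zero_le_power2])
    then have "p / real CARD('m) * ((s - (real CARD('m))\<^sup>2) * norm x)\<^sup>2
        \<le> p / real CARD('m) * (norm (R *v x))\<^sup>2"
      using p by (intro mult_left_mono) auto
    ultimately show ?thesis
      by (simp only: power_mult_distrib distrib_right mult_1 mult.assoc add_left_mono)
  qed
  have "real CARD('m) * ln ?c = ln (?c ^ CARD('m))"
    using c by (simp add: ln_realpow)
  also have "\<dots> \<le> ln (Re (det (rate_matrix N h Q)))"
    using det_hermitian_bounds(1)[OF conj_transpose_rate_matrix[OF Q] form c] c
    by (intro ln_mono) auto
  also have "\<dots> \<le> max_sum_rate N p h"
    by (rule max_sum_rate_ge[OF Q p])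
  finally show ?thesis .
qed

lemma continuous_on_det_rate_matrix:
  "continuous_on UNIV (\<lambda>h. Re (det (rate_matrix N h Q)))"
proof -
  have [continuous_intros]: "continuous_on UNIV (\<lambda>h :: nat \<Rightarrow> complex^'m^'k. h n)" for n
    by (rule continuous_on_product_coordinates)
  show ?thesis
    unfolding det_def rate_matrix_def matrix_matrix_mult_def conj_transpose_def mat_def
      vector_add_component sum_component vec_lambda_beta
    by (intro continuous_intros)
qed

text \<open>A supremum of continuous functions is lower semicontinuous, so no countable dense set of
  covariances is needed.\<close>

lemma borel_measurable_max_sum_rate:
  assumes "0 < N" "0 \<le> p"
  shows "(max_sum_rate N p :: (nat \<Rightarrow> complex^'m^'k) \<Rightarrow> real) \<in> borel_measurable borel"
proof (rule borel_measurableI_greater)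
  fix c :: real
  have "{h :: nat \<Rightarrow> complex^'m^'k. c < max_sum_rate N p h}
      = (\<Union>Q\<in>input_covariances N p. {h. c < ln (Re (det (rate_matrix N h Q)))})"
    unfolding max_sum_rate_eq
    using less_cSUP_iff[OF input_covariances_nonempty[OF assms] bdd_above_ln_det_rate_matrix[OF assms(2)]]
    by auto
  also have "open \<dots>"
  proof (intro open_UN ballI open_Collect_less continuous_on_const continuous_on_ln
      continuous_on_det_rate_matrix)
    fix Q h
    assume "Q \<in> input_covariances N p"
    then show "Re (det (rate_matrix N h Q)) \<noteq> 0"
      using det_rate_matrix_ge_1[of Q N p h] by auto
  qed
  finally show "{h :: nat \<Rightarrow> complex^'m^'k. h \<in> space borel \<and> c < max_sum_rate N p h} \<in> sets borel"
    by (simp add: borel_open)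
qed

subsection \<open>Complex Gaussian vectors\<close>

lemma nn_integral_lborel_translate:
  fixes a :: "'a::euclidean_space"
  assumes [measurable]: "g \<in> borel_measurable borel"
  shows "(\<integral>\<^sup>+x. g (x + a) \<partial>lborel) = (\<integral>\<^sup>+x. g x \<partial>lborel)"
proof -
  have "(\<integral>\<^sup>+x. g x \<partial>lborel) = (\<integral>\<^sup>+x. g x \<partial>distr lborel borel ((+) a))"
    by (simp add: lborel_distr_plus)
  also have "\<dots> = (\<integral>\<^sup>+x. g (a + x) \<partial>lborel)"
    by (intro nn_integral_distr) auto
  finally show ?thesis
    by (simp add: add.commute)
qed

text \<open>Uniqueness of translation invariant measures: both \<open>\<mu>(A) \<lambda>(B)\<close> and \<open>\<lambda>(A) \<mu>(B)\<close> are the integral of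
  \<open>1\<^sub>A(x + y) 1\<^sub>B(y)\<close> when \<open>B\<close> is symmetric. The unit ball \<open>B\<close> has the same measure for both.\<close>

lemma distr_lborel_orthogonal_transformation:
  fixes f :: "'a::euclidean_space \<Rightarrow> 'a"
  assumes f: "orthogonal_transformation f"
  shows "distr lborel borel f = lborel"
proof (rule measure_eqI)
  have lin: "linear f" and norm_f: "\<And>x. norm (f x) = norm x"
    using f by (auto simp: orthogonal_transformation)
  have [measurable]: "f \<in> borel_measurable borel"
    using lin by (intro borel_measurable_continuous_onI linear_continuous_on linear_conv_bounded_linear[THEN iffD1])
  obtain g where g: "\<And>x. f (g x) = x"
    using orthogonal_transformation_surj[OF f] by (metis surjD)
  show "sets (distr lborel borel f) = sets lborel"
    by simp
  fix A :: "'a set"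
  assume "A \<in> sets (distr lborel borel f)"
  then have [measurable]: "A \<in> sets borel"
    by simp
  define B :: "'a set" where "B = ball 0 1"
  have [measurable]: "B \<in> sets borel"
    by (simp add: B_def)
  have ball: "emeasure lborel (ball c 1 :: 'a set) = emeasure lborel B" for c
    by (simp add: emeasure_ball B_def)
  have B0: "emeasure lborel B \<noteq> 0" "emeasure lborel B \<noteq> \<infinity>"
    using unit_ball_vol_pos[of "real DIM('a)", THEN less_imp_neq]
    by (auto simp: emeasure_ball B_def)
  have "emeasure (distr lborel borel f) A * emeasure lborel B
      = (\<integral>\<^sup>+y. indicator B y * (\<integral>\<^sup>+u. indicator A (f u) \<partial>lborel) \<partial>lborel)"
  proof -
    have "(\<integral>\<^sup>+u. indicator A (f u) \<partial>lborel) = emeasure (distr lborel borel f) A"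
      using nn_integral_distr[of f lborel borel "indicator A"] by simp
    then show ?thesis
      by (simp add: nn_integral_multc mult.commute)
  qed
  also have "\<dots> = (\<integral>\<^sup>+y. indicator B y * (\<integral>\<^sup>+u. indicator A (f u + y) \<partial>lborel) \<partial>lborel)"
  proof (rule nn_integral_cong, rule arg_cong2[where f = "(*)", OF refl])
    fix y
    have "f (u + g y) = f u + y" for u
      using linear_add[OF lin] g by simp
    then show "(\<integral>\<^sup>+u. indicator A (f u) \<partial>lborel) = (\<integral>\<^sup>+u. indicator A (f u + y) \<partial>lborel)"
      using nn_integral_lborel_translate[of "\<lambda>u. indicator A (f u)" "g y"] by simp
  qed
  also have "\<dots> = (\<integral>\<^sup>+y. (\<integral>\<^sup>+u. indicator B y * indicator A (f u + y) \<partial>lborel) \<partial>lborel)"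
    by (simp add: nn_integral_cmult)
  also have "\<dots> = (\<integral>\<^sup>+u. (\<integral>\<^sup>+y. indicator B y * indicator A (f u + y) \<partial>lborel) \<partial>lborel)"
    by (rule lborel_pair.Fubini') measurable
  also have "\<dots> = (\<integral>\<^sup>+u. (\<integral>\<^sup>+y. indicator B (y - f u) * indicator A y \<partial>lborel) \<partial>lborel)"
  proof (rule nn_integral_cong)
    fix u
    show "(\<integral>\<^sup>+y. indicator B y * indicator A (f u + y) \<partial>lborel)
        = (\<integral>\<^sup>+y. indicator B (y - f u) * indicator A y \<partial>lborel)"
      using nn_integral_lborel_translate[of "\<lambda>y. indicator B y * indicator A (f u + y)" "- f u"]
      by simp
  qed
  also have "\<dots> = (\<integral>\<^sup>+y. (\<integral>\<^sup>+u. indicator B (y - f u) * indicator A y \<partial>lborel) \<partial>lborel)"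
    by (rule lborel_pair.Fubini') measurable
  also have "\<dots> = (\<integral>\<^sup>+y. emeasure lborel B * indicator A y \<partial>lborel)"
  proof (rule nn_integral_cong)
    fix y
    have "norm (y - f u) = dist (g y) u" for u
    proof -
      have "y - f u = f (g y - u)"
        using linear_diff[OF lin] g by simp
      then show ?thesis
        by (simp add: norm_f dist_norm)
    qed
    then have "indicator B (y - f u) = (indicator (ball (g y) 1) u :: ennreal)" for u
      by (simp add: B_def indicator_def norm_minus_commute flip: dist_norm)
    then show "(\<integral>\<^sup>+u. indicator B (y - f u) * indicator A y \<partial>lborel)
        = emeasure lborel B * indicator A y"
      by (simp only: nn_integral_multc borel_measurable_indicator sets_lborel borel_open open_ball
          nn_integral_indicator ball)
  qed
  also have "\<dots> = emeasure lborel A * emeasure lborel B"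
    by (subst nn_integral_cmult) (simp_all add: mult.commute)
  finally have "emeasure (distr lborel borel f) A * emeasure lborel B / emeasure lborel B
      = emeasure lborel A * emeasure lborel B / emeasure lborel B"
    by simp
  then show "emeasure (distr lborel borel f) A = emeasure lborel A"
    using B0 by (simp add: ennreal_mult_divide_eq)
qed

section \<open>The squared modulus of a complex Gaussian is exponential\<close>

lemma nn_integral_exp_atLeast: "(\<integral>\<^sup>+s. ennreal (exp (- s)) * indicator {a..} s \<partial>lborel) = ennreal (exp (- a))"
proof -
  have "(\<integral>\<^sup>+s. ennreal (exp (- s)) * indicator {a..} s \<partial>lborel) = ennreal (0 - (- exp (- a)))"
  proof (rule nn_integral_FTC_atLeast)
    show "((\<lambda>s::real. - exp (- s)) \<longlongrightarrow> 0) at_top"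
      using tendsto_minus[OF filterlim_compose[OF exp_at_bot filterlim_uminus_at_bot_at_top]] by simp
  qed (auto intro!: derivative_eq_intros)
  then show ?thesis
    by simp
qed

lemma emeasure_complex_annulus:
  assumes "0 \<le> a" "a \<le> s"
  shows "emeasure lborel {z::complex. a < (cmod z)\<^sup>2 \<and> (cmod z)\<^sup>2 \<le> s} = ennreal (pi * (s - a))"
proof -
  have cmod_le: "cmod z \<le> sqrt t \<longleftrightarrow> (cmod z)\<^sup>2 \<le> t" for z t
    using real_sqrt_le_iff[of "(cmod z)\<^sup>2" t] by simp
  have "{z::complex. a < (cmod z)\<^sup>2 \<and> (cmod z)\<^sup>2 \<le> s} = cball 0 (sqrt s) - cball 0 (sqrt a)"
    using cmod_le by auto
  then have "emeasure lborel {z::complex. a < (cmod z)\<^sup>2 \<and> (cmod z)\<^sup>2 \<le> s}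
      = emeasure lborel (cball 0 (sqrt s) :: complex set) - emeasure lborel (cball 0 (sqrt a) :: complex set)"
    using assms emeasure_lborel_cball_finite[of "0::complex" "sqrt a"]
    by (simp add: emeasure_Diff less_top[symmetric] subset_cball)
  also have "\<dots> = ennreal (pi * s) - ennreal (pi * a)"
    using assms by (simp add: emeasure_cball unit_ball_vol_2)
  finally show ?thesis
    using assms by (simp add: ennreal_minus right_diff_distrib)
qed

lemma borel_measurable_cn_density [measurable]: "cn_density \<in> borel_measurable borel"
  unfolding cn_density_def by measurable

text \<open>A layer-cake argument in place of polar coordinates:
  \<open>exp (- (cmod z)\<^sup>2)\<close> is the integral of \<open>exp (- s)\<close> over
  \<open>s\<close> beyond \<open>(cmod z)\<^sup>2\<close>, and exchanging the integrals leaves areas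
  of annuli, which are linear in \<open>s\<close>.\<close>

lemma emeasure_cn_density_tail:
  assumes a: "0 \<le> a"
  shows "emeasure (density lborel (\<lambda>z. ennreal (cn_density z))) {z. a < (cmod z)\<^sup>2} = ennreal (exp (- a))"
proof -
  have cn: "ennreal (cn_density z)
      = (\<integral>\<^sup>+s. ennreal (1 / pi) * (ennreal (exp (- s)) * indicator {(cmod z)\<^sup>2..} s) \<partial>lborel)" for z
    by (subst nn_integral_cmult) (simp_all add: nn_integral_exp_atLeast cn_density_def flip: ennreal_mult)
  have "emeasure (density lborel (\<lambda>z. ennreal (cn_density z))) {z. a < (cmod z)\<^sup>2}
      = (\<integral>\<^sup>+z. ennreal (cn_density z) * indicator {z. a < (cmod z)\<^sup>2} z \<partial>lborel)"
    by (rule emeasure_density) auto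
  also have "\<dots> = (\<integral>\<^sup>+z. (\<integral>\<^sup>+s. ennreal (1 / pi) * (ennreal (exp (- s)) * indicator {(cmod z)\<^sup>2..} s)
      * indicator {z. a < (cmod z)\<^sup>2} z \<partial>lborel) \<partial>lborel)"
    unfolding cn by (simp add: nn_integral_multc)
  also have "\<dots> = (\<integral>\<^sup>+s. (\<integral>\<^sup>+z. ennreal (1 / pi) * (ennreal (exp (- s)) * indicator {(cmod z)\<^sup>2..} s)
      * indicator {z. a < (cmod z)\<^sup>2} z \<partial>lborel) \<partial>lborel)"
    by (rule lborel_pair.Fubini') (simp add: indicator_def)
  \<comment> \<open>What remains is the first moment of the standard exponential law, shifted by
    \<open>a\<close>. The factor \<open>s - a\<close> comes from the area of the annulus.\<close>
  also have "\<dots> = (\<integral>\<^sup>+s. ennreal (exp (- a)) * ennreal (erlang_density 0 1 (s - a) * (s - a) ^ 1) \<partial>lborel)"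
  proof (rule nn_integral_cong)
    fix s :: real
    have "(\<integral>\<^sup>+z. ennreal (1 / pi) * (ennreal (exp (- s)) * indicator {(cmod z)\<^sup>2..} s)
          * indicator {z. a < (cmod z)\<^sup>2} z \<partial>lborel)
        = (\<integral>\<^sup>+z. ennreal (exp (- s) / pi) * indicator {z. a < (cmod z)\<^sup>2 \<and> (cmod z)\<^sup>2 \<le> s} z \<partial>lborel)"
      by (intro nn_integral_cong) (auto simp: indicator_def ennreal_mult' [symmetric])
    also have "\<dots> = ennreal (exp (- s) / pi) * emeasure lborel {z::complex. a < (cmod z)\<^sup>2 \<and> (cmod z)\<^sup>2 \<le> s}"
      by (simp add: nn_integral_cmult)
    also have "\<dots> = ennreal (exp (- a)) * ennreal (erlang_density 0 1 (s - a) * (s - a) ^ 1)"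
    proof (cases "a \<le> s")
      case True
      then have "ennreal (exp (- s) / pi) * emeasure lborel {z::complex. a < (cmod z)\<^sup>2 \<and> (cmod z)\<^sup>2 \<le> s}
          = ennreal (exp (- s) * (s - a))"
        using a by (simp add: emeasure_complex_annulus flip: ennreal_mult)
      moreover have "exp (- a) * exp (a - s) = exp (- s)"
        by (simp flip: exp_add)
      ultimately show ?thesis
        using True by (simp add: erlang_density_def flip: ennreal_mult mult.assoc)
    next
      case False
      then have "{z::complex. a < (cmod z)\<^sup>2 \<and> (cmod z)\<^sup>2 \<le> s} = {}"
        by auto
      then have "emeasure lborel {z::complex. a < (cmod z)\<^sup>2 \<and> (cmod z)\<^sup>2 \<le> s} = 0"
        by (simp only: emeasure_empty)
      with False show ?thesis
        by (simp add: erlang_density_def)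
    qed
    finally show "(\<integral>\<^sup>+z. ennreal (1 / pi) * (ennreal (exp (- s)) * indicator {(cmod z)\<^sup>2..} s)
          * indicator {z. a < (cmod z)\<^sup>2} z \<partial>lborel)
        = ennreal (exp (- a)) * ennreal (erlang_density 0 1 (s - a) * (s - a) ^ 1)" .
  qed
  also have "\<dots> = ennreal (exp (- a)) * (\<integral>\<^sup>+s. ennreal (erlang_density 0 1 (s - a) * (s - a) ^ 1) \<partial>lborel)"
    by (rule nn_integral_cmult) simp
  also have "(\<integral>\<^sup>+s. ennreal (erlang_density 0 1 (s - a) * (s - a) ^ 1) \<partial>lborel) = 1"
    using nn_integral_lborel_translate[of "\<lambda>s. ennreal (erlang_density 0 1 s * s ^ 1)" "- a"]
      nn_integral_erlang_ith_moment[of 1 0 1] by simp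
  finally show ?thesis
    by simp
qed

lemma (in prob_space) exponential_distributed_cmod_power2:
  assumes X: "distributed M lborel X (\<lambda>z. ennreal (cn_density z))"
  shows "distributed M lborel (\<lambda>\<omega>. (cmod (X \<omega>))\<^sup>2) (exponential_density 1)"
proof (rule exponential_distributedI)
  have [measurable]: "random_variable borel X"
    using distributed_measurable[OF X] by simp
  show "(\<lambda>\<omega>. (cmod (X \<omega>))\<^sup>2) \<in> borel_measurable M"
    by measurable
  fix a :: real
  assume a: "0 \<le> a"
  have "prob {\<omega> \<in> space M. a < (cmod (X \<omega>))\<^sup>2} = exp (- a)"
  proof -
    have "emeasure M {\<omega> \<in> space M. a < (cmod (X \<omega>))\<^sup>2} = emeasure (distr M lborel X) {z. a < (cmod z)\<^sup>2}"
      by (subst emeasure_distr) (simp_all add: vimage_def Int_def conj_commute)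
    also have "\<dots> = ennreal (exp (- a))"
      by (simp add: distributed_distr_eq_density[OF X] emeasure_cn_density_tail a)
    finally show ?thesis
      by (simp add: measure_def)
  qed
  moreover have "prob {\<omega> \<in> space M. (cmod (X \<omega>))\<^sup>2 \<le> a} = 1 - prob {\<omega> \<in> space M. a < (cmod (X \<omega>))\<^sup>2}"
    using prob_neg[of "\<lambda>\<omega>. a < (cmod (X \<omega>))\<^sup>2"] by (simp add: not_less)
  ultimately show "emeasure M {\<omega> \<in> space M. (cmod (X \<omega>))\<^sup>2 \<le> a} = 1 - ennreal (exp (- a * 1))"
    using a by (simp add: emeasure_eq_measure ennreal_minus flip: ennreal_1)
qed simp

section \<open>Isotropy of complex Gaussian vectors\<close>

lemma borel_measurable_vecI:
  fixes f :: "'a \<Rightarrow> 'b::euclidean_space^'n"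
  assumes "\<And>i. (\<lambda>x. f x $ i) \<in> borel_measurable M"
  shows "f \<in> borel_measurable M"
proof (subst borel_measurable_euclidean_space, rule ballI)
  fix b :: "'b^'n"
  assume "b \<in> Basis"
  then obtain i u where "b = axis i u"
    by (auto simp: Basis_vec_def)
  then show "(\<lambda>x. f x \<bullet> b) \<in> borel_measurable M"
    using assms[of i] by (simp add: inner_axis)
qed

lemma borel_measurable_vec_nth [measurable (raw)]:
  fixes f :: "'a \<Rightarrow> 'b::euclidean_space^'n"
  assumes "f \<in> borel_measurable M"
  shows "(\<lambda>x. f x $ i) \<in> borel_measurable M"
  by (rule measurable_compose[OF assms borel_measurable_continuous_onI]) (intro continuous_intros)

text \<open>Bridge between two views of a vector: independence produces product measures on
  families, while rotation invariance concerns Lebesgue measure on a Euclidean space. It suffices to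
  compare the two on boxes.\<close>

lemma lborel_vec_eq_distr:
  "distr (Pi\<^sub>M (UNIV::'n::finite set) (\<lambda>_. lborel :: 'b::euclidean_space measure)) borel (\<lambda>f. \<chi> j. f j) = lborel"
proof (rule lborel_eqI[symmetric])
  interpret product_sigma_finite "\<lambda>_::'n. lborel :: 'b measure" ..
  have [measurable]: "(\<lambda>f. \<chi> j. f j) \<in> Pi\<^sub>M (UNIV::'n set) (\<lambda>_. lborel :: 'b measure) \<rightarrow>\<^sub>M borel"
    by (rule borel_measurable_vecI) simp
  fix l u :: "'b^'n"
  assume le: "\<And>b. b \<in> Basis \<Longrightarrow> l \<bullet> b \<le> u \<bullet> b"
  have le': "l $ i \<bullet> b \<le> u $ i \<bullet> b" if "b \<in> Basis" for i b
    using le[of "axis i b"] that by (simp add: inner_axis)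
  have box_iff: "x \<in> box l u \<longleftrightarrow> (\<forall>i. x $ i \<in> box (l $ i) (u $ i))" for x
    by (auto simp: mem_box Basis_vec_def inner_axis)
  have "emeasure (distr (Pi\<^sub>M (UNIV::'n set) (\<lambda>_. lborel :: 'b measure)) borel (\<lambda>f. \<chi> j. f j)) (box l u)
      = emeasure (Pi\<^sub>M UNIV (\<lambda>_. lborel)) (Pi\<^sub>E UNIV (\<lambda>i. box (l $ i) (u $ i)))"
    by (subst emeasure_distr) (auto simp: box_iff space_PiM PiE_UNIV_domain Pi_iff intro!: arg_cong[where f = "emeasure _"])
  also have "\<dots> = (\<Prod>i\<in>UNIV. emeasure lborel (box (l $ i) (u $ i)))"
    by (rule emeasure_PiM) auto
  also have "\<dots> = (\<Prod>i\<in>UNIV. ennreal (\<Prod>b\<in>Basis. (u $ i - l $ i) \<bullet> b))"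
    using le' by (simp add: emeasure_lborel_box)
  also have "\<dots> = ennreal (\<Prod>i\<in>UNIV. \<Prod>b\<in>Basis. (u $ i - l $ i) \<bullet> b)"
    using le' by (intro prod_ennreal prod_nonneg) (auto simp: inner_diff_left)
  also have "(\<Prod>i\<in>UNIV. \<Prod>b\<in>Basis. (u $ i - l $ i) \<bullet> b) = (\<Prod>b\<in>Basis. (u - l) \<bullet> b)"
  proof -
    have "(\<Prod>b\<in>Basis. (u - l) \<bullet> b) = (\<Prod>b\<in>(\<lambda>(i, b). axis i b) ` (UNIV \<times> Basis). (u - l) \<bullet> b)"
      by (rule prod.cong) (auto simp: Basis_vec_def)
    also have "\<dots> = (\<Prod>(i, b)\<in>UNIV \<times> Basis. (u - l) \<bullet> axis i b)"
      by (subst prod.reindex) (auto simp: inj_on_def axis_eq_axis case_prod_unfold)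
    also have "\<dots> = (\<Prod>i\<in>UNIV. \<Prod>b\<in>Basis. (u $ i - l $ i) \<bullet> b)"
      by (subst prod.cartesian_product[symmetric]) (simp add: inner_axis)
    finally show ?thesis
      by simp
  qed
  finally show "emeasure (distr (Pi\<^sub>M (UNIV::'n set) (\<lambda>_. lborel :: 'b measure)) borel (\<lambda>f. \<chi> j. f j)) (box l u)
      = ennreal (\<Prod>b\<in>Basis. (u - l) \<bullet> b)" .
qed simp

text \<open>The product of the entry densities depends on the vector only through its norm; this is
  the source of the invariance under unitary maps.\<close>

lemma (in prob_space) distr_cn_vector:
  fixes X :: "'n::finite \<Rightarrow> 'a \<Rightarrow> complex"
  assumes X: "\<And>j. distributed M lborel (X j) (\<lambda>z. ennreal (cn_density z))"
    and indep: "indep_vars (\<lambda>_. borel) X UNIV"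
  shows "distr M borel (\<lambda>\<omega>. \<chi> j. X j \<omega>)
      = density lborel (\<lambda>h. ennreal (exp (- (norm h)\<^sup>2) / pi ^ CARD('n)))"
proof -
  interpret L: product_sigma_finite "\<lambda>_::'n. lborel :: complex measure" ..
  have [measurable]: "random_variable borel (X j)" for j
    using distributed_measurable[OF X[of j]] by simp
  have [measurable]: "(\<lambda>f. \<chi> j. f j) \<in> Pi\<^sub>M (UNIV::'n set) (\<lambda>_. lborel :: complex measure) \<rightarrow>\<^sub>M borel"
      "(\<lambda>f. \<chi> j. f j) \<in> Pi\<^sub>M (UNIV::'n set) (\<lambda>_. borel :: complex measure) \<rightarrow>\<^sub>M borel"
    by (rule borel_measurable_vecI; simp)+
  let ?D = "density lborel (\<lambda>z. ennreal (cn_density z))"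
  let ?g = "\<lambda>h :: complex^'n. ennreal (exp (- (norm h)\<^sup>2) / pi ^ CARD('n))"
  have distr_X: "distr M borel (X j) = ?D" for j
    using distributed_distr_eq_density[OF X[of j]] by (simp cong: distr_cong)
  interpret D: prob_space ?D
    using prob_space_distr[of "X undefined" borel] distr_X by simp
  interpret P: product_sigma_finite "\<lambda>_::'n. ?D"
    by standard
  have PiM_D: "Pi\<^sub>M (UNIV::'n set) (\<lambda>_. ?D) = density (Pi\<^sub>M UNIV (\<lambda>_. lborel)) (\<lambda>f. ?g (\<chi> j. f j))"
  proof (rule P.PiM_eqI[symmetric])
    show "sets (density (Pi\<^sub>M UNIV (\<lambda>_. lborel)) (\<lambda>f. ?g (\<chi> j. f j))) = sets (Pi\<^sub>M (UNIV::'n set) (\<lambda>_. ?D))"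
      by (simp cong: sets_PiM_cong)
    fix A :: "'n \<Rightarrow> complex set"
    assume "\<And>i. i \<in> UNIV \<Longrightarrow> A i \<in> sets ?D"
    then have A [measurable]: "A i \<in> sets borel" for i
      by simp
    have g: "?g (\<chi> j. f j) * indicator (Pi\<^sub>E UNIV A) f
        = (\<Prod>j\<in>UNIV. ennreal (cn_density (f j)) * indicator (A j) (f j))" for f
    proof -
      have "exp (- (norm (\<chi> j. f j))\<^sup>2) / pi ^ CARD('n) = (\<Prod>j\<in>UNIV. cn_density (f j))"
        by (simp add: cn_density_def norm_vec_power2 prod_dividef exp_sum flip: sum_negf)
      moreover have "indicator (Pi\<^sub>E UNIV A) f = (\<Prod>j\<in>UNIV. indicator (A j) (f j) :: ennreal)"
        by (auto simp: indicator_def PiE_UNIV_domain Pi_iff intro!: prod.neutral[symmetric])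
      ultimately show ?thesis
        by (simp add: prod.distrib prod_ennreal cn_density_def)
    qed
    have "emeasure (density (Pi\<^sub>M UNIV (\<lambda>_. lborel)) (\<lambda>f. ?g (\<chi> j. f j))) (Pi\<^sub>E UNIV A)
        = (\<integral>\<^sup>+f. ?g (\<chi> j. f j) * indicator (Pi\<^sub>E UNIV A) f \<partial>Pi\<^sub>M UNIV (\<lambda>_. lborel))"
      by (rule emeasure_density) (auto intro!: sets_PiM_I_finite)
    also have "\<dots> = (\<Prod>j\<in>UNIV. \<integral>\<^sup>+z. ennreal (cn_density z) * indicator (A j) z \<partial>lborel)"
      unfolding g by (rule L.product_nn_integral_prod) auto
    also have "\<dots> = (\<Prod>j\<in>UNIV. emeasure ?D (A j))"
      by (intro prod.cong refl emeasure_density[symmetric]) auto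
    finally show "emeasure (density (Pi\<^sub>M UNIV (\<lambda>_. lborel)) (\<lambda>f. ?g (\<chi> j. f j))) (Pi\<^sub>E UNIV A)
        = (\<Prod>j\<in>UNIV. emeasure ?D (A j))" .
  qed simp
  have "distr M (Pi\<^sub>M UNIV (\<lambda>_. borel)) (\<lambda>\<omega>. \<lambda>j\<in>UNIV. X j \<omega>) = Pi\<^sub>M UNIV (\<lambda>_. ?D)"
    using indep by (subst (asm) indep_vars_iff_distr_eq_PiM) (auto simp: distr_X)
  then have "distr (Pi\<^sub>M UNIV (\<lambda>_. ?D)) borel (\<lambda>f. \<chi> j. f j)
      = distr (distr M (Pi\<^sub>M UNIV (\<lambda>_. borel)) (\<lambda>\<omega>. \<lambda>j\<in>UNIV. X j \<omega>)) borel (\<lambda>f. \<chi> j. f j)"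
    by simp
  also have "\<dots> = distr M borel (\<lambda>\<omega>. \<chi> j. X j \<omega>)"
    by (subst distr_distr) (simp, rule measurable_restrict, simp, simp add: comp_def restrict_UNIV)
  finally have "distr M borel (\<lambda>\<omega>. \<chi> j. X j \<omega>)
      = distr (density (Pi\<^sub>M UNIV (\<lambda>_. lborel)) (\<lambda>f. ?g (\<chi> j. f j))) borel (\<lambda>f. \<chi> j. f j)"
    by (simp add: PiM_D)
  also have "\<dots> = density (distr (Pi\<^sub>M (UNIV::'n set) (\<lambda>_. lborel)) borel (\<lambda>f. \<chi> j. f j)) ?g"
    by (rule density_distr[symmetric]) auto
  finally show ?thesis
    by (simp add: lborel_vec_eq_distr)
qed

lemma distr_cn_vector_orthogonal_transformation:
  fixes f :: "complex^'n \<Rightarrow> complex^'n"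
  assumes f: "orthogonal_transformation f"
  defines "D \<equiv> density lborel (\<lambda>h :: complex^'n. ennreal (exp (- (norm h)\<^sup>2) / pi ^ CARD('n)))"
  shows "distr D borel f = D"
proof -
  have lin: "linear f" and norm_f: "\<And>x. norm (f x) = norm x"
    using f by (auto simp: orthogonal_transformation)
  have [measurable]: "f \<in> borel_measurable borel"
    using lin by (intro borel_measurable_continuous_onI linear_continuous_on linear_conv_bounded_linear[THEN iffD1])
  let ?g = "\<lambda>h :: complex^'n. ennreal (exp (- (norm h)\<^sup>2) / pi ^ CARD('n))"
  have "distr D borel f = distr (density lborel (\<lambda>h. ?g (f h))) borel f"
    by (simp add: D_def norm_f)
  also have "\<dots> = density (distr lborel borel f) ?g"
    by (rule density_distr[symmetric]) auto
  finally show ?thesis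
    by (simp add: distr_lborel_orthogonal_transformation[OF f] D_def)
qed

text \<open>Orthonormal rows make \<open>conj_transpose \<Phi>\<close> a right inverse, hence a left
  inverse since \<open>\<Phi>\<close> is square, and so norms are preserved. A unitary map is
  orthogonal for the underlying real inner product, which is what the Lebesgue measure sees.\<close>

lemma orthogonal_transformation_orthonormal_beams:
  assumes "orthonormal_beams \<Phi>"
  shows "orthogonal_transformation ((*v) \<Phi>)"
  unfolding orthogonal_transformation
proof (intro conjI allI)
  show "linear ((*v) \<Phi>)"
    by (rule linearI) (simp_all add: matrix_vector_right_distrib vec_eq_iff matrix_vector_mult_def scaleR_sum_right
        sum.distrib algebra_simps)
  have "\<Phi> ** conj_transpose \<Phi> = mat 1"
    using assms by (auto simp: orthonormal_beams_def vec_eq_iff matrix_matrix_mult_def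
        conj_transpose_def mat_def mult.commute)
  then have inv: "conj_transpose \<Phi> ** \<Phi> = mat 1"
    by (simp add: matrix_left_right_inverse)
  fix x
  have "(norm (\<Phi> *v x))\<^sup>2 = hermitian_form (conj_transpose \<Phi> ** mat 1 ** \<Phi>) x"
    by (simp only: hermitian_form_adjoint hermitian_form_mat_1)
  also have "\<dots> = (norm x)\<^sup>2"
    by (simp add: inv hermitian_form_mat_1)
  finally show "norm (\<Phi> *v x) = norm x"
    by simp
qed

subsection \<open>Replacing the beams by the coordinate axes\<close>

text \<open>Used to regroup the index triples of channel entries, for example as an antenna together
  with a beam.\<close>

lemma (in prob_space) indep_sets_reindex:
  assumes F: "indep_sets F I" and f: "inj_on f J" "f ` J \<subseteq> I"
  shows "indep_sets (\<lambda>j. F (f j)) J"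
proof (rule indep_setsI)
  fix j assume "j \<in> J"
  then show "F (f j) \<subseteq> events"
    using F f by (auto simp: indep_sets_def)
next
  fix A K
  assume K: "K \<noteq> {}" "K \<subseteq> J" "finite K" and A: "\<forall>j\<in>K. A j \<in> F (f j)"
  let ?B = "\<lambda>i. A (inv_into J f i)"
  have inv: "inv_into J f (f j) = j" if "j \<in> K" for j
    using that K f(1) by (auto intro: inv_into_f_f)
  have "prob (\<Inter>i\<in>f ` K. ?B i) = (\<Prod>i\<in>f ` K. prob (?B i))"
    using K A f by (intro indep_setsD[OF F]) (auto simp: inv)
  also have "\<dots> = (\<Prod>j\<in>K. prob (?B (f j)))"
    using inj_on_subset[OF f(1) K(2)] by (simp add: prod.reindex)
  finally show "prob (\<Inter>j\<in>K. A j) = (\<Prod>j\<in>K. prob (A j))"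
    using inv by (simp cong: INF_cong prod.cong)
qed

lemma (in prob_space) indep_vars_reindex:
  assumes "indep_vars M' X I" "inj_on f J" "f ` J \<subseteq> I"
  shows "indep_vars (\<lambda>j. M' (f j)) (\<lambda>j. X (f j)) J"
  using assms indep_sets_reindex[OF _ assms(2,3), of "\<lambda>i. {X i -` A \<inter> space M |A. A \<in> sets (M' i)}"]
  by (auto simp: indep_vars_def2)

definition axis_SINR :: "real \<Rightarrow> complex^'m \<Rightarrow> 'm \<Rightarrow> real" where
  "axis_SINR p g m = p / real CARD('m) * (cmod (g $ m))\<^sup>2 /
     (1 + p / real CARD('m) * (\<Sum>j\<in>UNIV - {m}. (cmod (g $ j))\<^sup>2))"

lemma SINR_eq_axis_SINR: "SINR p \<Phi> h m = axis_SINR p (\<Phi> *v h) m"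
  by (simp add: SINR_def axis_SINR_def beam_gain_def matrix_vector_mult_def mult.commute)

lemma borel_measurable_axis_SINR [measurable (raw)]:
  assumes [measurable]: "f \<in> borel_measurable M"
  shows "(\<lambda>x. axis_SINR p (f x) m) \<in> borel_measurable M"
  unfolding axis_SINR_def by measurable

definition axis_sum_rate :: "nat \<Rightarrow> real \<Rightarrow> (nat \<times> 'k \<Rightarrow> complex^'m) \<Rightarrow> real" where
  "axis_sum_rate N p g =
     (\<Sum>m\<in>UNIV. ln (1 + Max ((\<lambda>x. axis_SINR p (g x) m) ` ({..<N} \<times> UNIV))))"

lemma borel_measurable_axis_sum_rate [measurable]:
  "axis_sum_rate N p \<in> borel_measurable (Pi\<^sub>M (UNIV :: (nat \<times> 'k::finite) set) (\<lambda>_. borel))"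
  unfolding axis_sum_rate_def by measurable

context mimo_broadcast_channel
begin

lemma borel_measurable_entry [measurable]: "(\<lambda>\<omega>. H n \<omega> $ i $ j) \<in> borel_measurable \<Omega>"
  using distributed_measurable[OF channel_entries_distributed[of n i j]] by simp

definition row_at :: "nat \<times> 'k \<Rightarrow> 'w \<Rightarrow> complex^'m" where
  "row_at x \<omega> = H (fst x) \<omega> $ snd x"

lemma borel_measurable_row_at [measurable]: "row_at x \<in> borel_measurable \<Omega>"
  by (rule borel_measurable_vecI) (simp add: row_at_def)

lemma borel_measurable_channel [measurable]: "H n \<in> borel_measurable \<Omega>"
  by (intro borel_measurable_vecI) simp

lemma indep_vars_row_entries: "indep_vars (\<lambda>_. borel) (\<lambda>j \<omega>. row_at x \<omega> $ j) UNIV"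
  using indep_vars_reindex[OF channel_entries_indep, of "\<lambda>j. (fst x, snd x, j)" UNIV]
  by (simp add: row_at_def inj_on_def)

lemma distr_row_at:
  "distr \<Omega> borel (row_at x) = density lborel (\<lambda>h. ennreal (exp (- (norm h)\<^sup>2) / pi ^ CARD('m)))"
proof -
  have "distr \<Omega> borel (\<lambda>\<omega>. \<chi> j. row_at x \<omega> $ j)
      = density lborel (\<lambda>h. ennreal (exp (- (norm h)\<^sup>2) / pi ^ CARD('m)))"
    by (rule distr_cn_vector[OF _ indep_vars_row_entries])
      (simp add: row_at_def channel_entries_distributed)
  then show ?thesis
    by (simp add: eta_contract_eq)
qed

text \<open>Different rows are functions of disjoint blocks of the independent entries.\<close>

lemma indep_vars_row_at: "indep_vars (\<lambda>_. borel) row_at UNIV"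
proof -
  have "indep_vars (\<lambda>_. borel)
      (\<lambda>x \<omega>. (\<chi> j. restrict (\<lambda>k. (case k of (n, i, j) \<Rightarrow> \<lambda>\<omega>. H n \<omega> $ i $ j) \<omega>)
          ((\<lambda>j. (fst x, snd x, j)) ` UNIV) (fst x, snd x, j))) UNIV"
  proof (rule indep_vars_compose2[OF indep_vars_restrict[OF channel_entries_indep, of UNIV
          "\<lambda>x. (\<lambda>j. (fst x, snd x, j)) ` UNIV"]])
    show "disjoint_family_on (\<lambda>x. (\<lambda>j. (fst x, snd x, j)) ` UNIV) UNIV"
      by (auto simp: disjoint_family_on_def prod_eq_iff)
    show "(\<lambda>f. \<chi> j. f (fst x, snd x, j))
        \<in> Pi\<^sub>M ((\<lambda>j. (fst x, snd x, j)) ` UNIV) (\<lambda>_. borel :: complex measure) \<rightarrow>\<^sub>M borel" for x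
      by (rule borel_measurable_vecI) simp
  qed auto
  then show ?thesis
    by (simp add: row_at_def[abs_def])
qed

lemma borel_measurable_rows: "(\<lambda>\<omega> x. row_at x \<omega>) \<in> \<Omega> \<rightarrow>\<^sub>M Pi\<^sub>M UNIV (\<lambda>_. borel)"
  using measurable_restrict[of UNIV row_at \<Omega> "\<lambda>_. borel"] by (simp add: restrict_UNIV)

lemma distr_rotated_rows:
  assumes "orthonormal_beams \<phi>"
  shows "distr \<Omega> (Pi\<^sub>M UNIV (\<lambda>_. borel)) (\<lambda>\<omega> x. \<phi> *v row_at x \<omega>)
    = distr \<Omega> (Pi\<^sub>M UNIV (\<lambda>_. borel)) (\<lambda>\<omega> x. row_at x \<omega>)"
proof -
  have orth: "orthogonal_transformation ((*v) \<phi>)"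
    by (rule orthogonal_transformation_orthonormal_beams[OF assms])
  have meas [measurable]: "(*v) \<phi> \<in> borel_measurable borel"
    using orthogonal_transformation_linear[OF orth]
    by (intro borel_measurable_continuous_onI linear_continuous_on linear_conv_bounded_linear[THEN iffD1])
  have indep: "indep_vars (\<lambda>_. borel) (\<lambda>x \<omega>. \<phi> *v row_at x \<omega>) UNIV"
    by (rule indep_vars_compose2[OF indep_vars_row_at]) simp
  have "distr \<Omega> borel (\<lambda>\<omega>. \<phi> *v row_at x \<omega>) = distr \<Omega> borel (row_at x)" for x
  proof -
    have "distr \<Omega> borel (\<lambda>\<omega>. \<phi> *v row_at x \<omega>) = distr (distr \<Omega> borel (row_at x)) borel ((*v) \<phi>)"
      by (subst distr_distr) (auto simp: comp_def)
    then show ?thesis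
      by (simp add: distr_row_at distr_cn_vector_orthogonal_transformation[OF orth])
  qed
  moreover have "distr \<Omega> (Pi\<^sub>M UNIV (\<lambda>_. borel)) (\<lambda>\<omega>. \<lambda>x\<in>UNIV. \<phi> *v row_at x \<omega>)
      = Pi\<^sub>M UNIV (\<lambda>x. distr \<Omega> borel (\<lambda>\<omega>. \<phi> *v row_at x \<omega>))"
    using indep by (subst (asm) indep_vars_iff_distr_eq_PiM) auto
  moreover have "distr \<Omega> (Pi\<^sub>M UNIV (\<lambda>_. borel)) (\<lambda>\<omega>. \<lambda>x\<in>UNIV. row_at x \<omega>)
      = Pi\<^sub>M UNIV (\<lambda>x. distr \<Omega> borel (row_at x))"
    using indep_vars_row_at by (subst (asm) indep_vars_iff_distr_eq_PiM) auto
  ultimately show ?thesis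
    by (simp add: restrict_UNIV)
qed

text \<open>Independence of beams and channels, restated as a product law so that Fubini applies.
  The assumption speaks of whole channel matrices; sets of rows are pulled back along the measurable
  map that extracts rows.\<close>

lemma distr_beams_rows:
  "distr \<Omega> (borel \<Otimes>\<^sub>M Pi\<^sub>M UNIV (\<lambda>_. borel)) (\<lambda>\<omega>. (\<Phi> \<omega>, \<lambda>x. row_at x \<omega>))
    = distr \<Omega> borel \<Phi> \<Otimes>\<^sub>M distr \<Omega> (Pi\<^sub>M UNIV (\<lambda>_. borel)) (\<lambda>\<omega> x. row_at x \<omega>)"
proof -
  let ?P = "Pi\<^sub>M (UNIV :: (nat \<times> 'k) set) (\<lambda>_. borel :: (complex^'m) measure)"
  let ?Q = "Pi\<^sub>M (UNIV :: nat set) (\<lambda>_. borel :: (complex^'m^'k) measure)"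
  let ?R = "\<lambda>\<omega> x. row_at x \<omega>"
  note [measurable] = beams_measurable borel_measurable_rows
  interpret D\<Phi>: prob_space "distr \<Omega> borel \<Phi>"
    by (rule prob_space_distr) measurable
  interpret DR: prob_space "distr \<Omega> ?P ?R"
    by (rule prob_space_distr) measurable
  have rows [measurable]: "(\<lambda>h x. h (fst x) $ snd x) \<in> ?Q \<rightarrow>\<^sub>M ?P"
    using measurable_restrict[of UNIV "\<lambda>x h. h (fst x) $ snd x" ?Q "\<lambda>_. borel"]
    by (simp add: restrict_UNIV)
  show ?thesis
  proof (rule pair_measure_eqI[symmetric])
    fix A B
    assume "A \<in> sets (distr \<Omega> borel \<Phi>)" "B \<in> sets (distr \<Omega> ?P ?R)"
    then have A [measurable]: "A \<in> sets borel" and B [measurable]: "B \<in> sets ?P"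
      by auto
    let ?B = "(\<lambda>h x. h (fst x) $ snd x) -` B \<inter> space ?Q"
    have B': "(\<lambda>\<omega> n. H n \<omega>) -` ?B \<inter> space \<Omega> = ?R -` B \<inter> space \<Omega>"
      by (auto simp: row_at_def space_PiM)
    have "?B \<in> sets ?Q"
      by measurable
    then have "prob ((\<Phi> -` A \<inter> space \<Omega>) \<inter> (?R -` B \<inter> space \<Omega>))
        = prob (\<Phi> -` A \<inter> space \<Omega>) * prob (?R -` B \<inter> space \<Omega>)"
      unfolding B'[symmetric]
      by (intro indep_setD[OF beams_indep_channels] CollectI exI[of _ A] exI[of _ ?B] conjI refl A)
    moreover have "(\<Phi> -` A \<inter> space \<Omega>) \<inter> (?R -` B \<inter> space \<Omega>)
        = (\<lambda>\<omega>. (\<Phi> \<omega>, ?R \<omega>)) -` (A \<times> B) \<inter> space \<Omega>"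
      by auto
    ultimately show "emeasure (distr \<Omega> borel \<Phi>) A * emeasure (distr \<Omega> ?P ?R) B
        = emeasure (distr \<Omega> (borel \<Otimes>\<^sub>M ?P) (\<lambda>\<omega>. (\<Phi> \<omega>, ?R \<omega>))) (A \<times> B)"
      by (simp add: emeasure_distr emeasure_eq_measure ennreal_mult)
  qed (simp_all add: D\<Phi>.sigma_finite_measure_axioms DR.sigma_finite_measure_axioms cong: sets_pair_measure_cong)
qed

text \<open>Conditioning on the beams: for almost every value of \<open>\<Phi>\<close> the rotated
  rows have the original law by \<open>distr_rotated_rows\<close>, and a conditional law that does
  not depend on the condition is the unconditional one.\<close>

lemma distr_beamformed_rows:
  "distr \<Omega> (Pi\<^sub>M UNIV (\<lambda>_. borel)) (\<lambda>\<omega> x. \<Phi> \<omega> *v row_at x \<omega>)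
    = distr \<Omega> (Pi\<^sub>M UNIV (\<lambda>_. borel)) (\<lambda>\<omega> x. row_at x \<omega>)"
proof (rule measure_eqI)
  let ?P = "Pi\<^sub>M (UNIV :: (nat \<times> 'k) set) (\<lambda>_. borel :: (complex^'m) measure)"
  let ?R = "\<lambda>\<omega> x. row_at x \<omega>"
  let ?T = "\<lambda>z :: (complex^'m^'m) \<times> (nat \<times> 'k \<Rightarrow> complex^'m). \<lambda>x. fst z *v snd z x"
  note [measurable] = beams_measurable borel_measurable_rows
  have T [measurable]: "?T \<in> borel \<Otimes>\<^sub>M ?P \<rightarrow>\<^sub>M ?P"
  proof -
    have "(\<lambda>z. ?T z x) \<in> borel_measurable (borel \<Otimes>\<^sub>M ?P)" for x
      by (rule borel_measurable_vecI) (simp add: matrix_vector_mult_def)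
    then show ?thesis
      using measurable_restrict[of UNIV "\<lambda>x z. ?T z x" "borel \<Otimes>\<^sub>M ?P" "\<lambda>_. borel"]
      by (simp add: restrict_UNIV)
  qed
  show "sets (distr \<Omega> ?P (\<lambda>\<omega> x. \<Phi> \<omega> *v row_at x \<omega>)) = sets (distr \<Omega> ?P ?R)"
    by simp
  fix A assume "A \<in> sets (distr \<Omega> ?P (\<lambda>\<omega> x. \<Phi> \<omega> *v row_at x \<omega>))"
  then have A [measurable]: "A \<in> sets ?P"
    by simp
  interpret DR: prob_space "distr \<Omega> ?P ?R"
    by (rule prob_space_distr) measurable
  define TA where "TA = ?T -` A \<inter> space (borel \<Otimes>\<^sub>M ?P)"
  have TA [measurable]: "TA \<in> sets (borel \<Otimes>\<^sub>M ?P)"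
    unfolding TA_def by measurable
  have TA': "TA \<in> sets (borel \<Otimes>\<^sub>M distr \<Omega> ?P ?R)"
    using TA by (simp cong: sets_pair_measure_cong)
  have rotated: "emeasure (distr \<Omega> ?P ?R) (Pair \<phi> -` TA) = emeasure (distr \<Omega> ?P ?R) A"
    if "orthonormal_beams \<phi>" for \<phi>
  proof -
    have meas [measurable]: "(\<lambda>g x. \<phi> *v g x) \<in> ?P \<rightarrow>\<^sub>M ?P"
      using measurable_compose[OF measurable_Pair1'[of \<phi> borel ?P] T] by simp
    have "distr (distr \<Omega> ?P ?R) ?P (\<lambda>g x. \<phi> *v g x) = distr \<Omega> ?P (\<lambda>\<omega> x. \<phi> *v row_at x \<omega>)"
      by (subst distr_distr) (auto simp: comp_def)
    also have "\<dots> = distr \<Omega> ?P ?R"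
      by (rule distr_rotated_rows[OF that])
    finally have "emeasure (distr \<Omega> ?P ?R) A = emeasure (distr (distr \<Omega> ?P ?R) ?P (\<lambda>g x. \<phi> *v g x)) A"
      by simp
    also have "\<dots> = emeasure (distr \<Omega> ?P ?R) ((\<lambda>g x. \<phi> *v g x) -` A \<inter> space ?P)"
      by (subst emeasure_distr) auto
    also have "(\<lambda>g x. \<phi> *v g x) -` A \<inter> space ?P = Pair \<phi> -` TA"
      by (auto simp: TA_def space_pair_measure)
    finally show ?thesis
      by simp
  qed
  have "distr \<Omega> ?P (\<lambda>\<omega> x. \<Phi> \<omega> *v row_at x \<omega>) = distr (distr \<Omega> (borel \<Otimes>\<^sub>M ?P) (\<lambda>\<omega>. (\<Phi> \<omega>, ?R \<omega>))) ?P ?T"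
    by (subst distr_distr) (auto simp: comp_def)
  also have "\<dots> = distr (distr \<Omega> borel \<Phi> \<Otimes>\<^sub>M distr \<Omega> ?P ?R) ?P ?T"
    by (simp add: distr_beams_rows)
  also have "emeasure \<dots> A = emeasure (distr \<Omega> borel \<Phi> \<Otimes>\<^sub>M distr \<Omega> ?P ?R) TA"
    unfolding TA_def
    by (subst emeasure_distr)
      (simp_all add: space_pair_measure cong: measurable_cong_sets sets_pair_measure_cong)
  also have "\<dots> = (\<integral>\<^sup>+\<phi>. emeasure (distr \<Omega> ?P ?R) (Pair \<phi> -` TA) \<partial>distr \<Omega> borel \<Phi>)"
    by (rule DR.emeasure_pair_measure_alt) (use TA in \<open>simp cong: sets_pair_measure_cong\<close>)
  also have "\<dots> = (\<integral>\<^sup>+\<omega>. emeasure (distr \<Omega> ?P ?R) (Pair (\<Phi> \<omega>) -` TA) \<partial>\<Omega>)"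
    using DR.measurable_emeasure_Pair[OF TA'] by (intro nn_integral_distr) auto
  also have "\<dots> = (\<integral>\<^sup>+\<omega>. emeasure (distr \<Omega> ?P ?R) A \<partial>\<Omega>)"
    using beams_orthonormal by (intro nn_integral_cong_AE) (auto simp: rotated)
  also have "\<dots> = emeasure (distr \<Omega> ?P ?R) A"
    by (simp add: emeasure_space_1)
  finally show "emeasure (distr \<Omega> ?P (\<lambda>\<omega> x. \<Phi> \<omega> *v row_at x \<omega>)) A = emeasure (distr \<Omega> ?P ?R) A" .
qed

lemma R_RBF_eq: "R_RBF \<Omega> H \<Phi> N p = (LINT \<omega>|\<Omega>. axis_sum_rate N p (\<lambda>x. row_at x \<omega>))"
proof -
  let ?P = "Pi\<^sub>M (UNIV :: (nat \<times> 'k) set) (\<lambda>_. borel :: (complex^'m) measure)"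
  note [measurable] = beams_measurable borel_measurable_rows
  have meas [measurable]: "(\<lambda>\<omega> x. \<Phi> \<omega> *v row_at x \<omega>) \<in> \<Omega> \<rightarrow>\<^sub>M ?P"
  proof -
    have "(\<lambda>\<omega>. \<Phi> \<omega> *v row_at x \<omega>) \<in> borel_measurable \<Omega>" for x
      by (rule borel_measurable_vecI) (simp add: matrix_vector_mult_def)
    then show ?thesis
      using measurable_restrict[of UNIV "\<lambda>x \<omega>. \<Phi> \<omega> *v row_at x \<omega>" \<Omega> "\<lambda>_. borel"]
      by (simp add: restrict_UNIV)
  qed
  have "R_RBF \<Omega> H \<Phi> N p = (LINT \<omega>|\<Omega>. axis_sum_rate N p (\<lambda>x. \<Phi> \<omega> *v row_at x \<omega>))"
    by (simp add: R_RBF_def axis_sum_rate_def SINR_eq_axis_SINR row_at_def case_prod_unfold)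
  also have "\<dots> = (LINT g|distr \<Omega> ?P (\<lambda>\<omega> x. \<Phi> \<omega> *v row_at x \<omega>). axis_sum_rate N p g)"
    by (rule integral_distr[symmetric]) measurable
  also have "\<dots> = (LINT g|distr \<Omega> ?P (\<lambda>\<omega> x. row_at x \<omega>). axis_sum_rate N p g)"
    by (simp add: distr_beamformed_rows)
  also have "\<dots> = (LINT \<omega>|\<Omega>. axis_sum_rate N p (\<lambda>x. row_at x \<omega>))"
    by (rule integral_distr) measurable
  finally show ?thesis .
qed

end

subsection \<open>Expected maximum sum rate\<close>

text \<open>Jensen's inequality through the tangent of \<open>ln (1 + x)\<close> at
  \<open>w\<close>, which needs only an upper bound \<open>w\<close> of the mean and also provides
  an integrable majorant for \<open>f\<close>.\<close>

lemma (in prob_space) expectation_ln_1_plus_le: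
  fixes f g :: "'a \<Rightarrow> real"
  assumes [measurable]: "f \<in> borel_measurable M" "integrable M g"
    and f: "\<And>\<omega>. \<omega> \<in> space M \<Longrightarrow> 0 \<le> f \<omega>" "\<And>\<omega>. \<omega> \<in> space M \<Longrightarrow> f \<omega> \<le> ln (1 + g \<omega>)"
    and g: "\<And>\<omega>. \<omega> \<in> space M \<Longrightarrow> 0 \<le> g \<omega>" "expectation g \<le> w"
  shows "integrable M f" "expectation f \<le> ln (1 + w)"
proof -
  have "0 \<le> expectation g"
    using g(1) by (rule Bochner_Integration.integral_nonneg)
  with g(2) have w: "0 \<le> w"
    by simp
  let ?h = "\<lambda>\<omega>. ln (1 + w) + (g \<omega> - w) / (1 + w)"
  have h: "f \<omega> \<le> ?h \<omega>" if "\<omega> \<in> space M" for \<omega>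
  proof -
    have "ln ((1 + g \<omega>) / (1 + w)) \<le> (1 + g \<omega>) / (1 + w) - 1"
      using g(1)[OF that] w by (intro ln_le_minus_one) auto
    then have "ln (1 + g \<omega>) \<le> ?h \<omega>"
      using g(1)[OF that] w by (simp add: ln_div field_simps)
    with f(2)[OF that] show ?thesis
      by simp
  qed
  have int: "integrable M ?h"
    using assms(2) by auto
  show f_int: "integrable M f"
  proof (rule Bochner_Integration.integrable_bound[OF int])
    have "norm (f \<omega>) \<le> norm (?h \<omega>)" if "\<omega> \<in> space M" for \<omega>
      using f(1)[OF that] h[OF that] by simp
    then show "AE \<omega> in M. norm (f \<omega>) \<le> norm (?h \<omega>)"
      by (rule AE_I2)
  qed simp
  have "expectation f \<le> expectation ?h"
    using f_int int h by (rule integral_mono)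
  also have "\<dots> = ln (1 + w) + (expectation g - w) / (1 + w)"
    using assms(2) by (simp add: prob_space)
  also have "\<dots> \<le> ln (1 + w)"
    using g(2) w by (simp add: divide_le_0_iff)
  finally show "expectation f \<le> ln (1 + w)" .
qed

lemma (in prob_space) expectation_ge_on_event:
  fixes f :: "'a \<Rightarrow> real"
  assumes "integrable M f" "A \<in> events" "\<And>\<omega>. \<omega> \<in> space M \<Longrightarrow> 0 \<le> f \<omega>" "\<And>\<omega>. \<omega> \<in> A \<Longrightarrow> c \<le> f \<omega>"
  shows "c * prob A \<le> expectation f"
proof -
  have "expectation (\<lambda>\<omega>. c * indicator A \<omega>) \<le> expectation f"
  proof (rule integral_mono)
    show "integrable M (\<lambda>\<omega>. c * indicator A \<omega>)"
      using assms(2) by (simp add: emeasure_eq_measure)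
  qed (use assms in \<open>auto simp: indicator_def\<close>)
  then show ?thesis
    using sets.sets_into_space[OF assms(2)] by (simp add: Int_absorb2)
qed

lemma (in prob_space) nn_integral_indep_var:
  assumes indep: "indep_var S X T Y" and [measurable]: "case_prod f \<in> borel_measurable (S \<Otimes>\<^sub>M T)"
  shows "(\<integral>\<^sup>+\<omega>. f (X \<omega>) (Y \<omega>) \<partial>M) = (\<integral>\<^sup>+\<omega>'. \<integral>\<^sup>+\<omega>. f (X \<omega>) (Y \<omega>') \<partial>M \<partial>M)"
proof -
  have [measurable]: "X \<in> M \<rightarrow>\<^sub>M S" "Y \<in> M \<rightarrow>\<^sub>M T"
    using indep_var_rv1[OF indep] indep_var_rv2[OF indep] by auto
  interpret X: prob_space "distr M S X" by (rule prob_space_distr) simp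
  interpret Y: prob_space "distr M T Y" by (rule prob_space_distr) simp
  interpret XY: pair_sigma_finite "distr M S X" "distr M T Y" ..
  have meas: "case_prod f \<in> borel_measurable (distr M S X \<Otimes>\<^sub>M distr M T Y)"
    by (simp cong: measurable_cong_sets sets_pair_measure_cong)
  have "(\<integral>\<^sup>+\<omega>. f (X \<omega>) (Y \<omega>) \<partial>M) = (\<integral>\<^sup>+z. case_prod f z \<partial>distr M (S \<Otimes>\<^sub>M T) (\<lambda>\<omega>. (X \<omega>, Y \<omega>)))"
    by (subst nn_integral_distr) auto
  also have "\<dots> = (\<integral>\<^sup>+z. case_prod f z \<partial>(distr M S X \<Otimes>\<^sub>M distr M T Y))"
    using indep by (simp add: indep_var_distribution_eq)
  also have "\<dots> = (\<integral>\<^sup>+y. \<integral>\<^sup>+x. f x y \<partial>distr M S X \<partial>distr M T Y)"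
    using XY.nn_integral_snd[OF meas] by simp
  also have "\<dots> = (\<integral>\<^sup>+\<omega>'. (\<integral>\<^sup>+x. f x (Y \<omega>') \<partial>distr M S X) \<partial>M)"
    by (rule nn_integral_distr) measurable
  also have "\<dots> = (\<integral>\<^sup>+\<omega>'. \<integral>\<^sup>+\<omega>. f (X \<omega>) (Y \<omega>') \<partial>M \<partial>M)"
    by (intro nn_integral_cong nn_integral_distr) auto
  finally show ?thesis .
qed

lemma nn_integral_exp_rate:
  fixes l :: real
  assumes "0 < l"
  shows "(\<integral>\<^sup>+s. ennreal (exp (- l * s)) * indicator {0..} s \<partial>lborel) = ennreal (1 / l)"
proof -
  have "(\<integral>\<^sup>+s. ennreal (exp (- l * s)) * indicator {0..} s \<partial>lborel) = ennreal (0 - (- exp (- l * 0) / l))"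
  proof (rule nn_integral_FTC_atLeast)
    have "((\<lambda>s. exp (- (l * s))) \<longlongrightarrow> 0) at_top"
      using assms
      by (intro filterlim_compose[OF exp_at_bot] filterlim_compose[OF filterlim_uminus_at_bot_at_top]
          filterlim_tendsto_pos_mult_at_top[OF tendsto_const] filterlim_ident) auto
    from tendsto_divide[OF tendsto_minus[OF this] tendsto_const[of l]]
    show "((\<lambda>s. - exp (- l * s) / l) \<longlongrightarrow> 0) at_top"
      using assms by simp
  qed (use assms in \<open>auto intro!: derivative_eq_intros\<close>)
  then show ?thesis
    by simp
qed

section \<open>Integrals against the standard exponential law\<close>

context prob_space
begin

context
  fixes X :: "'a \<Rightarrow> real"
  assumes X: "distributed M lborel X (exponential_density 1)"
begin

lemma nn_integral_exponential:
  assumes [measurable]: "f \<in> borel_measurable borel"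
  shows "(\<integral>\<^sup>+\<omega>. f (X \<omega>) \<partial>M) = (\<integral>\<^sup>+s. ennreal (exp (- s)) * indicator {0..} s * f s \<partial>lborel)"
proof -
  have "(\<integral>\<^sup>+\<omega>. f (X \<omega>) \<partial>M) = (\<integral>\<^sup>+s. ennreal (exponential_density 1 s) * f s \<partial>lborel)"
    by (rule distributed_nn_integral[OF X, symmetric]) simp
  also have "\<dots> = (\<integral>\<^sup>+s. ennreal (exp (- s)) * indicator {0..} s * f s \<partial>lborel)"
    by (intro nn_integral_cong) (auto simp: exponential_density_def)
  finally show ?thesis .
qed

lemma nn_integral_exp_exponential:
  assumes "t < 1"
  shows "(\<integral>\<^sup>+\<omega>. ennreal (exp (t * X \<omega>)) \<partial>M) = ennreal (1 / (1 - t))"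
proof -
  have "(\<integral>\<^sup>+\<omega>. ennreal (exp (t * X \<omega>)) \<partial>M)
      = (\<integral>\<^sup>+s. ennreal (exp (- s)) * indicator {0..} s * ennreal (exp (t * s)) \<partial>lborel)"
    by (rule nn_integral_exponential) simp
  also have "\<dots> = (\<integral>\<^sup>+s. ennreal (exp (- (1 - t) * s)) * indicator {0..} s \<partial>lborel)"
    by (intro nn_integral_cong)
      (auto simp: indicator_def algebra_simps simp flip: ennreal_mult exp_add)
  finally show ?thesis
    using nn_integral_exp_rate[of "1 - t"] assms by simp
qed

text \<open>Lack of memory: beyond \<open>u\<close> the excess is again standard exponential with
  mean 1, so only the probability of exceeding \<open>u\<close> remains.\<close>

lemma nn_integral_excess_exponential:
  assumes u: "0 \<le> u"
  shows "(\<integral>\<^sup>+\<omega>. ennreal (max 0 (X \<omega> - u)) \<partial>M) = ennreal (exp (- u))"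
proof -
  have "(\<integral>\<^sup>+\<omega>. ennreal (max 0 (X \<omega> - u)) \<partial>M)
      = (\<integral>\<^sup>+s. ennreal (exp (- s)) * indicator {0..} s * ennreal (max 0 (s - u)) \<partial>lborel)"
    by (rule nn_integral_exponential) simp
  also have "\<dots> = (\<integral>\<^sup>+s. ennreal (exp (- u)) * ennreal (erlang_density 0 1 (s - u) * (s - u) ^ 1) \<partial>lborel)"
  proof (intro nn_integral_cong)
    fix s :: real
    have "exp (- u) * exp (u - s) = exp (- s)"
      by (simp flip: exp_add)
    then show "ennreal (exp (- s)) * indicator {0..} s * ennreal (max 0 (s - u))
        = ennreal (exp (- u)) * ennreal (erlang_density 0 1 (s - u) * (s - u) ^ 1)"
      using u by (auto simp: indicator_def erlang_density_def max_def simp flip: ennreal_mult mult.assoc)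
  qed
  also have "\<dots> = ennreal (exp (- u)) * (\<integral>\<^sup>+s. ennreal (erlang_density 0 1 (s - u) * (s - u) ^ 1) \<partial>lborel)"
    by (rule nn_integral_cmult) simp
  also have "(\<integral>\<^sup>+s. ennreal (erlang_density 0 1 (s - u) * (s - u) ^ 1) \<partial>lborel) = 1"
    using nn_integral_lborel_translate[of "\<lambda>s. ennreal (erlang_density 0 1 s * s ^ 1)" "- u"]
      nn_integral_erlang_ith_moment[of 1 0 1] by simp
  finally show ?thesis
    by simp
qed

text \<open>The mean of \<open>1 / X\<close> is infinite, but the exponent \<open>- 1 / 2\<close> is
  integrable at 0. It lets an interference power stand in a denominator.\<close>

lemma nn_integral_powr_exponential:
  "(\<integral>\<^sup>+\<omega>. ennreal (X \<omega> powr (- 1 / 2)) \<partial>M) = ennreal (Gamma (1 / 2))"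
proof -
  have "(\<integral>\<^sup>+\<omega>. ennreal (X \<omega> powr (- 1 / 2)) \<partial>M)
      = (\<integral>\<^sup>+s. ennreal (exp (- s)) * indicator {0..} s * ennreal (s powr (- 1 / 2)) \<partial>lborel)"
    by (rule nn_integral_exponential) simp
  also have "\<dots> = (\<integral>\<^sup>+s. ennreal (indicator {0..} s * (s powr (1 / 2 - 1) / exp s)) \<partial>lborel)"
    by (intro nn_integral_cong)
      (auto simp: indicator_def exp_minus field_simps simp flip: ennreal_mult)
  also have "\<dots> = ennreal (Gamma (1 / 2))"
  proof (rule nn_integral_has_integral_lborel)
    have "((\<lambda>s :: real. if s \<in> {0..} then s powr (1 / 2 - 1) / exp s else 0) has_integral Gamma (1 / 2)) UNIV"
      using Gamma_integral_real[of "1 / 2"] by (simp only: has_integral_restrict_UNIV)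
    then show "((\<lambda>s :: real. indicator {0..} s * (s powr (1 / 2 - 1) / exp s)) has_integral Gamma (1 / 2)) UNIV"
      by (rule has_integral_eq[rotated]) (simp add: indicator_def)
  qed simp_all
  finally show ?thesis .
qed

end

end

context mimo_broadcast_channel
begin

section \<open>Channel gains, well-aligned users and the mean optimal rate\<close>

definition gain :: "nat \<times> 'k \<Rightarrow> 'm \<Rightarrow> 'w \<Rightarrow> real" where
  "gain x j \<omega> = (cmod (row_at x \<omega> $ j))\<^sup>2"

lemma borel_measurable_gain [measurable]: "gain x j \<in> borel_measurable \<Omega>"
  unfolding gain_def[abs_def] by measurable

lemma gain_nonneg [simp]: "0 \<le> gain x j \<omega>"
  by (simp add: gain_def)

lemma distributed_gain: "distributed \<Omega> lborel (gain x j) (exponential_density 1)"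
  unfolding gain_def[abs_def] row_at_def
  by (intro exponential_distributed_cmod_power2 channel_entries_distributed)

lemma indep_vars_gain: "indep_vars (\<lambda>_. borel) (\<lambda>(x, j). gain x j) UNIV"
proof -
  have "indep_vars (\<lambda>_. borel) (\<lambda>z \<omega>. (cmod (H (fst (fst z)) \<omega> $ snd (fst z) $ snd z))\<^sup>2) UNIV"
    using indep_vars_compose2[OF indep_vars_reindex[OF channel_entries_indep,
          of "\<lambda>z. (fst (fst z), snd (fst z), snd z)" UNIV], of "\<lambda>_ z. (cmod z)\<^sup>2" "\<lambda>_. borel"]
    by (simp add: inj_on_def prod_eq_iff)
  then show ?thesis
    by (simp add: gain_def[abs_def] row_at_def case_prod_unfold)
qed

lemma indep_vars_gain_row: "indep_vars (\<lambda>_. borel) (gain x) UNIV"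
  using indep_vars_reindex[OF indep_vars_gain, of "Pair x" UNIV] by (simp add: inj_on_def)

definition aligned :: "'m \<Rightarrow> real \<Rightarrow> real \<Rightarrow> (complex^'m) set" where
  "aligned m a d = {g. a < (cmod (g $ m))\<^sup>2 \<and> (\<forall>j. j \<noteq> m \<longrightarrow> (cmod (g $ j))\<^sup>2 \<le> d)}"

lemma aligned_measurable [measurable]: "aligned m a d \<in> sets borel"
  unfolding aligned_def by measurable

lemma prob_aligned:
  assumes "0 \<le> a" "0 \<le> d"
  shows "prob (row_at x -` aligned m a d \<inter> space \<Omega>) = exp (- a) * (1 - exp (- d)) ^ (CARD('m) - 1)"
proof -
  define A where "A j = (if j = m then {a<..} else {..d})" for j
  have split: "(\<forall>j. P j) \<longleftrightarrow> P m \<and> (\<forall>j. j \<noteq> m \<longrightarrow> P j)" for P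
    by metis
  have "g \<in> aligned m a d \<longleftrightarrow> (\<forall>j. (cmod (g $ j))\<^sup>2 \<in> A j)" for g
    unfolding split[of "\<lambda>j. (cmod (g $ j))\<^sup>2 \<in> A j"] by (simp add: aligned_def A_def)
  then have aligned: "row_at x -` aligned m a d \<inter> space \<Omega> = (\<Inter>j\<in>UNIV. gain x j -` A j \<inter> space \<Omega>)"
    by (auto simp: gain_def)
  have A_m: "prob (gain x m -` A m \<inter> space \<Omega>) = exp (- a)"
    using exponential_distributedD_gt[OF distributed_gain[of x m] assms(1)]
    by (simp add: A_def vimage_def Int_def conj_commute)
  have A_j: "prob (gain x j -` A j \<inter> space \<Omega>) = 1 - exp (- d)" if "j \<noteq> m" for j
    using exponential_distributedD_le[OF distributed_gain[of x j] assms(2)] that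
    by (simp add: A_def vimage_def Int_def conj_commute)
  have "prob (row_at x -` aligned m a d \<inter> space \<Omega>) = prob (\<Inter>j\<in>UNIV. gain x j -` A j \<inter> space \<Omega>)"
    by (simp only: aligned)
  also have "\<dots> = (\<Prod>j\<in>UNIV. prob (gain x j -` A j \<inter> space \<Omega>))"
    by (rule indep_varsD_finite[OF indep_vars_gain_row]) (auto simp: A_def)
  also have "\<dots> = prob (gain x m -` A m \<inter> space \<Omega>) * (\<Prod>j\<in>UNIV - {m}. prob (gain x j -` A j \<inter> space \<Omega>))"
    by (rule prod.remove) auto
  finally show ?thesis
    by (simp add: A_m A_j)
qed

text \<open>One fixed antenna \<open>i\<close> per user is enough for lower bounds: \<open>N\<close>
  candidates per beam already give the leading order \<open>ln N\<close> of the largest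
  gain.\<close>

definition all_aligned :: "'k \<Rightarrow> nat \<Rightarrow> real \<Rightarrow> real \<Rightarrow> 'w set" where
  "all_aligned i N a d = {\<omega> \<in> space \<Omega>. \<forall>m. \<exists>n<N. row_at (n, i) \<omega> \<in> aligned m a d}"

lemma all_aligned_events [measurable]: "all_aligned i N a d \<in> events"
  unfolding all_aligned_def by measurable

text \<open>A beam lacks an aligned user with probability \<open>(1 - q) ^ N\<close>, at most
  \<open>exp (- q N)\<close>, by independence of the rows; the factor \<open>M\<close> is the union
  bound over the beams.\<close>

lemma prob_all_aligned_ge:
  assumes N: "0 < N" and ad: "0 \<le> a" "0 \<le> d"
  shows "1 - real CARD('m) * exp (- real N * (exp (- a) * (1 - exp (- d)) ^ (CARD('m) - 1)))
    \<le> prob (all_aligned i N a d)"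
proof -
  define q where "q = exp (- a) * (1 - exp (- d)) ^ (CARD('m) - 1)"
  define U where "U m = {\<omega> \<in> space \<Omega>. \<forall>n<N. row_at (n, i) \<omega> \<notin> aligned m a d}" for m
  have U_event [measurable]: "U m \<in> events" for m
    unfolding U_def by measurable
  have U: "prob (U m) \<le> exp (- real N * q)" for m
  proof -
    let ?J = "(\<lambda>n. (n, i)) ` {..<N}"
    have q: "prob (row_at x -` aligned m a d \<inter> space \<Omega>) = q" for x
      using prob_aligned[OF ad] by (simp add: q_def)
    have "prob (row_at x -` (- aligned m a d) \<inter> space \<Omega>) = 1 - q" for x
    proof -
      have "row_at x -` (- aligned m a d) \<inter> space \<Omega> = space \<Omega> - (row_at x -` aligned m a d \<inter> space \<Omega>)"
        by auto
      then show ?thesis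
        using q[of x] by (simp add: prob_compl)
    qed
    then have "(\<Prod>x\<in>?J. prob (row_at x -` (- aligned m a d) \<inter> space \<Omega>)) = (1 - q) ^ N"
      by (simp add: card_image inj_on_def)
    moreover have "U m = (\<Inter>x\<in>?J. row_at x -` (- aligned m a d) \<inter> space \<Omega>)"
      using N by (auto simp: U_def)
    moreover have "prob (\<Inter>x\<in>?J. row_at x -` (- aligned m a d) \<inter> space \<Omega>)
        = (\<Prod>x\<in>?J. prob (row_at x -` (- aligned m a d) \<inter> space \<Omega>))"
      using N by (intro indep_varsD[OF indep_vars_row_at]) auto
    ultimately have "prob (U m) = (1 - q) ^ N"
      by simp
    also have "\<dots> \<le> exp (- q) ^ N"
      using exp_ge_add_one_self[of "- q"] prob_le_1[of "row_at (0, i) -` aligned m a d \<inter> space \<Omega>"] q[of "(0, i)"]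
      by (intro power_mono) auto
    finally show ?thesis
      by (simp flip: exp_of_nat_mult)
  qed
  have "prob (space \<Omega> - all_aligned i N a d) \<le> prob (\<Union>m\<in>UNIV. U m)"
    by (rule finite_measure_mono) (auto simp: all_aligned_def U_def)
  also have "\<dots> \<le> (\<Sum>m\<in>UNIV. prob (U m))"
    by (rule finite_measure_subadditive_finite) auto
  also have "\<dots> \<le> (\<Sum>m\<in>(UNIV::'m set). exp (- real N * q))"
    by (intro sum_mono U)
  finally show ?thesis
    by (simp add: prob_compl q_def)
qed

text \<open>An exponential-moment proxy for the largest squared channel norm: every summand is at
  most the sum, so that norm is at most \<open>ln (tilted_sum t N \<omega>) / t\<close>. For fixed
  \<open>t < 1\<close> the mean is a constant multiple of \<open>N\<close>, so the logarithm of the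
  mean divided by \<open>t\<close> is \<open>ln N / t\<close> up to a constant.\<close>

definition tilted_sum :: "real \<Rightarrow> nat \<Rightarrow> 'w \<Rightarrow> real" where
  "tilted_sum t N \<omega> = (\<Sum>n<N. exp (t * (\<Sum>i\<in>UNIV. \<Sum>j\<in>UNIV. gain (n, i) j \<omega>)))"

lemma tilted_sum_expectation:
  assumes "t < 1"
  shows "integrable \<Omega> (tilted_sum t N)"
    and "expectation (tilted_sum t N) = real N / (1 - t) ^ (CARD('k) * CARD('m))"
proof -
  have "has_bochner_integral \<Omega> (\<lambda>\<omega>. exp (t * (\<Sum>i\<in>UNIV. \<Sum>j\<in>UNIV. gain (n, i) j \<omega>)))
      (1 / (1 - t) ^ (CARD('k) * CARD('m)))" for n
  proof (rule has_bochner_integral_nn_integral)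
    have "indep_vars (\<lambda>_. borel) (\<lambda>(i, j). gain (n, i) j) UNIV"
      using indep_vars_reindex[OF indep_vars_gain, of "\<lambda>(i, j). ((n, i), j)" UNIV]
      by (simp add: inj_on_def case_prod_unfold)
    then have indep: "indep_vars (\<lambda>_. borel) (\<lambda>z \<omega>. ennreal (exp (t * gain (n, fst z) (snd z) \<omega>))) UNIV"
      using indep_vars_compose2[of "\<lambda>_. borel" "\<lambda>(i, j). gain (n, i) j" UNIV "\<lambda>_ s. ennreal (exp (t * s))" "\<lambda>_. borel"]
      by (simp add: case_prod_unfold)
    have "(\<integral>\<^sup>+\<omega>. ennreal (exp (t * (\<Sum>i\<in>UNIV. \<Sum>j\<in>UNIV. gain (n, i) j \<omega>))) \<partial>\<Omega>)
        = (\<integral>\<^sup>+\<omega>. (\<Prod>z\<in>UNIV. ennreal (exp (t * gain (n, fst z) (snd z) \<omega>))) \<partial>\<Omega>)"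
      by (intro nn_integral_cong)
        (simp add: prod_ennreal sum.cartesian_product sum_distrib_left exp_sum case_prod_unfold)
    also have "\<dots> = (\<Prod>z\<in>(UNIV :: ('k \<times> 'm) set). \<integral>\<^sup>+\<omega>. ennreal (exp (t * gain (n, fst z) (snd z) \<omega>)) \<partial>\<Omega>)"
      by (rule indep_vars_nn_integral[OF _ indep]) auto
    also have "\<dots> = (\<Prod>z\<in>(UNIV :: ('k \<times> 'm) set). ennreal (1 / (1 - t)))"
      using assms by (simp add: nn_integral_exp_exponential[OF distributed_gain])
    also have "\<dots> = ennreal (1 / (1 - t) ^ (CARD('k) * CARD('m)))"
      using assms by (simp add: prod_ennreal power_one_over ennreal_power)
    finally show "(\<integral>\<^sup>+\<omega>. ennreal (exp (t * (\<Sum>i\<in>UNIV. \<Sum>j\<in>UNIV. gain (n, i) j \<omega>))) \<partial>\<Omega>)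
        = ennreal (1 / (1 - t) ^ (CARD('k) * CARD('m)))" .
  qed (use assms in auto)
  then have "has_bochner_integral \<Omega> (tilted_sum t N) (\<Sum>n<N. 1 / (1 - t) ^ (CARD('k) * CARD('m)))"
    unfolding tilted_sum_def[abs_def] by (intro has_bochner_integral_sum)
  then show "integrable \<Omega> (tilted_sum t N)"
    "expectation (tilted_sum t N) = real N / (1 - t) ^ (CARD('k) * CARD('m))"
    by (auto simp: has_bochner_integral_iff)
qed

lemma max_sum_rate_random_variable:
  assumes "0 < N" "0 \<le> p"
  shows "(\<lambda>\<omega>. max_sum_rate N p (\<lambda>n. H n \<omega>)) \<in> borel_measurable \<Omega>"
  by (rule measurable_compose[OF measurable_coordinatewise_then_product borel_measurable_max_sum_rate[OF assms]])
    simp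

lemma R_Opt_le:
  assumes N: "0 < N" and p: "0 \<le> p" and t: "0 < t" "t < 1"
  shows "integrable \<Omega> (\<lambda>\<omega>. max_sum_rate N p (\<lambda>n. H n \<omega>))"
    and "R_Opt \<Omega> H N p \<le> real CARD('m) * ln (1 + p / real CARD('m) *
      (ln (real N / (1 - t) ^ (CARD('k) * CARD('m))) / t))"
proof -
  let ?M = "real CARD('m)"
  define w where "w = real N / (1 - t) ^ (CARD('k) * CARD('m))"
  have w: "0 < w"
    using N t by (simp add: w_def)
  let ?f = "\<lambda>\<omega>. max_sum_rate N p (\<lambda>n. H n \<omega>) / ?M"
  \<comment> \<open>The tangent of \<open>ln\<close> at \<open>w\<close>, the mean of the tilted
    sum, replaces \<open>ln ?W\<close>. It makes the majorant linear in \<open>?W\<close>, with mean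
    \<open>p / ?M * (ln w / t)\<close>.\<close>
  let ?g = "\<lambda>\<omega>. p / ?M * ((tilted_sum t N \<omega> / w - 1 + ln w) / t)"
  have bound: "?f \<omega> \<le> ln (1 + ?g \<omega>)" "0 \<le> ?g \<omega>" for \<omega>
  proof -
    let ?W = "tilted_sum t N \<omega>"
    have norm_H: "(norm (H n \<omega>))\<^sup>2 = (\<Sum>i\<in>UNIV. \<Sum>j\<in>UNIV. gain (n, i) j \<omega>)" for n
      by (simp add: norm_matrix_power2 gain_def row_at_def)
    have le_W: "exp (t * (norm (H n \<omega>))\<^sup>2) \<le> ?W" if "n < N" for n
      unfolding tilted_sum_def norm_H
      using that by (intro member_le_sum[of n "{..<N}" "\<lambda>n. exp (t * (\<Sum>i\<in>UNIV. \<Sum>j\<in>UNIV. gain (n, i) j \<omega>))"]) auto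
    have "1 \<le> exp (t * (norm (H 0 \<omega>))\<^sup>2)"
      using t by simp
    then have W: "1 \<le> ?W"
      using le_W[OF N] by linarith
    have v: "(norm (H n \<omega>))\<^sup>2 \<le> ln ?W / t" if "n < N" for n
    proof -
      have "ln (exp (t * (norm (H n \<omega>))\<^sup>2)) \<le> ln ?W"
        using le_W[OF that] by (intro ln_mono) auto
      then show ?thesis
        using t by (simp add: field_simps)
    qed
    have "ln (?W / w) \<le> ?W / w - 1"
      using W w by (intro ln_le_minus_one) auto
    then have ln_W: "ln ?W \<le> ?W / w - 1 + ln w"
      using W w by (simp add: ln_div)
    have "0 \<le> ln ?W"
      using W by simp
    with ln_W have nonneg: "0 \<le> (?W / w - 1 + ln w) / t"
      using t by simp
    then show "0 \<le> ?g \<omega>"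
      using p by (intro mult_nonneg_nonneg) auto
    have "max_sum_rate N p (\<lambda>n. H n \<omega>) \<le> ?M * ln (1 + p / ?M * ((?W / w - 1 + ln w) / t))"
      using N p nonneg
    proof (rule max_sum_rate_le)
      fix n assume "n < N"
      then have "(norm (H n \<omega>))\<^sup>2 \<le> ln ?W / t"
        by (rule v)
      also have "\<dots> \<le> (?W / w - 1 + ln w) / t"
        using ln_W t by (intro divide_right_mono) auto
      finally show "(norm (H n \<omega>))\<^sup>2 \<le> (?W / w - 1 + ln w) / t" .
    qed
    then show "?f \<omega> \<le> ln (1 + ?g \<omega>)"
      by (simp add: divide_le_eq mult.commute)
  qed
  have g: "expectation ?g = p / ?M * (ln w / t)"
    using w t tilted_sum_expectation[OF t(2), of N] by (simp add: prob_space w_def[symmetric])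
  have g_int: "integrable \<Omega> ?g"
    using tilted_sum_expectation[OF t(2), of N] by auto
  have f_meas: "?f \<in> borel_measurable \<Omega>"
    using max_sum_rate_random_variable[OF N p] by simp
  have f_nonneg: "0 \<le> ?f \<omega>" for \<omega>
    by (intro divide_nonneg_nonneg max_sum_rate_nonneg N p) simp
  have *: "integrable \<Omega> ?f" "expectation ?f \<le> ln (1 + p / ?M * (ln w / t))"
    using expectation_ln_1_plus_le[OF f_meas g_int f_nonneg bound eq_refl[OF g]] .
  show "integrable \<Omega> (\<lambda>\<omega>. max_sum_rate N p (\<lambda>n. H n \<omega>))"
    using integrable_mult_right[OF *(1), of ?M] by simp
  from *(2) show "R_Opt \<Omega> H N p \<le> ?M * ln (1 + p / ?M *
      (ln (real N / (1 - t) ^ (CARD('k) * CARD('m))) / t))"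
    by (simp add: R_Opt_def w_def divide_le_eq mult.commute)
qed

text \<open>Interference at most 1 and \<open>sqrt a\<close> at least \<open>M\<^sup>2\<close> are
  what diagonal dominance in \<open>max_sum_rate_ge_selection\<close> asks for. Outside the event
  the rate is only used to be nonnegative.\<close>

lemma R_Opt_ge:
  assumes N: "0 < N" and p: "0 \<le> p" and a: "(real CARD('m))^4 \<le> a"
  shows "real CARD('m) * ln (1 + p / real CARD('m) * (sqrt a - (real CARD('m))\<^sup>2)\<^sup>2) *
      prob (all_aligned i N a 1) \<le> R_Opt \<Omega> H N p"
  unfolding R_Opt_def
proof (rule expectation_ge_on_event)
  show "integrable \<Omega> (\<lambda>\<omega>. max_sum_rate N p (\<lambda>n. H n \<omega>))"
    using R_Opt_le(1)[OF N p, of "1 / 2"] by simp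
  fix \<omega> assume "\<omega> \<in> all_aligned i N a 1"
  then have "\<forall>m. \<exists>n. n < N \<and> row_at (n, i) \<omega> \<in> aligned m a 1"
    by (simp add: all_aligned_def)
  then obtain \<sigma> where "\<forall>m. \<sigma> m < N \<and> row_at (\<sigma> m, i) \<omega> \<in> aligned m a 1"
    using choice[of "\<lambda>m n. n < N \<and> row_at (n, i) \<omega> \<in> aligned m a 1"] by blast
  then have \<sigma>: "\<And>m. \<sigma> m < N" "\<And>m. row_at (\<sigma> m, i) \<omega> \<in> aligned m a 1"
    by blast+
  show "real CARD('m) * ln (1 + p / real CARD('m) * (sqrt a - (real CARD('m))\<^sup>2)\<^sup>2)
      \<le> max_sum_rate N p (\<lambda>n. H n \<omega>)"
  proof (rule max_sum_rate_ge_selection[OF \<sigma>(1)])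
    show "sqrt a \<le> cmod (H (\<sigma> m) \<omega> $ i $ m)" for m
      using \<sigma>(2)[of m] by (intro real_le_lsqrt) (simp_all add: aligned_def row_at_def)
    show "cmod (H (\<sigma> m) \<omega> $ i $ j) \<le> 1" if "j \<noteq> m" for m j
      using \<sigma>(2)[of m] that by (auto simp: aligned_def row_at_def abs_square_le_1)
    show "(real CARD('m))\<^sup>2 \<le> sqrt a"
      using a by (intro real_le_rsqrt) (simp flip: power_mult)
  qed (rule p)
qed (use max_sum_rate_nonneg[OF N p] in auto)

end

subsection \<open>Expected beam-forming rate\<close>

context mimo_broadcast_channel
begin

section \<open>The SINR of one antenna\<close>

definition beam_SINR :: "real \<Rightarrow> 'm \<Rightarrow> nat \<times> 'k \<Rightarrow> 'w \<Rightarrow> real" where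
  "beam_SINR p m x \<omega> = axis_SINR p (row_at x \<omega>) m"

lemma borel_measurable_beam_SINR [measurable]: "beam_SINR p m x \<in> borel_measurable \<Omega>"
  unfolding beam_SINR_def[abs_def] by measurable

lemma beam_SINR_eq:
  "beam_SINR p m x \<omega> = p / real CARD('m) * gain x m \<omega> /
     (1 + p / real CARD('m) * (\<Sum>j\<in>UNIV - {m}. gain x j \<omega>))"
  by (simp add: beam_SINR_def axis_SINR_def gain_def)

lemma beam_SINR_nonneg: "0 \<le> p \<Longrightarrow> 0 \<le> beam_SINR p m x \<omega>"
  unfolding beam_SINR_eq
  by (intro divide_nonneg_nonneg mult_nonneg_nonneg add_nonneg_nonneg sum_nonneg) auto

lemma indep_var_gain_interference:
  "indep_var borel (gain x m) borel (\<lambda>\<omega>. \<Sum>j\<in>UNIV - {m}. gain x j \<omega>)"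
  by (rule indep_vars_sum) (auto intro: indep_vars_subset[OF indep_vars_gain_row])

lemma nn_integral_exp_interference:
  assumes "0 \<le> s"
  shows "(\<integral>\<^sup>+\<omega>. ennreal (exp (- s * (\<Sum>j\<in>UNIV - {m}. gain x j \<omega>))) \<partial>\<Omega>)
    = ennreal (1 / (1 + s) ^ (CARD('m) - 1))"
proof -
  have "indep_vars (\<lambda>_. borel) (\<lambda>j \<omega>. ennreal (exp (- s * gain x j \<omega>))) (UNIV - {m})"
    by (rule indep_vars_compose2[OF indep_vars_subset[OF indep_vars_gain_row]]) auto
  note indep = indep_vars_nn_integral[OF _ this]
  have "(\<integral>\<^sup>+\<omega>. ennreal (exp (- s * (\<Sum>j\<in>UNIV - {m}. gain x j \<omega>))) \<partial>\<Omega>)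
      = (\<integral>\<^sup>+\<omega>. (\<Prod>j\<in>UNIV - {m}. ennreal (exp (- s * gain x j \<omega>))) \<partial>\<Omega>)"
    by (intro nn_integral_cong) (simp add: prod_ennreal sum_distrib_left exp_sum flip: sum_negf)
  also have "\<dots> = (\<Prod>j\<in>UNIV - {m}. \<integral>\<^sup>+\<omega>. ennreal (exp (- s * gain x j \<omega>)) \<partial>\<Omega>)"
    by (rule indep) auto
  also have "\<dots> = (\<Prod>j\<in>UNIV - {m}. ennreal (1 / (1 + s)))"
    using assms nn_integral_exp_exponential[OF distributed_gain, of "- s"] by (intro prod.cong) auto
  also have "\<dots> = ennreal (1 / (1 + s) ^ (CARD('m) - 1))"
    using assms by (simp add: prod_ennreal power_one_over ennreal_power)
  finally show ?thesis .
qed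

text \<open>With \<open>c = p / M\<close> and interference \<open>Y\<close>, the SINR exceeds
  \<open>s\<close> exactly if the gain exceeds \<open>s * (1 / c + Y)\<close>, and the excess is at
  most \<open>c\<close> times that of the gain because the denominator is at least 1. Given
  \<open>Y\<close>, the mean excess of the gain is exponential in \<open>Y\<close>, and the Laplace
  transform of \<open>Y\<close> supplies the factor \<open>1 / (1 + s) ^ (M - 1)\<close>. Thus
  \<open>b\<close> is \<open>c\<close> times the tail probability of the SINR at
  \<open>s\<close>.\<close>

lemma beam_SINR_excess:
  assumes p: "0 < p" and s: "0 \<le> s"
  defines "b \<equiv> p / real CARD('m) * exp (- s * real CARD('m) / p) / (1 + s) ^ (CARD('m) - 1)"
  shows "integrable \<Omega> (\<lambda>\<omega>. max 0 (beam_SINR p m x \<omega> - s))"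
    and "expectation (\<lambda>\<omega>. max 0 (beam_SINR p m x \<omega> - s)) \<le> b"
proof -
  define c where "c = p / real CARD('m)"
  have c: "0 < c"
    using p by (simp add: c_def)
  let ?Y = "\<lambda>\<omega>. \<Sum>j\<in>UNIV - {m}. gain x j \<omega>"
  have Y: "0 \<le> ?Y \<omega>" for \<omega>
    by (simp add: sum_nonneg)
  have pointwise: "max 0 (beam_SINR p m x \<omega> - s) \<le> c * max 0 (gain x m \<omega> - s * (1 / c + ?Y \<omega>))" for \<omega>
  proof -
    have d: "1 \<le> 1 + c * ?Y \<omega>"
      using c Y[of \<omega>] by simp
    have "beam_SINR p m x \<omega> - s = c * (gain x m \<omega> - s * (1 / c + ?Y \<omega>)) / (1 + c * ?Y \<omega>)"
      using c d by (simp add: beam_SINR_eq c_def[symmetric] divide_simps)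
    also have "\<dots> \<le> c * max 0 (gain x m \<omega> - s * (1 / c + ?Y \<omega>)) / (1 + c * ?Y \<omega>)"
      using c d by (intro divide_right_mono mult_left_mono) auto
    also have "\<dots> \<le> c * max 0 (gain x m \<omega> - s * (1 / c + ?Y \<omega>)) / 1"
      using c d by (intro divide_left_mono) auto
    finally show ?thesis
      using c by simp
  qed
  have "(\<integral>\<^sup>+\<omega>. ennreal (max 0 (beam_SINR p m x \<omega> - s)) \<partial>\<Omega>)
      \<le> (\<integral>\<^sup>+\<omega>. ennreal c * ennreal (max 0 (gain x m \<omega> - s * (1 / c + ?Y \<omega>))) \<partial>\<Omega>)"
  proof (rule nn_integral_mono)
    fix \<omega>
    have "ennreal (max 0 (beam_SINR p m x \<omega> - s)) \<le> ennreal (c * max 0 (gain x m \<omega> - s * (1 / c + ?Y \<omega>)))"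
      by (rule ennreal_leI[OF pointwise])
    also have "\<dots> = ennreal c * ennreal (max 0 (gain x m \<omega> - s * (1 / c + ?Y \<omega>)))"
      using c by (intro ennreal_mult) simp_all
    finally show "ennreal (max 0 (beam_SINR p m x \<omega> - s))
        \<le> ennreal c * ennreal (max 0 (gain x m \<omega> - s * (1 / c + ?Y \<omega>)))" .
  qed
  also have "\<dots> = ennreal c * (\<integral>\<^sup>+\<omega>. ennreal (max 0 (gain x m \<omega> - s * (1 / c + ?Y \<omega>))) \<partial>\<Omega>)"
    by (rule nn_integral_cmult) simp
  also have "(\<integral>\<^sup>+\<omega>. ennreal (max 0 (gain x m \<omega> - s * (1 / c + ?Y \<omega>))) \<partial>\<Omega>)
      = (\<integral>\<^sup>+\<omega>'. \<integral>\<^sup>+\<omega>. ennreal (max 0 (gain x m \<omega> - s * (1 / c + ?Y \<omega>'))) \<partial>\<Omega> \<partial>\<Omega>)"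
    by (rule nn_integral_indep_var[OF indep_var_gain_interference,
          of "\<lambda>u y. ennreal (max 0 (u - s * (1 / c + y)))"]) simp
  also have "\<dots> = (\<integral>\<^sup>+\<omega>'. ennreal (exp (- (s * (1 / c + ?Y \<omega>')))) \<partial>\<Omega>)"
    using c s Y by (intro nn_integral_cong nn_integral_excess_exponential[OF distributed_gain]
        mult_nonneg_nonneg add_nonneg_nonneg) auto
  also have "\<dots> = (\<integral>\<^sup>+\<omega>'. ennreal (exp (- s / c)) * ennreal (exp (- s * ?Y \<omega>')) \<partial>\<Omega>)"
  proof (rule nn_integral_cong)
    fix \<omega>
    have "exp (- (s * (1 / c + ?Y \<omega>))) = exp (- s / c) * exp (- s * ?Y \<omega>)"
      by (simp add: distrib_left flip: exp_add)
    then show "ennreal (exp (- (s * (1 / c + ?Y \<omega>)))) = ennreal (exp (- s / c)) * ennreal (exp (- s * ?Y \<omega>))"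
      by (simp only: ennreal_mult exp_ge_zero)
  qed
  also have "\<dots> = ennreal (exp (- s / c)) * ennreal (1 / (1 + s) ^ (CARD('m) - 1))"
    by (subst nn_integral_cmult) (simp_all only: nn_integral_exp_interference[OF s], simp)
  also have "ennreal c * \<dots> = ennreal b"
    using c s by (simp add: b_def c_def ennreal_mult' mult_ac flip: ennreal_mult)
  finally have le: "(\<integral>\<^sup>+\<omega>. ennreal (max 0 (beam_SINR p m x \<omega> - s)) \<partial>\<Omega>) \<le> ennreal b" .
  show int: "integrable \<Omega> (\<lambda>\<omega>. max 0 (beam_SINR p m x \<omega> - s))"
    using le by (intro integrableI_nonneg) (auto simp: le_less_trans)
  have "0 \<le> b"
    using p s by (simp add: b_def)
  moreover have "(\<integral>\<^sup>+\<omega>. ennreal (max 0 (beam_SINR p m x \<omega> - s)) \<partial>\<Omega>)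
      = ennreal (expectation (\<lambda>\<omega>. max 0 (beam_SINR p m x \<omega> - s)))"
    by (rule nn_integral_eq_integral[OF int]) (rule AE_I2, rule max.cobounded1)
  ultimately show "expectation (\<lambda>\<omega>. max 0 (beam_SINR p m x \<omega> - s)) \<le> b"
    using le by (simp only: ennreal_le_iff)
qed

text \<open>A bound independent of the power. Keeping a single interferer \<open>j\<close>, which
  exists since there are two beams, bounds the SINR by the ratio of two independent gains, and the
  power cancels. The ratio has infinite mean, hence the square root; the crude
  \<open>sqrt u \<le> 1 + u\<close> with mean 2 accounts for the constant.\<close>

lemma expectation_sqrt_beam_SINR:
  assumes M: "2 \<le> CARD('m)" and p: "0 < p"
  shows "integrable \<Omega> (\<lambda>\<omega>. sqrt (beam_SINR p m x \<omega>))"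
    and "expectation (\<lambda>\<omega>. sqrt (beam_SINR p m x \<omega>)) \<le> 2 * Gamma (1 / 2)"
proof -
  define c where "c = p / real CARD('m)"
  have c: "0 < c"
    using p by (simp add: c_def)
  have "(UNIV :: 'm set) \<noteq> {m}"
  proof
    assume "(UNIV :: 'm set) = {m}"
    then have "CARD('m) = card {m}"
      by (rule arg_cong)
    then show False
      using M by simp
  qed
  then obtain j where j: "j \<noteq> m"
    by blast
  have indep: "indep_var borel (gain x m) borel (gain x j)"
  proof -
    have "indep_var borel (gain x m) borel (\<lambda>\<omega>. \<Sum>j\<in>{j}. gain x j \<omega>)"
      using j by (intro indep_vars_sum indep_vars_subset[OF indep_vars_gain_row]) auto
    then show ?thesis
      by simp
  qed
  have AE: "AE \<omega> in \<Omega>. 0 < gain x j \<omega>"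
  proof -
    have "prob {\<omega> \<in> space \<Omega>. 0 < gain x j \<omega>} = 1"
      using exponential_distributedD_gt[OF distributed_gain[of x j], of 0] by simp
    then have "AE \<omega> in \<Omega>. \<omega> \<in> {\<omega> \<in> space \<Omega>. 0 < gain x j \<omega>}"
      by (subst AE_in_set_eq_1) simp_all
    then show ?thesis
      by eventually_elim simp
  qed
  have pointwise: "sqrt (beam_SINR p m x \<omega>) \<le> (1 + gain x m \<omega>) * gain x j \<omega> powr (- 1 / 2)"
    if pos: "0 < gain x j \<omega>" for \<omega>
  proof -
    have "c * gain x j \<omega> \<le> 1 + c * (\<Sum>j\<in>UNIV - {m}. gain x j \<omega>)"
    proof -
      have "gain x j \<omega> \<le> (\<Sum>j\<in>UNIV - {m}. gain x j \<omega>)"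
        using j by (intro member_le_sum) auto
      then have "c * gain x j \<omega> \<le> c * (\<Sum>j\<in>UNIV - {m}. gain x j \<omega>)"
        using c by (intro mult_left_mono) auto
      then show ?thesis
        by simp
    qed
    then have "beam_SINR p m x \<omega> \<le> c * gain x m \<omega> / (c * gain x j \<omega>)"
      unfolding beam_SINR_eq c_def[symmetric] using c pos
      by (intro frac_le) simp_all
    also have "\<dots> = gain x m \<omega> / gain x j \<omega>"
      using c by simp
    finally have "sqrt (beam_SINR p m x \<omega>) \<le> sqrt (gain x m \<omega>) / sqrt (gain x j \<omega>)"
      unfolding real_sqrt_divide[symmetric] by (rule real_sqrt_le_mono)
    also have "\<dots> = sqrt (gain x m \<omega>) * gain x j \<omega> powr (- 1 / 2)"
    proof -
      have "gain x j \<omega> powr (- 1 / 2) = inverse (sqrt (gain x j \<omega>))"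
        using pos powr_minus[of "gain x j \<omega>" "1 / 2"] powr_half_sqrt[of "gain x j \<omega>"] by simp
      then show ?thesis
        by (simp only: divide_inverse)
    qed
    also have "\<dots> \<le> (1 + gain x m \<omega>) * gain x j \<omega> powr (- 1 / 2)"
    proof (rule mult_right_mono)
      show "sqrt (gain x m \<omega>) \<le> 1 + gain x m \<omega>"
        by (rule real_le_lsqrt) (simp_all add: power2_sum add_increasing)
    qed simp
    finally show ?thesis .
  qed
  have "(\<integral>\<^sup>+\<omega>. ennreal (sqrt (beam_SINR p m x \<omega>)) \<partial>\<Omega>)
      \<le> (\<integral>\<^sup>+\<omega>. ennreal (1 + gain x m \<omega>) * ennreal (gain x j \<omega> powr (- 1 / 2)) \<partial>\<Omega>)"
  proof (rule nn_integral_mono_AE)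
    have "ennreal (sqrt (beam_SINR p m x \<omega>)) \<le> ennreal (1 + gain x m \<omega>) * ennreal (gain x j \<omega> powr (- 1 / 2))"
      if "0 < gain x j \<omega>" for \<omega>
      unfolding ennreal_mult[OF add_nonneg_nonneg[OF zero_le_one gain_nonneg] powr_ge_zero, symmetric]
      by (rule ennreal_leI[OF pointwise[OF that]])
    with AE show "AE \<omega> in \<Omega>. ennreal (sqrt (beam_SINR p m x \<omega>))
        \<le> ennreal (1 + gain x m \<omega>) * ennreal (gain x j \<omega> powr (- 1 / 2))"
      by (rule eventually_mono)
  qed
  also have "\<dots> = (\<integral>\<^sup>+\<omega>'. \<integral>\<^sup>+\<omega>. ennreal (1 + gain x m \<omega>) * ennreal (gain x j \<omega>' powr (- 1 / 2)) \<partial>\<Omega> \<partial>\<Omega>)"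
    by (rule nn_integral_indep_var[OF indep, of "\<lambda>u v. ennreal (1 + u) * ennreal (v powr (- 1 / 2))"]) simp
  also have "\<dots> = (\<integral>\<^sup>+\<omega>. ennreal (1 + gain x m \<omega>) \<partial>\<Omega>) * (\<integral>\<^sup>+\<omega>'. ennreal (gain x j \<omega>' powr (- 1 / 2)) \<partial>\<Omega>)"
    by (simp add: nn_integral_multc nn_integral_cmult)
  also have "(\<integral>\<^sup>+\<omega>. ennreal (1 + gain x m \<omega>) \<partial>\<Omega>) = ennreal 2"
  proof -
    have "(\<integral>\<^sup>+\<omega>. ennreal (gain x m \<omega>) \<partial>\<Omega>) = 1"
      using nn_integral_excess_exponential[OF distributed_gain[of x m], of 0] by simp
    then show ?thesis
      by (simp add: ennreal_plus nn_integral_add emeasure_space_1 del: ennreal_plus[symmetric])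
  qed
  also have "(\<integral>\<^sup>+\<omega>'. ennreal (gain x j \<omega>' powr (- 1 / 2)) \<partial>\<Omega>) = ennreal (Gamma (1 / 2))"
    by (rule nn_integral_powr_exponential[OF distributed_gain])
  also have "ennreal 2 * ennreal (Gamma (1 / 2)) = ennreal (2 * Gamma (1 / 2))"
    by (simp add: ennreal_mult' Gamma_real_nonneg)
  finally have le: "(\<integral>\<^sup>+\<omega>. ennreal (sqrt (beam_SINR p m x \<omega>)) \<partial>\<Omega>) \<le> ennreal (2 * Gamma (1 / 2))" .
  have nonneg: "0 \<le> sqrt (beam_SINR p m x \<omega>)" for \<omega>
    using beam_SINR_nonneg p by simp
  show int: "integrable \<Omega> (\<lambda>\<omega>. sqrt (beam_SINR p m x \<omega>))"
    using le nonneg by (intro integrableI_nonneg) (auto simp: le_less_trans)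
  show "expectation (\<lambda>\<omega>. sqrt (beam_SINR p m x \<omega>)) \<le> 2 * Gamma (1 / 2)"
    using le by (simp add: nn_integral_eq_integral[OF int nonneg[THEN AE_I2]] Gamma_real_nonneg)
qed

section \<open>The largest SINR and the mean beam-forming rate\<close>

definition max_SINR :: "real \<Rightarrow> 'm \<Rightarrow> nat \<Rightarrow> 'w \<Rightarrow> real" where
  "max_SINR p m N \<omega> = Max ((\<lambda>x. beam_SINR p m x \<omega>) ` ({..<N} \<times> UNIV))"

lemma borel_measurable_max_SINR [measurable]: "max_SINR p m N \<in> borel_measurable \<Omega>"
  unfolding max_SINR_def[abs_def] by measurable

lemma max_SINR_ge:
  assumes "n < N"
  shows "beam_SINR p m (n, i) \<omega> \<le> max_SINR p m N \<omega>"
  unfolding max_SINR_def using assms by (intro Max_ge) auto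

lemma max_SINR_nonneg: "0 < N \<Longrightarrow> 0 \<le> p \<Longrightarrow> 0 \<le> max_SINR p m N \<omega>"
  using beam_SINR_nonneg[of p m "(0, undefined)" \<omega>] max_SINR_ge[of 0 N p m undefined \<omega>] by linarith

lemma R_RBF_eq_max_SINR: "R_RBF \<Omega> H \<Phi> N p = (LINT \<omega>|\<Omega>. (\<Sum>m\<in>UNIV. ln (1 + max_SINR p m N \<omega>)))"
  by (simp add: R_RBF_eq axis_sum_rate_def max_SINR_def beam_SINR_def)

text \<open>A maximum is at most a threshold \<open>s\<close> plus the sum of all excesses over
  \<open>s\<close>, so no independence between antennas is needed. The threshold remains free and is
  tuned in the asymptotics.\<close>

lemma expectation_ln_max_SINR:
  assumes N: "0 < N" and p: "0 < p" and s: "0 \<le> s"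
  defines "b \<equiv> p / real CARD('m) * exp (- s * real CARD('m) / p) / (1 + s) ^ (CARD('m) - 1)"
  shows "integrable \<Omega> (\<lambda>\<omega>. ln (1 + max_SINR p m N \<omega>))"
    and "expectation (\<lambda>\<omega>. ln (1 + max_SINR p m N \<omega>)) \<le> ln (1 + (s + real N * real CARD('k) * b))"
proof -
  let ?I = "{..<N} \<times> (UNIV :: 'k set)"
  let ?g = "\<lambda>\<omega>. s + (\<Sum>x\<in>?I. max 0 (beam_SINR p m x \<omega> - s))"
  have meas: "(\<lambda>\<omega>. ln (1 + max_SINR p m N \<omega>)) \<in> borel_measurable \<Omega>"
    by measurable
  have int: "integrable \<Omega> ?g"
    using beam_SINR_excess(1)[OF p s] by auto
  have nonneg: "0 \<le> ln (1 + max_SINR p m N \<omega>)" for \<omega>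
    using max_SINR_nonneg[OF N, of p m \<omega>] p by simp
  have bound: "ln (1 + max_SINR p m N \<omega>) \<le> ln (1 + ?g \<omega>)" for \<omega>
  proof -
    have "max_SINR p m N \<omega> \<in> (\<lambda>x. beam_SINR p m x \<omega>) ` ?I"
      unfolding max_SINR_def using N by (intro Max_in) auto
    then obtain x where x: "x \<in> ?I" "max_SINR p m N \<omega> = beam_SINR p m x \<omega>"
      by blast
    have "max 0 (beam_SINR p m x \<omega> - s) \<le> (\<Sum>x\<in>?I. max 0 (beam_SINR p m x \<omega> - s))"
      using x(1) by (intro member_le_sum) auto
    then have "max_SINR p m N \<omega> \<le> ?g \<omega>"
      using x(2) by simp
    then show ?thesis
      using max_SINR_nonneg[OF N, of p m \<omega>] p by (intro ln_mono) auto
  qed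
  have g_nonneg: "0 \<le> ?g \<omega>" for \<omega>
    using s by (intro add_nonneg_nonneg sum_nonneg) auto
  have "expectation ?g = s + (\<Sum>x\<in>?I. expectation (\<lambda>\<omega>. max 0 (beam_SINR p m x \<omega> - s)))"
    using beam_SINR_excess(1)[OF p s] by (simp add: prob_space)
  also have "\<dots> \<le> s + (\<Sum>x\<in>?I. b)"
    unfolding b_def by (intro add_left_mono sum_mono beam_SINR_excess(2)[OF p s])
  also have "\<dots> = s + real N * real CARD('k) * b"
    by (simp add: card_cartesian_product)
  finally have Eg: "expectation ?g \<le> s + real N * real CARD('k) * b" .
  show "integrable \<Omega> (\<lambda>\<omega>. ln (1 + max_SINR p m N \<omega>))"
    "expectation (\<lambda>\<omega>. ln (1 + max_SINR p m N \<omega>)) \<le> ln (1 + (s + real N * real CARD('k) * b))"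
    using expectation_ln_1_plus_le[OF meas int nonneg bound g_nonneg Eg] .
qed

lemma R_RBF_le:
  assumes N: "0 < N" and p: "0 < p" and s: "0 \<le> s"
  shows "R_RBF \<Omega> H \<Phi> N p \<le> real CARD('m) * ln (1 + (s + real N * real CARD('k) *
    (p / real CARD('m) * exp (- s * real CARD('m) / p) / (1 + s) ^ (CARD('m) - 1))))"
proof -
  have "R_RBF \<Omega> H \<Phi> N p = (\<Sum>m\<in>UNIV. expectation (\<lambda>\<omega>. ln (1 + max_SINR p m N \<omega>)))"
    unfolding R_RBF_eq_max_SINR using expectation_ln_max_SINR(1)[OF N p s] by simp
  also have "\<dots> \<le> (\<Sum>m\<in>(UNIV :: 'm set). ln (1 + (s + real N * real CARD('k) *
    (p / real CARD('m) * exp (- s * real CARD('m) / p) / (1 + s) ^ (CARD('m) - 1)))))"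
    by (intro sum_mono expectation_ln_max_SINR(2)[OF N p s])
  finally show ?thesis
    by simp
qed

text \<open>From \<open>1 + S \<le> (1 + sqrt S)\<^sup>2\<close>, half of each logarithm is
  dominated by a logarithm of a sum of square roots, which has finite mean. This is the origin of
  the factor 2, and the bound does not involve \<open>p\<close>.\<close>

lemma R_RBF_le_uniform:
  assumes M: "2 \<le> CARD('m)" and N: "0 < N" and p: "0 < p"
  shows "R_RBF \<Omega> H \<Phi> N p \<le> 2 * real CARD('m) * ln (1 + real N * real CARD('k) * (2 * Gamma (1 / 2)))"
proof -
  let ?I = "{..<N} \<times> (UNIV :: 'k set)"
  have "expectation (\<lambda>\<omega>. ln (1 + max_SINR p m N \<omega>))
      \<le> 2 * ln (1 + real N * real CARD('k) * (2 * Gamma (1 / 2)))" for m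
  proof -
    let ?f = "\<lambda>\<omega>. ln (1 + max_SINR p m N \<omega>) / 2"
    let ?g = "\<lambda>\<omega>. \<Sum>x\<in>?I. sqrt (beam_SINR p m x \<omega>)"
    have meas: "?f \<in> borel_measurable \<Omega>"
      by measurable
    have int: "integrable \<Omega> ?g"
      using expectation_sqrt_beam_SINR(1)[OF M p] by auto
    have nonneg: "0 \<le> ?f \<omega>" for \<omega>
      using max_SINR_nonneg[OF N, of p m \<omega>] p by simp
    have g_nonneg: "0 \<le> ?g \<omega>" for \<omega>
      using beam_SINR_nonneg p by (intro sum_nonneg) auto
    have bound: "?f \<omega> \<le> ln (1 + ?g \<omega>)" for \<omega>
    proof -
      have "max_SINR p m N \<omega> \<in> (\<lambda>x. beam_SINR p m x \<omega>) ` ?I"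
        unfolding max_SINR_def using N by (intro Max_in) auto
      then obtain x where x: "x \<in> ?I" "max_SINR p m N \<omega> = beam_SINR p m x \<omega>"
        by blast
      have S: "0 \<le> beam_SINR p m x \<omega>"
        using beam_SINR_nonneg p by simp
      have "sqrt (beam_SINR p m x \<omega>) \<le> ?g \<omega>"
        using x(1) beam_SINR_nonneg p by (intro member_le_sum) auto
      then have "(1 + sqrt (beam_SINR p m x \<omega>))\<^sup>2 \<le> (1 + ?g \<omega>)\<^sup>2"
        using S by (intro power_mono) auto
      moreover have "1 + beam_SINR p m x \<omega> \<le> (1 + sqrt (beam_SINR p m x \<omega>))\<^sup>2"
        using S by (simp add: power2_sum)
      ultimately have "ln (1 + max_SINR p m N \<omega>) \<le> ln ((1 + ?g \<omega>)\<^sup>2)"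
        using S x(2) by (intro ln_mono) auto
      also have "\<dots> = 2 * ln (1 + ?g \<omega>)"
        using g_nonneg[of \<omega>] by (simp add: ln_realpow)
      finally show ?thesis
        by simp
    qed
    have "expectation ?g = (\<Sum>x\<in>?I. expectation (\<lambda>\<omega>. sqrt (beam_SINR p m x \<omega>)))"
      using expectation_sqrt_beam_SINR(1)[OF M p] by simp
    also have "\<dots> \<le> (\<Sum>x\<in>?I. 2 * Gamma (1 / 2))"
      by (intro sum_mono expectation_sqrt_beam_SINR(2)[OF M p])
    also have "\<dots> = real N * real CARD('k) * (2 * Gamma (1 / 2))"
      by (simp add: card_cartesian_product)
    finally have Eg: "expectation ?g \<le> real N * real CARD('k) * (2 * Gamma (1 / 2))" .
    show ?thesis
      using expectation_ln_1_plus_le(2)[OF meas int nonneg bound g_nonneg Eg] by simp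
  qed
  then have "(\<Sum>m\<in>UNIV. expectation (\<lambda>\<omega>. ln (1 + max_SINR p m N \<omega>)))
      \<le> (\<Sum>m\<in>(UNIV :: 'm set). 2 * ln (1 + real N * real CARD('k) * (2 * Gamma (1 / 2))))"
    by (rule sum_mono)
  moreover have "R_RBF \<Omega> H \<Phi> N p = (\<Sum>m\<in>UNIV. expectation (\<lambda>\<omega>. ln (1 + max_SINR p m N \<omega>)))"
    unfolding R_RBF_eq_max_SINR using expectation_ln_max_SINR(1)[OF N p order_refl] by simp
  ultimately show ?thesis
    by simp
qed

text \<open>On the event each beam has a candidate whose interference powers are at most
  \<open>d\<close>; bounding their total by \<open>M * d\<close> cancels the \<open>M\<close> of the
  power share and leaves the denominator \<open>1 + p * d\<close>.\<close>

lemma R_RBF_ge: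
  assumes N: "0 < N" and p: "0 < p" and a: "0 \<le> a" and d: "0 \<le> d"
  shows "real CARD('m) * ln (1 + p / real CARD('m) * a / (1 + p * d)) * prob (all_aligned i N a d)
    \<le> R_RBF \<Omega> H \<Phi> N p"
  unfolding R_RBF_eq_max_SINR
proof (rule expectation_ge_on_event)
  show "integrable \<Omega> (\<lambda>\<omega>. \<Sum>m\<in>UNIV. ln (1 + max_SINR p m N \<omega>))"
    using expectation_ln_max_SINR(1)[OF N p order_refl] by auto
  show "0 \<le> (\<Sum>m\<in>UNIV. ln (1 + max_SINR p m N \<omega>))" for \<omega>
    using max_SINR_nonneg[OF N] p by (intro sum_nonneg ln_ge_zero) auto
  fix \<omega> assume \<omega>: "\<omega> \<in> all_aligned i N a d"
  have "ln (1 + p / real CARD('m) * a / (1 + p * d)) \<le> ln (1 + max_SINR p m N \<omega>)" for m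
  proof -
    obtain n where n: "n < N" "row_at (n, i) \<omega> \<in> aligned m a d"
      using \<omega> by (auto simp: all_aligned_def)
    let ?Y = "\<Sum>j\<in>UNIV - {m}. gain (n, i) j \<omega>"
    have "?Y \<le> (\<Sum>j\<in>UNIV - {m}. d)"
      using n(2) by (intro sum_mono) (auto simp: aligned_def gain_def)
    also have "\<dots> \<le> real CARD('m) * d"
      using d by (simp add: mult_right_mono)
    finally have "p / real CARD('m) * ?Y \<le> p / real CARD('m) * (real CARD('m) * d)"
      using p by (intro mult_left_mono) auto
    then have Y: "1 + p / real CARD('m) * ?Y \<le> 1 + p * d"
      by simp
    have Y0: "0 < 1 + p / real CARD('m) * ?Y"
      using p by (intro add_pos_nonneg mult_nonneg_nonneg sum_nonneg) auto
    have "p / real CARD('m) * a / (1 + p * d) \<le> beam_SINR p m (n, i) \<omega>"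
      unfolding beam_SINR_eq using n(2) p a Y Y0
      by (intro frac_le mult_left_mono mult_nonneg_nonneg) (auto simp: aligned_def gain_def)
    also have "\<dots> \<le> max_SINR p m N \<omega>"
      by (rule max_SINR_ge[OF n(1)])
    finally show ?thesis
      using p a d by (intro ln_mono) (auto intro!: add_pos_nonneg divide_nonneg_nonneg mult_nonneg_nonneg add_nonneg_nonneg)
  qed
  then have "(\<Sum>m\<in>(UNIV :: 'm set). ln (1 + p / real CARD('m) * a / (1 + p * d)))
      \<le> (\<Sum>m\<in>UNIV. ln (1 + max_SINR p m N \<omega>))"
    by (rule sum_mono)
  then show "real CARD('m) * ln (1 + p / real CARD('m) * a / (1 + p * d)) \<le> (\<Sum>m\<in>UNIV. ln (1 + max_SINR p m N \<omega>))"
    by simp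
qed simp

end

subsection \<open>Asymptotics\<close>

text \<open>The strict inequality between \<open>M * ln y0\<close> and \<open>\<kappa>\<close>
  absorbs the error from replacing \<open>y N\<close> by its limit.\<close>

lemma eventually_le_ln_add:
  fixes r A y :: "nat \<Rightarrow> real"
  assumes y: "y \<longlonglongrightarrow> y0" "0 < y0" and M: "0 < M" "M * ln y0 < \<kappa>"
    and A: "eventually (\<lambda>N. 0 < A N) sequentially"
    and r: "eventually (\<lambda>N. r N \<le> M * ln (A N * y N)) sequentially"
  shows "eventually (\<lambda>N. r N \<le> M * ln (A N) + \<kappa>) sequentially"
proof -
  have "(\<lambda>N. M * ln (y N)) \<longlonglongrightarrow> M * ln y0"
    using y by (intro tendsto_intros) auto
  from order_tendstoD(2)[OF this M(2)] order_tendstoD(1)[OF y] A r show ?thesis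
    by eventually_elim (simp add: ln_mult distrib_left)
qed

text \<open>A rate that is at least \<open>M V\<close> except on an event of probability \<open>e\<close> loses at most \<open>M e V\<close>
  in expectation.\<close>

lemma eventually_ge_ln_diff:
  fixes r A y e V :: "nat \<Rightarrow> real"
  assumes y: "y \<longlonglongrightarrow> y0" "0 < y0" and M: "0 < M" "- \<kappa> < M * ln y0"
    and A: "eventually (\<lambda>N. 0 < A N) sequentially"
    and V: "eventually (\<lambda>N. ln (A N * y N) \<le> V N) sequentially"
      "eventually (\<lambda>N. V N \<le> u N) sequentially"
    and eu: "(\<lambda>N. e N * u N) \<longlonglongrightarrow> 0" "eventually (\<lambda>N. 0 \<le> e N) sequentially"
    and r: "eventually (\<lambda>N. M * V N * (1 - e N) \<le> r N) sequentially"
  shows "eventually (\<lambda>N. M * ln (A N) - \<kappa> \<le> r N) sequentially"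
proof -
  have "(\<lambda>N. M * ln (y N) - M * (e N * u N)) \<longlonglongrightarrow> M * ln y0 - M * 0"
    using y eu(1) by (intro tendsto_intros) auto
  then have "eventually (\<lambda>N. - \<kappa> < M * ln (y N) - M * (e N * u N)) sequentially"
    using M(2) by (intro order_tendstoD(1)) auto
  from this order_tendstoD(1)[OF y] A V eu(2) r show ?thesis
  proof eventually_elim
    case (elim N)
    have "M * (ln (A N) + ln (y N)) \<le> M * V N"
      using elim M(1) by (intro mult_left_mono) (auto simp: ln_mult)
    moreover have "M * (e N * V N) \<le> M * (e N * u N)"
      using elim M(1) by (intro mult_left_mono) auto
    ultimately have "M * (ln (A N) + ln (y N)) - M * (e N * u N) \<le> M * V N * (1 - e N)"
      by (simp add: algebra_simps)
    then show ?case
      using elim by (simp add: algebra_simps)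
  qed
qed

text \<open>Makes the probability of a small interference power comparable to its threshold.\<close>

lemma half_le_one_minus_exp:
  fixes x :: real
  assumes "0 \<le> x" "x \<le> 1"
  shows "x / 2 \<le> 1 - exp (- x)"
proof -
  have "x * x \<le> x"
    using assms mult_left_mono[of x 1 x] by simp
  then have "1 \<le> (1 - x / 2) * (1 + x)"
    by (simp add: algebra_simps)
  then have "inverse (1 + x) \<le> 1 - x / 2"
    using assms by (simp add: inverse_eq_divide divide_le_eq)
  moreover have "exp (- x) \<le> inverse (1 + x)"
    using exp_ge_add_one_self[of x] assms by (simp add: exp_minus le_imp_inverse_le)
  ultimately show ?thesis
    by simp
qed

context mimo_broadcast_channel
begin

section \<open>Both rates relative to a reference SNR\<close>

context
  fixes P :: "nat \<Rightarrow> real"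
  assumes P_pos: "\<And>N. 0 < P N"
    and P_ln: "filterlim (\<lambda>N. P N * ln (real N)) at_top sequentially"
begin

text \<open>The SNR obtained with the power share of one beam, without interference, at gain
  \<open>ln N\<close>, the typical size of the largest of \<open>N\<close> standard exponential
  variables.\<close>

definition reference_SNR :: "nat \<Rightarrow> real" where
  "reference_SNR N = P N * ln (real N) / real CARD('m)"

lemma reference_SNR_at_top: "filterlim reference_SNR at_top sequentially"
proof -
  have "filterlim (\<lambda>N. 1 / real CARD('m) * (P N * ln (real N))) at_top sequentially"
    by (rule filterlim_tendsto_pos_mult_at_top[OF tendsto_const _ P_ln]) simp
  then show ?thesis
    by (simp add: reference_SNR_def[abs_def])
qed

lemma eventually_reference_SNR_pos: "eventually (\<lambda>N. 0 < reference_SNR N) sequentially"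
  using reference_SNR_at_top by (simp add: filterlim_at_top_dense)

lemma inverse_reference_SNR: "(\<lambda>N. 1 / reference_SNR N) \<longlonglongrightarrow> 0"
  using tendsto_inverse_0_at_top[OF reference_SNR_at_top] by (simp add: inverse_eq_divide)

lemma eventually_ln_pos: "eventually (\<lambda>N. 0 < ln (real N)) sequentially"
  by real_asymp

lemma R_Opt_upper:
  assumes "0 < \<eta>"
  shows "eventually (\<lambda>N. R_Opt \<Omega> H N (P N) \<le> real CARD('m) * ln (reference_SNR N) + \<eta>) sequentially"
proof -
  let ?M = "real CARD('m)"
  \<comment> \<open>Makes \<open>?M * ln (1 / t)\<close> equal to \<open>\<eta> / 2\<close>, so half
    of \<open>\<eta>\<close> is left for the vanishing terms.\<close>
  define t where "t = exp (- \<eta> / (2 * ?M))"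
  have t: "0 < t" "t < 1"
    using assms by (auto simp: t_def)
  \<comment> \<open>The logarithm of the constant multiplying \<open>N\<close> in the mean of the
    tilted sum; it is negligible against \<open>ln N\<close>.\<close>
  define c where "c = real (CARD('k) * CARD('m)) * (- ln (1 - t))"
  have c: "0 \<le> c"
    using t by (auto simp: c_def intro!: mult_nonneg_nonpos)
  have "(\<lambda>N. c / ln (real N)) \<longlonglongrightarrow> 0"
    by real_asymp
  then have "(\<lambda>N. 1 / reference_SNR N + (1 + c / ln (real N)) / t) \<longlonglongrightarrow> 0 + (1 + 0) / t"
    using t by (intro tendsto_intros inverse_reference_SNR) auto
  then have lim: "(\<lambda>N. 1 / reference_SNR N + (1 + c / ln (real N)) / t) \<longlonglongrightarrow> 1 / t"
    by simp
  show ?thesis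
  proof (rule eventually_le_ln_add[OF lim _ _ _ eventually_reference_SNR_pos])
    show "?M * ln (1 / t) < \<eta>"
      using assms by (simp add: t_def ln_div)
    show "eventually (\<lambda>N. R_Opt \<Omega> H N (P N)
        \<le> ?M * ln (reference_SNR N * (1 / reference_SNR N + (1 + c / ln (real N)) / t))) sequentially"
      using eventually_reference_SNR_pos eventually_ln_pos eventually_gt_at_top[of 0]
    proof eventually_elim
      case (elim N)
      have "ln (real N / (1 - t) ^ (CARD('k) * CARD('m))) = ln (real N) + c"
        using t elim(3) by (simp add: c_def ln_div ln_realpow)
      moreover have "1 + P N / ?M * ((ln (real N) + c) / t)
          = reference_SNR N * (1 / reference_SNR N + (1 + c / ln (real N)) / t)"
        using elim P_pos[of N] by (simp add: reference_SNR_def divide_simps)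
      ultimately show ?case
        using R_Opt_le(2)[OF elim(3) less_imp_le[OF P_pos[of N]] t] by (simp only:)
    qed
  qed (use t in auto)
qed

text \<open>The threshold is \<open>s = c * reference_SNR N\<close>, for which
  \<open>N * exp (- s M / P)\<close> becomes \<open>N powr (1 - c)\<close>. The hypothesis
  \<open>f\<close> says that the total mean excess over this threshold is negligible against the
  reference SNR, so the largest SINR behaves as if bounded by \<open>c\<close> times it.\<close>

lemma R_RBF_upper_scaled:
  assumes c: "0 < c" and \<kappa>: "real CARD('m) * ln c < \<kappa>"
    and f: "(\<lambda>N. real CARD('k) * real N powr (1 - c) / (1 + c * reference_SNR N) ^ (CARD('m) - 1) / ln (real N)) \<longlonglongrightarrow> 0"
  shows "eventually (\<lambda>N. R_RBF \<Omega> H \<Phi> N (P N) \<le> real CARD('m) * ln (reference_SNR N) + \<kappa>) sequentially"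
proof -
  let ?M = "real CARD('m)"
  let ?f = "\<lambda>N. real CARD('k) * real N powr (1 - c) / (1 + c * reference_SNR N) ^ (CARD('m) - 1) / ln (real N)"
  have "(\<lambda>N. 1 / reference_SNR N + c + ?f N) \<longlonglongrightarrow> 0 + c + 0"
    by (intro tendsto_intros inverse_reference_SNR f)
  then have lim: "(\<lambda>N. 1 / reference_SNR N + c + ?f N) \<longlonglongrightarrow> c"
    by simp
  show ?thesis
  proof (rule eventually_le_ln_add[OF lim c _ \<kappa> eventually_reference_SNR_pos])
    show "eventually (\<lambda>N. R_RBF \<Omega> H \<Phi> N (P N)
        \<le> ?M * ln (reference_SNR N * (1 / reference_SNR N + c + ?f N))) sequentially"
      using eventually_reference_SNR_pos eventually_ln_pos eventually_gt_at_top[of 0]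
    proof eventually_elim
      case (elim N)
      let ?s = "c * reference_SNR N"
      have s: "0 \<le> ?s"
        using c elim by simp
      have "- ?s * ?M / P N = - c * ln (real N)"
        using P_pos[of N] by (simp add: reference_SNR_def)
      then have "real N * exp (- ?s * ?M / P N) = real N powr (1 - c)"
        using elim by (simp add: powr_def left_diff_distrib exp_diff exp_minus divide_inverse)
      then have "1 + (?s + real N * real CARD('k) * (P N / ?M * exp (- ?s * ?M / P N) / (1 + ?s) ^ (CARD('m) - 1)))
          = 1 + ?s + real CARD('k) * (P N / ?M) * real N powr (1 - c) / (1 + ?s) ^ (CARD('m) - 1)"
        by (simp add: mult_ac)
      moreover have "P N / ?M = reference_SNR N / ln (real N)"
        using elim by (simp add: reference_SNR_def)
      moreover have "1 + ?s + real CARD('k) * (reference_SNR N / ln (real N)) * real N powr (1 - c) / (1 + ?s) ^ (CARD('m) - 1)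
          = reference_SNR N * (1 / reference_SNR N + c + ?f N)"
        using elim by (simp add: distrib_left mult_ac)
      ultimately have "1 + (?s + real N * real CARD('k) * (P N / ?M * exp (- ?s * ?M / P N) / (1 + ?s) ^ (CARD('m) - 1)))
          = reference_SNR N * (1 / reference_SNR N + c + ?f N)"
        by (simp only:)
      with R_RBF_le[OF elim(3) P_pos[of N] s] show ?case
        by (simp only:)
    qed
  qed simp
qed

lemma R_RBF_upper:
  assumes "0 < \<eta>"
  shows "eventually (\<lambda>N. R_RBF \<Omega> H \<Phi> N (P N) \<le> real CARD('m) * ln (reference_SNR N) + \<eta>) sequentially"
proof (rule R_RBF_upper_scaled[of 1])
  show "(\<lambda>N. real CARD('k) * real N powr (1 - 1) / (1 + 1 * reference_SNR N) ^ (CARD('m) - 1) / ln (real N)) \<longlonglongrightarrow> 0"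
  proof (rule tendsto_sandwich[OF _ _ tendsto_const])
    show "(\<lambda>N. real CARD('k) / ln (real N)) \<longlonglongrightarrow> 0"
      by real_asymp
    show "eventually (\<lambda>N. real CARD('k) * real N powr (1 - 1) / (1 + 1 * reference_SNR N) ^ (CARD('m) - 1) / ln (real N)
        \<le> real CARD('k) / ln (real N)) sequentially"
      using eventually_reference_SNR_pos eventually_ln_pos
    proof eventually_elim
      case (elim N)
      have "1 \<le> (1 + reference_SNR N) ^ (CARD('m) - 1)"
        using elim by simp
      then have "real CARD('k) * real N powr (1 - 1) / (1 + reference_SNR N) ^ (CARD('m) - 1) \<le> real CARD('k) / 1"
        by (intro frac_le) auto
      then show ?case
        using elim by (intro divide_right_mono) auto
    qed
    show "eventually (\<lambda>N. 0 \<le> real CARD('k) * real N powr (1 - 1) / (1 + 1 * reference_SNR N) ^ (CARD('m) - 1) / ln (real N)) sequentially"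
      using eventually_reference_SNR_pos eventually_ln_pos by eventually_elim simp
  qed
qed (use assms in auto)

text \<open>A threshold constant below 1 lets \<open>N powr (1 - c)\<close> grow, but for
  \<open>1 - c \<le> l\<close> it stays below \<open>P\<close>. Since \<open>M - 1\<close> is at
  least 1, one factor \<open>1 + c * reference_SNR N\<close>, of order \<open>P ln N\<close>,
  compensates it.\<close>

lemma R_RBF_upper_polynomial:
  assumes M: "2 \<le> CARD('m)" and l: "0 < l"
    and P_ge: "eventually (\<lambda>N. real N powr l \<le> P N) sequentially"
  shows "\<exists>\<kappa>>0. eventually (\<lambda>N. R_RBF \<Omega> H \<Phi> N (P N) \<le> real CARD('m) * ln (reference_SNR N) - \<kappa>) sequentially"
proof -
  let ?M = "real CARD('m)"
  \<comment> \<open>The minimum with \<open>1 / 2\<close> keeps \<open>c\<close> positive when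
    \<open>l\<close> is large.\<close>
  define c where "c = 1 - min l (1 / 2)"
  have c: "0 < c" "c < 1" "1 - c \<le> l"
    using l by (auto simp: c_def)
  \<comment> \<open>Half of the available gap \<open>- ?M * ln c\<close>, leaving strict room for
    the limit.\<close>
  define \<kappa> where "\<kappa> = - (?M * ln c) / 2"
  have "?M * ln c < 0"
    using c by (intro mult_pos_neg) auto
  then have \<kappa>: "0 < \<kappa>" "?M * ln c < - \<kappa>"
    unfolding \<kappa>_def by linarith+
  have "eventually (\<lambda>N. R_RBF \<Omega> H \<Phi> N (P N) \<le> ?M * ln (reference_SNR N) + - \<kappa>) sequentially"
  proof (rule R_RBF_upper_scaled[OF c(1) \<kappa>(2)])
    show "(\<lambda>N. real CARD('k) * real N powr (1 - c) / (1 + c * reference_SNR N) ^ (CARD('m) - 1) / ln (real N)) \<longlonglongrightarrow> 0"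
    proof (rule tendsto_sandwich[OF _ _ tendsto_const])
      show "(\<lambda>N. real CARD('k) * (?M / c) / ln (real N) / ln (real N)) \<longlonglongrightarrow> 0"
        by real_asymp
      show "eventually (\<lambda>N. real CARD('k) * real N powr (1 - c) / (1 + c * reference_SNR N) ^ (CARD('m) - 1) / ln (real N)
          \<le> real CARD('k) * (?M / c) / ln (real N) / ln (real N)) sequentially"
        using eventually_reference_SNR_pos eventually_ln_pos P_ge eventually_gt_at_top[of 0]
      proof eventually_elim
        case (elim N)
        let ?D = "(1 + c * reference_SNR N) ^ (CARD('m) - 1)"
        have N: "1 \<le> real N"
          using elim(4) by simp
        have "real N powr (1 - c) \<le> P N"
          using powr_mono[OF c(3) N] elim(3) by simp
        then have "real N powr (1 - c) * (c * ln (real N) / ?M) \<le> P N * (c * ln (real N) / ?M)"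
          using c elim by (intro mult_right_mono) auto
        also have "\<dots> = c * reference_SNR N"
          by (simp add: reference_SNR_def)
        also have "\<dots> \<le> (1 + c * reference_SNR N) ^ 1"
          by simp
        also have "\<dots> \<le> ?D"
          using M c elim by (intro power_increasing) auto
        finally have "real N powr (1 - c) * (c * ln (real N) / ?M) \<le> ?D" .
        moreover have "0 < ?D"
          using c elim by (intro zero_less_power add_pos_nonneg) auto
        ultimately have "real N powr (1 - c) / ?D \<le> ?M / c / ln (real N)"
          using c elim by (simp add: field_simps)
        then have "real CARD('k) * (real N powr (1 - c) / ?D) / ln (real N)
            \<le> real CARD('k) * (?M / c / ln (real N)) / ln (real N)"
          using elim by (intro divide_right_mono mult_left_mono) auto
        then show ?case
          by simp
      qed
      show "eventually (\<lambda>N. 0 \<le> real CARD('k) * real N powr (1 - c) / (1 + c * reference_SNR N) ^ (CARD('m) - 1) / ln (real N)) sequentially"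
        using eventually_reference_SNR_pos eventually_ln_pos
        by eventually_elim (use c in \<open>simp add: add_nonneg_nonneg\<close>)
    qed
  qed
  then show ?thesis
    using \<kappa>(1) by auto
qed

text \<open>Bounds the rate that can be lost on an exceptional event by a multiple of
  \<open>ln N\<close>. The additional power of \<open>N\<close> covers the factor
  \<open>ln N\<close>, and the absolute value makes the exponent nonnegative.\<close>

lemma ln_reference_SNR_le:
  assumes P: "P N \<le> real N powr B" and N: "1 \<le> N"
  shows "ln (1 + reference_SNR N) \<le> ln 2 + (\<bar>B\<bar> + 1) * ln (real N)"
proof -
  have N': "1 \<le> real N"
    using N by simp
  have "ln (real N) \<le> real N"
    using ln_le_minus_one[of "real N"] N' by linarith
  then have "P N * ln (real N) \<le> real N powr \<bar>B\<bar> * real N powr 1"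
    using P P_pos[of N] N' powr_mono[OF abs_ge_self[of B] N'] by (intro mult_mono) auto
  moreover have "reference_SNR N \<le> P N * ln (real N) / 1"
    unfolding reference_SNR_def using P_pos[of N] N' by (intro divide_left_mono) auto
  ultimately have "reference_SNR N \<le> real N powr (\<bar>B\<bar> + 1)"
    by (simp add: powr_add)
  moreover have "1 \<le> real N powr (\<bar>B\<bar> + 1)"
    using N' by (simp add: ge_one_powr_ge_zero)
  moreover have "0 \<le> reference_SNR N"
    using P_pos[of N] N' by (simp add: reference_SNR_def)
  ultimately have "ln (1 + reference_SNR N) \<le> ln (2 * real N powr (\<bar>B\<bar> + 1))"
    by (intro ln_mono) auto
  then show ?thesis
    using N' by (simp add: ln_mult ln_powr)
qed

lemma exp_decay_ln:
  fixes q \<epsilon> b :: real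
  assumes "0 < q" "0 < \<epsilon>"
  shows "(\<lambda>N. real CARD('m) * exp (- q * real N powr \<epsilon>) * (ln 2 + b * ln (real N))) \<longlonglongrightarrow> 0"
  using assms by real_asymp

text \<open>At gain level \<open>(1 - \<epsilon>) * ln N\<close> the expected number of aligned
  candidates per beam is \<open>q * N powr \<epsilon>\<close>, as the interference threshold 1 costs
  only the constant factor \<open>q\<close>. No growth bound on \<open>P\<close> enters, so the
  estimate serves polynomial and superpolynomial powers alike.\<close>

lemma R_Opt_lower_event:
  assumes \<epsilon>: "0 < \<epsilon>" "\<epsilon> < 1"
  shows "\<exists>q>0. eventually (\<lambda>N. real CARD('m) *
      ln (1 + P N / real CARD('m) * (sqrt ((1 - \<epsilon>) * ln (real N)) - (real CARD('m))\<^sup>2)\<^sup>2) *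
      (1 - real CARD('m) * exp (- q * real N powr \<epsilon>)) \<le> R_Opt \<Omega> H N (P N)) sequentially"
proof -
  let ?M = "real CARD('m)"
  define q where "q = (1 - exp (- 1 :: real)) ^ (CARD('m) - 1)"
  have q: "0 < q"
    by (simp add: q_def)
  have "filterlim (\<lambda>N. (1 - \<epsilon>) * ln (real N)) at_top sequentially"
    using \<epsilon> by real_asymp
  then have "eventually (\<lambda>N. ?M ^ 4 \<le> (1 - \<epsilon>) * ln (real N)) sequentially"
    by (simp add: filterlim_at_top)
  from this eventually_gt_at_top[of 0]
  have "eventually (\<lambda>N. ?M * ln (1 + P N / ?M * (sqrt ((1 - \<epsilon>) * ln (real N)) - ?M\<^sup>2)\<^sup>2) *
      (1 - ?M * exp (- q * real N powr \<epsilon>)) \<le> R_Opt \<Omega> H N (P N)) sequentially"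
  proof eventually_elim
    case (elim N)
    let ?a = "(1 - \<epsilon>) * ln (real N)"
    have a: "0 \<le> ?a"
      using elim \<epsilon> by simp
    have "real N * exp (- ?a) = real N powr \<epsilon>"
      using elim by (simp add: powr_def left_diff_distrib exp_diff exp_minus exp_add divide_inverse)
    then have "- real N * (exp (- ?a) * (1 - exp (- 1)) ^ (CARD('m) - 1)) = - q * real N powr \<epsilon>"
      by (simp add: q_def mult_ac)
    then have prob: "1 - ?M * exp (- q * real N powr \<epsilon>) \<le> prob (all_aligned undefined N ?a 1)"
      using prob_all_aligned_ge[OF elim(2) a, of 1 undefined] by simp
    have "0 \<le> ?M * ln (1 + P N / ?M * (sqrt ?a - ?M\<^sup>2)\<^sup>2)"
      using P_pos[of N] by simp
    from order_trans[OF mult_left_mono[OF prob this] R_Opt_ge[OF elim(2) less_imp_le[OF P_pos] elim(1)]]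
    show ?case .
  qed
  with q show ?thesis
    by blast
qed

lemma R_Opt_lower:
  assumes \<eta>: "0 < \<eta>" and P_le: "eventually (\<lambda>N. P N \<le> real N powr B) sequentially"
  shows "eventually (\<lambda>N. real CARD('m) * ln (reference_SNR N) - \<eta> \<le> R_Opt \<Omega> H N (P N)) sequentially"
proof -
  let ?M = "real CARD('m)"
  \<comment> \<open>Makes \<open>?M * ln (1 - \<epsilon>)\<close> equal to
    \<open>- \<eta> / 2\<close>.\<close>
  define \<epsilon> where "\<epsilon> = 1 - exp (- \<eta> / (2 * ?M))"
  have \<epsilon>: "0 < \<epsilon>" "\<epsilon> < 1"
    using \<eta> by (auto simp: \<epsilon>_def)
  obtain q where q: "0 < q" and lower: "eventually (\<lambda>N. ?M *
      ln (1 + P N / ?M * (sqrt ((1 - \<epsilon>) * ln (real N)) - ?M\<^sup>2)\<^sup>2) *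
      (1 - ?M * exp (- q * real N powr \<epsilon>)) \<le> R_Opt \<Omega> H N (P N)) sequentially"
    using R_Opt_lower_event[OF \<epsilon>] by blast
  \<comment> \<open>The loss \<open>?M\<^sup>2\<close> from diagonal dominance is constant, while
    the amplitude grows like \<open>sqrt (ln N)\<close>, so only the factor
    \<open>1 - \<epsilon>\<close> survives.\<close>
  have lim: "(\<lambda>N. (sqrt ((1 - \<epsilon>) * ln (real N)) - ?M\<^sup>2)\<^sup>2 / ln (real N)) \<longlonglongrightarrow> 1 - \<epsilon>"
  proof -
    have "(\<lambda>N. (sqrt (1 - \<epsilon>) - ?M\<^sup>2 / sqrt (ln (real N)))\<^sup>2) \<longlonglongrightarrow> (sqrt (1 - \<epsilon>) - 0)\<^sup>2"
    proof (intro tendsto_intros)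
      show "(\<lambda>N. ?M\<^sup>2 / sqrt (ln (real N))) \<longlonglongrightarrow> 0"
        by real_asymp
    qed
    moreover have "eventually (\<lambda>N. (sqrt (1 - \<epsilon>) - ?M\<^sup>2 / sqrt (ln (real N)))\<^sup>2
        = (sqrt ((1 - \<epsilon>) * ln (real N)) - ?M\<^sup>2)\<^sup>2 / ln (real N)) sequentially"
      using eventually_ln_pos
    proof eventually_elim
      case (elim N)
      have "sqrt (1 - \<epsilon>) - ?M\<^sup>2 / sqrt (ln (real N)) = (sqrt ((1 - \<epsilon>) * ln (real N)) - ?M\<^sup>2) / sqrt (ln (real N))"
        using elim by (simp add: diff_divide_distrib real_sqrt_mult)
      then show ?case
        using elim by (simp add: power_divide)
    qed
    ultimately show ?thesis
      using \<epsilon> by (simp add: tendsto_cong)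
  qed
  have pos: "0 < 1 - \<epsilon>"
    using \<epsilon> by simp
  have large: "eventually (\<lambda>N. ?M ^ 4 \<le> (1 - \<epsilon>) * ln (real N)) sequentially"
  proof -
    have "filterlim (\<lambda>N. (1 - \<epsilon>) * ln (real N)) at_top sequentially"
      using \<epsilon> by real_asymp
    then show ?thesis
      by (simp add: filterlim_at_top)
  qed
  show ?thesis
  proof (rule eventually_ge_ln_diff[OF lim _ _ _ eventually_reference_SNR_pos _ _ exp_decay_ln[OF q \<epsilon>(1), of "\<bar>B\<bar> + 1"] _ lower])
    show "- \<eta> < ?M * ln (1 - \<epsilon>)"
      using \<eta> by (simp add: \<epsilon>_def)
    show "eventually (\<lambda>N. ln (reference_SNR N * ((sqrt ((1 - \<epsilon>) * ln (real N)) - ?M\<^sup>2)\<^sup>2 / ln (real N)))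
        \<le> ln (1 + P N / ?M * (sqrt ((1 - \<epsilon>) * ln (real N)) - ?M\<^sup>2)\<^sup>2)) sequentially"
      using eventually_reference_SNR_pos eventually_ln_pos order_tendstoD(1)[OF lim pos]
    proof eventually_elim
      case (elim N)
      then show ?case
        using \<epsilon> by (intro ln_mono mult_pos_pos) (simp_all add: reference_SNR_def)
    qed
    show "eventually (\<lambda>N. ln (1 + P N / ?M * (sqrt ((1 - \<epsilon>) * ln (real N)) - ?M\<^sup>2)\<^sup>2)
        \<le> ln 2 + (\<bar>B\<bar> + 1) * ln (real N)) sequentially"
      using large eventually_ln_pos P_le eventually_ge_at_top[of 1]
    proof eventually_elim
      case (elim N)
      have "?M\<^sup>2 \<le> sqrt ((1 - \<epsilon>) * ln (real N))"
        using elim(1) by (intro real_le_rsqrt) (simp flip: power_mult)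
      then have "(sqrt ((1 - \<epsilon>) * ln (real N)) - ?M\<^sup>2)\<^sup>2 \<le> (sqrt ((1 - \<epsilon>) * ln (real N)))\<^sup>2"
        by (intro power_mono) auto
      also have "\<dots> \<le> ln (real N)"
        using \<epsilon> elim(2) by (simp add: mult_left_le_one_le)
      finally have "P N / ?M * (sqrt ((1 - \<epsilon>) * ln (real N)) - ?M\<^sup>2)\<^sup>2 \<le> P N / ?M * ln (real N)"
        using P_pos[of N] by (intro mult_left_mono) auto
      then have "ln (1 + P N / ?M * (sqrt ((1 - \<epsilon>) * ln (real N)) - ?M\<^sup>2)\<^sup>2) \<le> ln (1 + reference_SNR N)"
        using P_pos[of N] by (intro ln_mono) (auto simp: reference_SNR_def intro!: add_pos_nonneg)
      then show ?case
        using ln_reference_SNR_le[OF elim(3,4)] by simp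
    qed
  qed (use \<epsilon> in auto)
qed

text \<open>Two losses are balanced: the signal level drops by the factor
  \<open>1 - \<epsilon>\<close>, which leaves \<open>N powr \<epsilon>\<close> strong candidates,
  and interference scaled down to order \<open>1 / P\<close> costs at most the factor
  \<open>N powr (- \<epsilon> / 2)\<close> up to a constant. About
  \<open>N powr (\<epsilon> / 2)\<close> candidates remain, enough for every beam.\<close>

lemma R_RBF_lower:
  assumes \<eta>: "0 < \<eta>" and P_le: "\<And>\<delta>. 0 < \<delta> \<Longrightarrow> eventually (\<lambda>N. P N \<le> real N powr \<delta>) sequentially"
  shows "eventually (\<lambda>N. real CARD('m) * ln (reference_SNR N) - \<eta> \<le> R_RBF \<Omega> H \<Phi> N (P N)) sequentially"
proof -
  let ?M = "real CARD('m)"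
  define \<theta> where "\<theta> = exp (- \<eta> / (2 * ?M))"
  have \<theta>: "0 < \<theta>" "\<theta> < 1"
    using \<eta> by (auto simp: \<theta>_def)
  \<comment> \<open>Solves \<open>(1 - \<epsilon>) / (1 + \<epsilon>) = \<theta>\<close>: the
    numerator is the signal loss, the denominator the residual interference.\<close>
  define \<epsilon> where "\<epsilon> = (1 - \<theta>) / (1 + \<theta>)"
  have \<epsilon>: "0 < \<epsilon>" "\<epsilon> < 1" "(1 - \<epsilon>) / (1 + \<epsilon>) = \<theta>"
    using \<theta> by (auto simp: \<epsilon>_def field_simps)
  \<comment> \<open>Chosen so that \<open>M\<close> interference constraints, each costing
    \<open>N powr - \<delta>\<close>, cost at most \<open>N powr (- \<epsilon> / 2)\<close>
    together.\<close>
  define \<delta> where "\<delta> = \<epsilon> / (2 * ?M)"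
  have \<delta>: "0 < \<delta>"
    using \<epsilon> by (simp add: \<delta>_def)
  \<comment> \<open>One factor \<open>1 / 2\<close> is lost in \<open>half_le_one_minus_exp\<close>,
    the other in \<open>1 + P N \<le> 2 * N powr \<delta>\<close>.\<close>
  define q where "q = (\<epsilon> / 4) ^ (CARD('m) - 1)"
  have q: "0 < q"
    using \<epsilon> by (simp add: q_def)
  have lim: "(\<lambda>N. \<theta>) \<longlonglongrightarrow> \<theta>"
    by simp
  have \<epsilon>2: "0 < \<epsilon> / 2"
    using \<epsilon> by simp
  show ?thesis
  proof (rule eventually_ge_ln_diff[where V = "\<lambda>N. ln (1 + reference_SNR N * \<theta>)",
        OF lim \<theta>(1) _ _ eventually_reference_SNR_pos _ _ exp_decay_ln[OF q \<epsilon>2, of "\<bar>\<delta>\<bar> + 1"]])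
    show "- \<eta> < ?M * ln \<theta>"
      using \<eta> by (simp add: \<theta>_def)
    show "eventually (\<lambda>N. ln (reference_SNR N * \<theta>) \<le> ln (1 + reference_SNR N * \<theta>)) sequentially"
      using eventually_reference_SNR_pos by eventually_elim (use \<theta> in \<open>auto intro!: ln_mono\<close>)
    show "eventually (\<lambda>N. ln (1 + reference_SNR N * \<theta>) \<le> ln 2 + (\<bar>\<delta>\<bar> + 1) * ln (real N)) sequentially"
      using eventually_reference_SNR_pos P_le[OF \<delta>] eventually_ge_at_top[of 1]
    proof eventually_elim
      case (elim N)
      have "ln (1 + reference_SNR N * \<theta>) \<le> ln (1 + reference_SNR N)"
        using elim \<theta> by (intro ln_mono) (auto intro!: add_pos_nonneg mult_right_le_one_le)
      then show ?case
        using ln_reference_SNR_le[OF elim(2,3)] by simp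
    qed
    show "eventually (\<lambda>N. ?M * ln (1 + reference_SNR N * \<theta>) * (1 - ?M * exp (- q * real N powr (\<epsilon> / 2)))
        \<le> R_RBF \<Omega> H \<Phi> N (P N)) sequentially"
      using eventually_reference_SNR_pos eventually_ln_pos P_le[OF \<delta>] eventually_gt_at_top[of 0]
    proof eventually_elim
      case (elim N)
      let ?a = "(1 - \<epsilon>) * ln (real N)"
      \<comment> \<open>The summand 1 in the denominator keeps \<open>?d\<close> at most
        \<open>\<epsilon>\<close> even if \<open>P\<close> tends to 0, while \<open>P N * ?d\<close>
        is at most \<open>\<epsilon>\<close> in any case.\<close>
      let ?d = "\<epsilon> / (1 + P N)"
      have N: "1 \<le> real N"
        using elim(4) by simp
      have a: "0 \<le> ?a"
        using elim \<epsilon> by simp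
      have d: "0 < ?d" "?d \<le> \<epsilon>" "P N * ?d \<le> \<epsilon>"
        using \<epsilon> P_pos[of N] by (auto simp: field_simps)
      have "?d / 2 \<le> 1 - exp (- ?d)"
        using d \<epsilon> by (intro half_le_one_minus_exp) auto
      moreover have "\<epsilon> / 4 * real N powr - \<delta> \<le> ?d / 2"
      proof -
        have "1 \<le> real N powr \<delta>"
          using N \<delta> by (simp add: ge_one_powr_ge_zero)
        then have "1 + P N \<le> 2 * real N powr \<delta>"
          using elim(3) by simp
        then have "\<epsilon> / (2 * real N powr \<delta>) \<le> ?d"
          using \<epsilon> P_pos[of N] N by (intro divide_left_mono) (auto intro!: mult_pos_pos add_pos_pos)
        then have "\<epsilon> / (2 * real N powr \<delta>) / 2 \<le> ?d / 2"
          by (rule divide_right_mono) simp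
        moreover have "\<epsilon> / 4 * real N powr - \<delta> = \<epsilon> / (2 * real N powr \<delta>) / 2"
          by (simp add: powr_minus_divide)
        ultimately show ?thesis
          by (simp only:)
      qed
      ultimately have "\<epsilon> / 4 * real N powr - \<delta> \<le> 1 - exp (- ?d)"
        by (rule order_trans[rotated])
      then have "(\<epsilon> / 4 * real N powr - \<delta>) ^ (CARD('m) - 1) \<le> (1 - exp (- ?d)) ^ (CARD('m) - 1)"
        using \<epsilon> by (intro power_mono) auto
      moreover have "real N powr (- \<epsilon> / 2) \<le> (real N powr - \<delta>) ^ (CARD('m) - 1)"
      proof -
        have "(real N powr - \<delta>) ^ (CARD('m) - 1) = real N powr (- \<delta> * real (CARD('m) - 1))"
          using N by (simp add: powr_power mult.commute)
        moreover have "\<delta> * real (CARD('m) - 1) \<le> \<delta> * ?M"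
          using \<delta> by (intro mult_left_mono) auto
        moreover have "\<delta> * ?M = \<epsilon> / 2"
          by (simp add: \<delta>_def)
        ultimately show ?thesis
          using powr_mono[OF _ N, of "- \<epsilon> / 2" "- \<delta> * real (CARD('m) - 1)"] by simp
      qed
      then have "q * real N powr (- \<epsilon> / 2) \<le> q * (real N powr - \<delta>) ^ (CARD('m) - 1)"
        using q by (intro mult_left_mono) auto
      moreover have "q * (real N powr - \<delta>) ^ (CARD('m) - 1) = (\<epsilon> / 4 * real N powr - \<delta>) ^ (CARD('m) - 1)"
        by (simp only: q_def power_mult_distrib)
      ultimately have "q * real N powr (- \<epsilon> / 2) \<le> (1 - exp (- ?d)) ^ (CARD('m) - 1)"
        by linarith
      then have "real N powr \<epsilon> * (q * real N powr (- \<epsilon> / 2)) \<le> real N powr \<epsilon> * (1 - exp (- ?d)) ^ (CARD('m) - 1)"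
        by (intro mult_left_mono) auto
      moreover have "real N powr \<epsilon> * (q * real N powr (- \<epsilon> / 2)) = q * real N powr (\<epsilon> / 2)"
      proof -
        have "real N powr \<epsilon> * real N powr (- \<epsilon> / 2) = real N powr (\<epsilon> / 2)"
          by (simp flip: powr_add)
        then show ?thesis
          by (simp only: mult.left_commute)
      qed
      moreover have "real N * exp (- ?a) = real N powr \<epsilon>"
        using elim by (simp add: powr_def left_diff_distrib exp_diff exp_minus exp_add divide_inverse)
      ultimately have "q * real N powr (\<epsilon> / 2) \<le> real N * (exp (- ?a) * (1 - exp (- ?d)) ^ (CARD('m) - 1))"
        by (simp only: mult.assoc[symmetric])
      then have "1 - ?M * exp (- q * real N powr (\<epsilon> / 2))
          \<le> 1 - ?M * exp (- real N * (exp (- ?a) * (1 - exp (- ?d)) ^ (CARD('m) - 1)))"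
        by simp
      also have "\<dots> \<le> prob (all_aligned undefined N ?a ?d)"
        by (rule prob_all_aligned_ge[OF elim(4) a less_imp_le[OF d(1)]])
      finally have prob: "1 - ?M * exp (- q * real N powr (\<epsilon> / 2)) \<le> prob (all_aligned undefined N ?a ?d)" .
      have "reference_SNR N * \<theta> = P N / ?M * ?a / (1 + \<epsilon>)"
        unfolding \<epsilon>(3)[symmetric] by (simp add: reference_SNR_def)
      also have "\<dots> \<le> P N / ?M * ?a / (1 + P N * ?d)"
        using elim(2) d P_pos[of N] \<epsilon> by (intro divide_left_mono mult_nonneg_nonneg) (auto intro!: mult_pos_pos add_pos_nonneg)
      finally have "ln (1 + reference_SNR N * \<theta>) \<le> ln (1 + P N / ?M * ?a / (1 + P N * ?d))"
        using elim(1) \<theta> by (intro ln_mono) (auto intro!: add_pos_nonneg)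
      then have "?M * ln (1 + reference_SNR N * \<theta>) * prob (all_aligned undefined N ?a ?d)
          \<le> ?M * ln (1 + P N / ?M * ?a / (1 + P N * ?d)) * prob (all_aligned undefined N ?a ?d)"
        by (intro mult_right_mono mult_left_mono) auto
      also have "\<dots> \<le> R_RBF \<Omega> H \<Phi> N (P N)"
        by (rule R_RBF_ge[OF elim(4) P_pos a less_imp_le[OF d(1)]])
      finally have "?M * ln (1 + reference_SNR N * \<theta>) * prob (all_aligned undefined N ?a ?d) \<le> R_RBF \<Omega> H \<Phi> N (P N)" .
      moreover have "0 \<le> ?M * ln (1 + reference_SNR N * \<theta>)"
        using elim(1) \<theta> by simp
      ultimately show ?case
        using mult_left_mono[OF prob, of "?M * ln (1 + reference_SNR N * \<theta>)"] by linarith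
    qed
  qed auto
qed

section \<open>The gap between the rates in the three growth regimes of the power\<close>

lemma difference_tendsto_0:
  assumes P_le: "\<And>\<delta>. 0 < \<delta> \<Longrightarrow> eventually (\<lambda>N. P N \<le> real N powr \<delta>) sequentially"
  shows "(\<lambda>N. R_Opt \<Omega> H N (P N) - R_RBF \<Omega> H \<Phi> N (P N)) \<longlonglongrightarrow> 0"
proof (rule tendstoI)
  fix e :: real
  assume "0 < e"
  then have e: "0 < e / 3"
    by simp
  have "eventually (\<lambda>N. real CARD('m) * ln (reference_SNR N) - e / 3 \<le> R_RBF \<Omega> H \<Phi> N (P N)) sequentially"
    by (rule R_RBF_lower[OF e P_le])
  with R_Opt_upper[OF e] R_RBF_upper[OF e] R_Opt_lower[OF e P_le[OF zero_less_one]]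
  show "eventually (\<lambda>N. dist (R_Opt \<Omega> H N (P N) - R_RBF \<Omega> H \<Phi> N (P N)) 0 < e) sequentially"
    by eventually_elim (use e in \<open>simp add: abs_less_iff\<close>)
qed

lemma difference_ge_polynomial:
  assumes "2 \<le> CARD('m)" "0 < l" "eventually (\<lambda>N. real N powr l \<le> P N) sequentially"
    and P_le: "eventually (\<lambda>N. P N \<le> real N powr B) sequentially"
  shows "\<exists>\<kappa>>0. eventually (\<lambda>N. \<kappa> \<le> R_Opt \<Omega> H N (P N) - R_RBF \<Omega> H \<Phi> N (P N)) sequentially"
proof -
  obtain \<kappa> where \<kappa>: "0 < \<kappa>"
      "eventually (\<lambda>N. R_RBF \<Omega> H \<Phi> N (P N) \<le> real CARD('m) * ln (reference_SNR N) - \<kappa>) sequentially"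
    using R_RBF_upper_polynomial[OF assms(1-3)] by blast
  have half: "0 < \<kappa> / 2"
    using \<kappa>(1) by simp
  from \<kappa>(2) R_Opt_lower[OF half P_le]
  have "eventually (\<lambda>N. \<kappa> / 2 \<le> R_Opt \<Omega> H N (P N) - R_RBF \<Omega> H \<Phi> N (P N)) sequentially"
    by eventually_elim simp
  with half show ?thesis
    by blast
qed

text \<open>If \<open>P\<close> grows faster than every power of \<open>N\<close>, then the rate lost on the exceptional event of
  \<open>R_Opt_lower_event\<close> is not controlled, but half of the optimal rate already exceeds the
  bound on the beam-forming rate that is uniform in \<open>P\<close>.\<close>

lemma difference_ge_superpolynomial:
  assumes M: "2 \<le> CARD('m)" and P_ge: "eventually (\<lambda>N. real N powr 6 \<le> P N) sequentially"
  shows "eventually (\<lambda>N. 1 \<le> R_Opt \<Omega> H N (P N) - R_RBF \<Omega> H \<Phi> N (P N)) sequentially"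
proof -
  define M where "M = real CARD('m)"
  define C where "C = real CARD('k) * (2 * Gamma (1 / 2 :: real))"
  have M_pos: "0 < M" and C_pos: "0 < C"
    by (simp_all add: M_def C_def Gamma_real_pos)
  obtain q where q: "0 < q" and lower: "eventually (\<lambda>N. M *
      ln (1 + P N / M * (sqrt ((1 - 1 / 2) * ln (real N)) - M\<^sup>2)\<^sup>2) *
      (1 - M * exp (- q * real N powr (1 / 2))) \<le> R_Opt \<Omega> H N (P N)) sequentially"
    using R_Opt_lower_event[of "1 / 2"] unfolding M_def by auto
  have "filterlim (\<lambda>N. sqrt ((1 - 1 / 2) * ln (real N)) - M\<^sup>2) at_top sequentially"
    by real_asymp
  then have large: "eventually (\<lambda>N. 1 \<le> sqrt ((1 - 1 / 2) * ln (real N)) - M\<^sup>2) sequentially"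
    by (simp add: filterlim_at_top)
  have "(\<lambda>N. 1 - M * exp (- q * real N powr (1 / 2))) \<longlonglongrightarrow> 1"
    using q by real_asymp
  then have prob: "eventually (\<lambda>N. 1 / 2 < 1 - M * exp (- q * real N powr (1 / 2))) sequentially"
    by (rule order_tendstoD) simp
  \<comment> \<open>The exponent 6 is taken large enough: half of the optimal rate has leading term
    \<open>3 * M * ln N\<close>, against \<open>2 * M * ln N\<close> for beam-forming.\<close>
  have "filterlim (\<lambda>N. M * (6 * ln (real N) - ln M) / 2 - 2 * M * ln (1 + real N * C)) at_top sequentially"
    using M_pos C_pos by real_asymp
  then have gap: "eventually (\<lambda>N. 1 \<le> M * (6 * ln (real N) - ln M) / 2 - 2 * M * ln (1 + real N * C)) sequentially"
    by (simp add: filterlim_at_top)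
  from lower large prob gap P_ge eventually_gt_at_top[of 0] show ?thesis
  proof eventually_elim
    case (elim N)
    let ?V = "ln (1 + P N / M * (sqrt ((1 - 1 / 2) * ln (real N)) - M\<^sup>2)\<^sup>2)"
    have "1 \<le> (sqrt ((1 - 1 / 2) * ln (real N)) - M\<^sup>2)\<^sup>2"
      using elim(2) by (rule one_le_power)
    then have "P N / M * 1 \<le> P N / M * (sqrt ((1 - 1 / 2) * ln (real N)) - M\<^sup>2)\<^sup>2"
      using P_pos[of N] M_pos by (intro mult_left_mono) auto
    moreover have "real N powr 6 / M \<le> P N / M"
      using elim(5) M_pos by (intro divide_right_mono) auto
    ultimately have "real N powr 6 / M \<le> 1 + P N / M * (sqrt ((1 - 1 / 2) * ln (real N)) - M\<^sup>2)\<^sup>2"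
      by simp
    then have "ln (real N powr 6 / M) \<le> ?V"
      using elim(6) M_pos by (intro ln_mono) auto
    then have V: "6 * ln (real N) - ln M \<le> ?V"
      using elim(6) M_pos by (simp add: ln_div ln_powr ln_realpow)
    have V0: "0 \<le> ?V"
      using P_pos[of N] M_pos by simp
    have "M * (6 * ln (real N) - ln M) / 2 \<le> M * ?V * (1 / 2)"
      using V M_pos by simp
    also have "\<dots> \<le> M * ?V * (1 - M * exp (- q * real N powr (1 / 2)))"
      using elim(3) V0 M_pos by (intro mult_left_mono) auto
    also have "\<dots> \<le> R_Opt \<Omega> H N (P N)"
      by (rule elim(1))
    finally have "M * (6 * ln (real N) - ln M) / 2 \<le> R_Opt \<Omega> H N (P N)" .
    moreover have "R_RBF \<Omega> H \<Phi> N (P N) \<le> 2 * M * ln (1 + real N * C)"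
      using R_RBF_le_uniform[OF M elim(6) P_pos[of N]] by (simp add: M_def C_def mult.assoc)
    ultimately show ?case
      using elim(4) by linarith
  qed
qed

text \<open>The limit \<open>L\<close> gives subpolynomial, polynomial or superpolynomial growth
  according to whether it is 0, positive and finite, or infinite. In the last two regimes the gap is
  eventually bounded away from 0.\<close>

lemma difference_tendsto_0_iff:
  assumes M: "2 \<le> CARD('m)" and L: "0 \<le> L" "(\<lambda>N. ereal (ln (P N) / ln (real N))) \<longlonglongrightarrow> L"
  shows "(\<lambda>N. R_Opt \<Omega> H N (P N) - R_RBF \<Omega> H \<Phi> N (P N)) \<longlonglongrightarrow> 0 \<longleftrightarrow> L = 0"
proof -
  have P_ge: "eventually (\<lambda>N. real N powr c \<le> P N) sequentially" if "ereal c < L" for c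
    using order_tendstoD(1)[OF L(2) that] eventually_ln_pos eventually_gt_at_top[of 0]
  proof eventually_elim
    case (elim N)
    then have "c * ln (real N) < ln (P N)"
      by (simp add: less_divide_eq)
    then have "exp (c * ln (real N)) \<le> exp (ln (P N))"
      by simp
    then show ?case
      using elim P_pos[of N] by (simp add: powr_def)
  qed
  have P_le: "eventually (\<lambda>N. P N \<le> real N powr c) sequentially" if "L < ereal c" for c
    using order_tendstoD(2)[OF L(2) that] eventually_ln_pos eventually_gt_at_top[of 0]
  proof eventually_elim
    case (elim N)
    then have "ln (P N) < c * ln (real N)"
      by (simp add: divide_less_eq)
    then have "exp (ln (P N)) \<le> exp (c * ln (real N))"
      by simp
    then show ?case
      using elim P_pos[of N] by (simp add: powr_def)
  qed
  have away: "\<not> (\<lambda>N. R_Opt \<Omega> H N (P N) - R_RBF \<Omega> H \<Phi> N (P N)) \<longlonglongrightarrow> 0"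
    if "0 < \<kappa>" "eventually (\<lambda>N. \<kappa> \<le> R_Opt \<Omega> H N (P N) - R_RBF \<Omega> H \<Phi> N (P N)) sequentially" for \<kappa> :: real
  proof
    assume "(\<lambda>N. R_Opt \<Omega> H N (P N) - R_RBF \<Omega> H \<Phi> N (P N)) \<longlonglongrightarrow> 0"
    from tendsto_lowerbound[OF this that(2)] that(1) show False
      by simp
  qed
  show ?thesis
  proof (cases L)
    case (real l)
    show ?thesis
    proof (cases "l = 0")
      case True
      have "(\<lambda>N. R_Opt \<Omega> H N (P N) - R_RBF \<Omega> H \<Phi> N (P N)) \<longlonglongrightarrow> 0"
        by (rule difference_tendsto_0) (simp add: P_le real True)
      then show ?thesis
        by (simp add: real True)
    next
      case False
      then have l: "0 < l / 2" "ereal (l / 2) < L" "L < ereal (l + 1)"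
        using L(1) real by auto
      obtain \<kappa> where "0 < \<kappa>" "eventually (\<lambda>N. \<kappa> \<le> R_Opt \<Omega> H N (P N) - R_RBF \<Omega> H \<Phi> N (P N)) sequentially"
        using difference_ge_polynomial[OF M l(1) P_ge[OF l(2)] P_le[OF l(3)]] by blast
      from away[OF this] show ?thesis
        using False real by simp
    qed
  next
    case PInf
    then have "eventually (\<lambda>N. real N powr 6 \<le> P N) sequentially"
      by (intro P_ge) simp
    from away[OF zero_less_one difference_ge_superpolynomial[OF M this]] show ?thesis
      by (simp add: PInf)
  next
    case MInf
    with L(1) show ?thesis
      by simp
  qed
qed

end

end

theorem theorem9:
  fixes \<Omega> :: "'w measure"
    and H :: "nat \<Rightarrow> 'w \<Rightarrow> complex^'m^'k"
    and \<Phi> :: "'w \<Rightarrow> complex^'m^'m"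
    and P :: "nat \<Rightarrow> real"
  assumes "CARD('m) \<ge> 2"
    and "CARD('k) \<le> CARD('m)"
    and "mimo_broadcast_channel \<Omega> H \<Phi>"
    and "\<And>N. P N > 0"
    and "filterlim (\<lambda>N. P N * ln (real N)) at_top sequentially"
    and "\<exists>L::ereal. 0 \<le> L \<and> (\<lambda>N. ereal (ln (P N) / ln (real N))) \<longlonglongrightarrow> L"
  shows "((\<lambda>N. R_Opt \<Omega> H N (P N) - R_RBF \<Omega> H \<Phi> N (P N)) \<longlonglongrightarrow> 0) \<longleftrightarrow>
         \<not> Omega_lim (\<lambda>N. ln (P N)) (\<lambda>N. ln (real N))"
proof -
  interpret mimo_broadcast_channel \<Omega> H \<Phi>
    by fact
  obtain L :: ereal where L: "0 \<le> L" "(\<lambda>N. ereal (ln (P N) / ln (real N))) \<longlonglongrightarrow> L"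
    using assms(6) by blast
  \<comment> \<open>Since the limit of the quotient is unique, the positive limit demanded by
    \<open>Omega_lim\<close> can only be \<open>L\<close>.\<close>
  have "Omega_lim (\<lambda>N. ln (P N)) (\<lambda>N. ln (real N)) \<longleftrightarrow> 0 < L"
    unfolding Omega_lim_def using L(2) LIMSEQ_unique by blast
  then show ?thesis
    using difference_tendsto_0_iff[OF assms(4,5,1) L] L(1) by auto
qed

end
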